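(* Let $q$ be a prime power, $m$ a positive integer, and $\delta$ an integer with $2\le\delta\le q^m-1$. Let $\delta_{\max}=q^{m+[m\text{ even}]}-1-(q^2-2)[m\text{ even}]$. Then there exists a $q$-ary quantum stabilizer code $Q$ with parameters $$[[\,q^{2m}-1,\ q^{2m}-1-2m\lceil(\delta-1)(1-1/q^2)\rceil,\ d_Q\ge\delta\,]]_q$$ that is pure up to $\delta_{\max}+1$. Moreover, if $\mathcal{BCH}(q^{2m}-1,q^2;\delta)$ has true minimum distance $d$ with $d\le\delta_{\max}$, then $Q$ is a pure quantum code with minimum distance $d_Q=d$.
   Context: For a prime power $Q'$ and $M\ge1$, $\mathcal{BCH}(n,Q';\delta)$ with $n=Q'^M-1$ denotes the primitive, narrow-sense BCH code: with $\alpha$ primitive in $\mathbf{F}_{Q'^M}$ and $C_x=\{xQ'^k\bmod n\mid k\in\mathbf{Z}\}$, it is the cyclic code of length $n$ over $\mathbf{F}_{Q'}$ with generator polynomial $\prod_{z\in Z}(x-\alpha^z)$, $Z=C_1\cup\cdots\cup C_{\delta-1}$; here $Q'=q^2$, $M=m$. An $[[n,k,d]]_q$ quantum stabilizer code is a $q^k$-dimensional subspace of $(\mathbf{C}^q)^{\otimes n}$ that is the joint fixed space of an abelian subgroup $S$ of the $q$-ary Pauli error group on $n$ qudits, with minimum distance $d$ (the smallest weight of an error in the normalizer of $S$ but not in $S$, up to scalars). It is pure up to $t$ if $S$ contains no non-scalar element of weight less than $t$; pure if pure up to its minimum distance. Iverson notation: $[P]=1$ if $P$ holds, $0$ otherwise.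 *)

theory Defs
  imports "HOL-Analysis.Analysis" "HOL-Computational_Algebra.Polynomial" "HOL-Library.Function_Algebras"
begin

text \<open>The base field F_q is a finite field type 'a; q = CARD('a), p = CHAR('a).
  Absolute trace F_q \<rightarrow> F_p, with F_p identified with {0..<p} via of_nat.\<close>

definition ff_deg :: "'a::{finite,field} itself \<Rightarrow> nat" where
  "ff_deg _ = (THE r. CARD('a) = CHAR('a) ^ r)"

definition ftrace :: "'a::{finite,field} \<Rightarrow> 'a" where
  "ftrace x = (\<Sum>k<ff_deg TYPE('a). x ^ (CHAR('a) ^ k))"

definition trace_nat :: "'a::{finite,field} \<Rightarrow> nat" where
  "trace_nat x = (THE j. j < CHAR('a) \<and> of_nat j = ftrace x)"

definition omega :: "'a::{finite,field} itself \<Rightarrow> complex" where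
  "omega _ = exp (2 * pi * \<i> / of_nat CHAR('a))"

text \<open>Basis of (C^q)^{\<otimes> n}: vectors in F_q^n, encoded as functions nat \<Rightarrow> 'a vanishing from n on.
  A state is a function from basis vectors to complex amplitudes.\<close>

definition fvecs :: "nat \<Rightarrow> (nat \<Rightarrow> 'a::zero) set" where
  "fvecs n = {x. \<forall>i\<ge>n. x i = 0}"

type_synonym 'a state = "(nat \<Rightarrow> 'a) \<Rightarrow> complex"
type_synonym 'a qop = "'a state \<Rightarrow> 'a state"

definition hilbert :: "nat \<Rightarrow> 'a::{finite,field} state set" where
  "hilbert n = {\<psi>. \<forall>x. x \<notin> fvecs n \<longrightarrow> \<psi> x = 0}"

definition cscale :: "complex \<Rightarrow> 'a state \<Rightarrow> 'a state" where
  "cscale c \<psi> = (\<lambda>x. c * \<psi> x)"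

text \<open>Pauli error omega^c X(a) Z(b), where X(a)|x> = |x+a>, Z(b)|x> = omega^{tr(b.x)} |x>.\<close>

definition pauli :: "nat \<Rightarrow> nat \<Rightarrow> (nat \<Rightarrow> 'a) \<Rightarrow> (nat \<Rightarrow> 'a) \<Rightarrow> 'a::{finite,field} qop" where
  "pauli n c a b = (\<lambda>\<psi> x. omega TYPE('a) ^ c
       * omega TYPE('a) ^ trace_nat (\<Sum>i<n. b i * (x i - a i)) * \<psi> (\<lambda>i. x i - a i))"

definition pauli_group :: "nat \<Rightarrow> 'a::{finite,field} qop set" where
  "pauli_group n = {pauli n c a b | c a b. a \<in> fvecs n \<and> b \<in> fvecs n}"

definition scalars :: "nat \<Rightarrow> 'a::{finite,field} qop set" where
  "scalars n = {pauli n c (\<lambda>_. 0) (\<lambda>_. 0) | c. True}"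

definition symp_wt :: "nat \<Rightarrow> (nat \<Rightarrow> 'a::zero) \<Rightarrow> (nat \<Rightarrow> 'a) \<Rightarrow> nat" where
  "symp_wt n a b = card {i. i < n \<and> (a i \<noteq> 0 \<or> b i \<noteq> 0)}"

definition pauli_wt :: "nat \<Rightarrow> 'a::{finite,field} qop \<Rightarrow> nat" where
  "pauli_wt n E = (LEAST w. \<exists>c a b. a \<in> fvecs n \<and> b \<in> fvecs n \<and> E = pauli n c a b
                              \<and> w = symp_wt n a b)"

definition abelian_pauli_subgroup :: "nat \<Rightarrow> 'a::{finite,field} qop set \<Rightarrow> bool" where
  "abelian_pauli_subgroup n S \<longleftrightarrow> S \<subseteq> pauli_group n \<and> id \<in> S
     \<and> (\<forall>s\<in>S. \<forall>t\<in>S. s \<circ> t \<in> S)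
     \<and> (\<forall>s\<in>S. \<exists>t\<in>S. s \<circ> t = id \<and> t \<circ> s = id)
     \<and> (\<forall>s\<in>S. \<forall>t\<in>S. s \<circ> t = t \<circ> s)"

definition stab_code :: "nat \<Rightarrow> 'a::{finite,field} qop set \<Rightarrow> 'a state set" where
  "stab_code n S = {\<psi> \<in> hilbert n. \<forall>E\<in>S. E \<psi> = \<psi>}"

definition normalizer :: "nat \<Rightarrow> 'a::{finite,field} qop set \<Rightarrow> 'a qop set" where
  "normalizer n S = {E \<in> pauli_group n. \<forall>s\<in>S. \<exists>s'\<in>S. E \<circ> s = s' \<circ> E}"

definition scalar_S :: "nat \<Rightarrow> 'a::{finite,field} qop set \<Rightarrow> 'a qop set" where
  "scalar_S n S = {z \<circ> s | z s. z \<in> scalars n \<and> s \<in> S}"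

definition qmin_dist :: "nat \<Rightarrow> 'a::{finite,field} qop set \<Rightarrow> nat" where
  "qmin_dist n S = Inf (pauli_wt n ` (normalizer n S - scalar_S n S))"

definition pure_up_to :: "nat \<Rightarrow> 'a::{finite,field} qop set \<Rightarrow> nat \<Rightarrow> bool" where
  "pure_up_to n S t \<longleftrightarrow> (\<forall>E\<in>S. E \<notin> scalars n \<longrightarrow> pauli_wt n E \<ge> t)"

definition is_pure :: "nat \<Rightarrow> 'a::{finite,field} qop set \<Rightarrow> bool" where
  "is_pure n S \<longleftrightarrow> pure_up_to n S (qmin_dist n S)"

definition qdim :: "nat \<Rightarrow> 'a::{finite,field} qop set \<Rightarrow> nat" where
  "qdim n S = vector_space.dim (cscale :: complex \<Rightarrow> 'a state \<Rightarrow> 'a state) (stab_code n S)"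

text \<open>The field F_{Q'^M} is a finite field type 'b; F_{Q'} is its subfield {x. x^{Q'} = x}.
  Codewords are coefficient vectors c_0..c_{N-1} (c i = 0 for i \<ge> N).\<close>

definition cyclo_coset :: "nat \<Rightarrow> nat \<Rightarrow> nat \<Rightarrow> nat set" where
  "cyclo_coset Q N x = {x * Q ^ k mod N | k. True}"

definition bch_gen :: "nat \<Rightarrow> nat \<Rightarrow> 'b::{finite,field} \<Rightarrow> nat \<Rightarrow> 'b poly" where
  "bch_gen Q N \<alpha> \<delta> = (\<Prod>z\<in>(\<Union>x\<in>{1..<\<delta>}. cyclo_coset Q N x). [:- (\<alpha> ^ z), 1:])"

definition primitive_elt :: "'b::{finite,field} \<Rightarrow> bool" where
  "primitive_elt \<alpha> \<longleftrightarrow> (\<forall>x. x \<noteq> 0 \<longrightarrow> (\<exists>i. x = \<alpha> ^ i))"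

definition cw_poly :: "nat \<Rightarrow> (nat \<Rightarrow> 'b::comm_ring_1) \<Rightarrow> 'b poly" where
  "cw_poly N c = (\<Sum>i<N. monom (c i) i)"

definition bch_code :: "nat \<Rightarrow> 'b::{finite,field} \<Rightarrow> nat \<Rightarrow> (nat \<Rightarrow> 'b) set" where
  "bch_code Q \<alpha> \<delta> = (let N = CARD('b) - 1 in
     {c. (\<forall>i. c i ^ Q = c i) \<and> (\<forall>i\<ge>N. c i = 0) \<and>
         (\<exists>f. (\<forall>i. coeff f i ^ Q = coeff f i) \<and> cw_poly N c = f * bch_gen Q N \<alpha> \<delta>)})"

definition hamming_wt :: "nat \<Rightarrow> (nat \<Rightarrow> 'b::zero) \<Rightarrow> nat" where
  "hamming_wt N c = card {i. i < N \<and> c i \<noteq> 0}"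

definition bch_min_dist :: "nat \<Rightarrow> 'b::{finite,field} \<Rightarrow> nat \<Rightarrow> nat" where
  "bch_min_dist Q \<alpha> \<delta> = Inf {hamming_wt (CARD('b) - 1) c | c. c \<in> bch_code Q \<alpha> \<delta> \<and> c \<noteq> (\<lambda>_. 0)}"

end

theory Submission
  imports Defs "HOL-Computational_Algebra.Primes"
begin

text \<open>
  Embed the small field into the big one by \<open>\<iota>\<close> and choose \<open>\<gamma>\<close> in the subfield \<open>K\<close> of order \<open>q\<^sup>2\<close>,
  outside the image of \<open>\<iota>\<close>. The map \<open>(a, b) \<mapsto> \<iota> a + \<gamma> \<iota> b\<close> identifies pairs of vectors, that is
  Pauli errors up to phase, with vectors over \<open>K\<close>. Let \<open>C\<close> be the BCH code and \<open>D\<close> its dual for the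
  trace-symplectic form, which is the Hermitian dual because \<open>C\<close> is linear over \<open>K\<close>. Test words of
  trace type show that the words of \<open>D\<close> vanish at \<open>\<alpha>\<^sup>x\<close> for \<open>0 \<le> x \<le> \<delta>\<^sub>m\<^sub>a\<^sub>x\<close>, since
  \<open>q x + z q\<^bsup>2k\<^esup>\<close> is never divisible by \<open>q\<^bsup>2m\<^esup> - 1\<close> for \<open>1 \<le> z < \<delta>\<close>. Hence \<open>D\<close> lies in \<open>C\<close>, and the BCH
  bound gives the weights of both.

  The errors in \<open>D\<close> commute but have to be lifted to a group that meets the scalars trivially, using
  only phases that are \<open>p\<close>-th roots of unity. For \<open>p = 2\<close> this needs every lifted error to square to the
  identity, which holds because the words of \<open>D\<close> also vanish at 1 and the length is odd. The
  normalizer is then \<open>C\<close> up to phases, and the dimension follows from counting orbits of a monomial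
  action.
\<close>

section \<open>Finite fields\<close>

text \<open>Two obstacles shape the development. The fields are unrelated types, compared only
  through their orders, so nothing maps \<open>'a\<close> into \<open>'b\<close> until a
  homomorphism has been built by hand. In characteristic 2 the admissible phases are just signs: an
  error \<open>X(a) Z(b)\<close> whose square is -1 cannot be corrected by a factor of order 4, so
  its vector must be shown not to occur in \<open>D\<close>.

  The parameters come from counting. Below \<open>q ^ m - 1\<close> the exponents not divisible by
  \<open>q^2\<close> represent distinct cyclotomic cosets of full size \<open>m\<close>; this yields
  the degree of the generator polynomial, the order of \<open>D\<close> and the dimension
  \<open>q ^ n / card D\<close>. Undetectable errors correspond to the words of \<open>C\<close>
  outside \<open>D\<close>. The words of \<open>D\<close> are heavier than \<delta>max, so a word of
  \<open>C\<close> of weight \<open>d \<le> \<delta>max\<close> lies outside \<open>D\<close>; this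
  is why the quantum distance equals \<open>d\<close> and the code is pure in that range.\<close>

lemma prime_CHAR_finite_field: "prime CHAR('a::{finite,field})"
  by (intro prime_CHAR_semidom finite_imp_CHAR_pos) simp

lemma CARD_field_ge_2: "CARD('a::{finite,field}) \<ge> 2"
proof -
  have "card {0, 1::'a} \<le> CARD('a)" by (rule card_mono) auto
  then show ?thesis by simp
qed

lemma power_CARD_minus_1:
  fixes x :: "'a::{finite,field}"
  assumes "x \<noteq> 0"
  shows "x ^ (CARD('a) - 1) = 1"
proof -
  have "(\<Prod>y\<in>UNIV-{0}. x * y) = (\<Prod>y\<in>UNIV-{0}. y)"
    by (rule prod.reindex_bij_witness[of _ "\<lambda>y. y / x" "\<lambda>y. x * y"]) (use assms in auto)
  then have "x ^ (CARD('a) - 1) * \<Prod>(UNIV-{0::'a}) = \<Prod>(UNIV-{0::'a})"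
    by (simp add: prod.distrib)
  then show ?thesis by simp
qed

lemma power_CARD_eq_self:
  fixes x :: "'a::{finite,field}"
  shows "x ^ CARD('a) = x"
proof (cases "x = 0")
  case False
  have "x ^ Suc (CARD('a) - 1) = x" 
    by (simp only: power_Suc power_CARD_minus_1[OF False] mult_1_right)
  moreover have "Suc (CARD('a) - 1) = CARD('a)" using CARD_field_ge_2[where 'a='a] by simp
  ultimately show ?thesis by metis
qed (use CARD_field_ge_2[where 'a='a] in auto)

lemma card_power_fixed_le:
  assumes "k \<ge> 2"
  shows "card {x::'a::field. x ^ k = x} \<le> k"
proof -
  let ?f = "monom 1 k - monom 1 1 :: 'a poly"
  have "coeff ?f k = 1" using assms by simp
  then have nz: "?f \<noteq> 0" by (metis coeff_0 zero_neq_one)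
  have "{x::'a. x ^ k = x} = {x. poly ?f x = 0}" by (auto simp: poly_monom)
  then have "card {x::'a. x ^ k = x} \<le> degree ?f" using card_poly_roots_bound[OF nz] by simp
  also have "\<dots> \<le> k" using assms by (intro degree_diff_le order.trans[OF degree_monom_le]) auto
  finally show ?thesis .
qed

text \<open>The inverse of a nonzero element is its power with exponent \<open>CARD('a) - 2\<close>,
  so the inverse of the image of \<open>d\<close> is again the image of a natural number. Closure
  under addition therefore suffices to divide by \<open>d\<close>.\<close>

lemma inverse_of_nat_finite_field:
  assumes "(of_nat d :: 'a::{finite,field}) \<noteq> 0"
  obtains c where "of_nat c * of_nat d = (1::'a)"
proof
  show "of_nat (d ^ (CARD('a) - 2)) * of_nat d = (1::'a)"
  proof -
    have "of_nat (d ^ (CARD('a) - 2)) * of_nat d = (of_nat d :: 'a) ^ Suc (CARD('a) - 2)"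
      by simp
    also have "Suc (CARD('a) - 2) = CARD('a) - 1" using CARD_field_ge_2[where 'a='a] by simp
    finally show ?thesis using power_CARD_minus_1[OF assms] by simp
  qed
qed

lemma of_nat_mod_CHAR_eq: "(of_nat (j mod CHAR('a)) :: 'a::{finite,field}) = of_nat j"
proof -
  have "of_nat j = (of_nat (j div CHAR('a) * CHAR('a) + j mod CHAR('a)) :: 'a)" by simp
  also have "\<dots> = of_nat (j mod CHAR('a))" unfolding of_nat_add of_nat_mult by simp
  finally show ?thesis ..
qed

text \<open>A predicate on plain sets, since it is applied alike to subsets of a field, to sets of
  vectors and to sets of pairs of vectors.\<close>

definition add_subgroup :: "'v::ab_group_add set \<Rightarrow> bool" where
  "add_subgroup W \<longleftrightarrow> 0 \<in> W \<and> (\<forall>u\<in>W. \<forall>v\<in>W. u + v \<in> W) \<and> (\<forall>u\<in>W. - u \<in> W)"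

lemma add_subgroupD:
  assumes "add_subgroup W"
  shows "0 \<in> W" "u \<in> W \<Longrightarrow> v \<in> W \<Longrightarrow> u + v \<in> W" "u \<in> W \<Longrightarrow> - u \<in> W"
    "u \<in> W \<Longrightarrow> v \<in> W \<Longrightarrow> u - v \<in> W"
  using assms unfolding add_subgroup_def by (auto simp only: diff_conv_add_uminus)

lemma add_subgroup_of_nat_mult:
  fixes W :: "'a::ring_1 set"
  assumes "add_subgroup W" "w \<in> W"
  shows "of_nat c * w \<in> W"
  using assms by (induction c) (auto simp: add_subgroup_def distrib_right)

text \<open>A proper additive subgroup of prime power order is enlarged by adjoining the multiples of
  an outside element, so one of maximal order is the whole field.\<close>

lemma CARD_eq_CHAR_power: "\<exists>r. CARD('a::{finite,field}) = CHAR('a) ^ r"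
proof -
  let ?p = "CHAR('a)"
  define \<W> where "\<W> = {W::'a set. add_subgroup W \<and> (\<exists>k. card W = ?p ^ k)}"
  have "{0} \<in> \<W>" unfolding \<W>_def by (auto simp: add_subgroup_def intro: exI[of _ 0])
  moreover have "finite \<W>" by simp
  ultimately have "Max (card ` \<W>) \<in> card ` \<W>" "\<And>V. V \<in> \<W> \<Longrightarrow> card V \<le> Max (card ` \<W>)"
    by (auto intro!: Max_in)
  then obtain W where W: "W \<in> \<W>" and max: "\<And>V. V \<in> \<W> \<Longrightarrow> card V \<le> card W"
    by (metis (no_types, lifting) imageE)
  from W obtain k where sg: "add_subgroup W" and k: "card W = ?p ^ k" unfolding \<W>_def by auto
  note sgD = add_subgroupD[OF sg] and mult = add_subgroup_of_nat_mult[OF sg]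
  have "W = UNIV"
  proof (rule ccontr)
    assume "W \<noteq> UNIV"
    then obtain e where e: "e \<notin> W" by auto
    have prime: "prime ?p" by (rule prime_CHAR_finite_field)
    define f where "f = (\<lambda>(j::nat, w). of_nat j * e + w)"
    define V where "V = f ` ({..<?p} \<times> W)"
    have mem: "of_nat j * e + w \<in> V" if "w \<in> W" for j w
    proof -
      have "of_nat j * e + w = f (j mod ?p, w)" by (simp add: f_def of_nat_mod_CHAR_eq)
      then show ?thesis using that prime_gt_0_nat[OF prime] unfolding V_def by auto
    qed
    \<comment> \<open>If \<open>i < j\<close>, then \<open>(j - i) e\<close> would lie in
      \<open>W\<close>; as \<open>j - i\<close> is invertible in the field, so would
      \<open>e\<close>. One inequality is enough, the roles being exchangeable.\<close>
    have eq: "i \<ge> j" if "of_nat i * e + w = of_nat j * e + v" "w \<in> W" "v \<in> W" "j < ?p" for i j w v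
    proof (rule ccontr)
      assume "\<not> i \<ge> j"
      then have less: "i < j" by simp
      have "(of_nat (j - i) :: 'a) \<noteq> 0" using less that(4)
        by (metis diff_le_self dvd_imp_le leD le_less_trans of_nat_eq_0_iff_char_dvd zero_less_diff)
      then obtain c where c: "of_nat c * of_nat (j - i) = (1::'a)" by (rule inverse_of_nat_finite_field)
      have "of_nat (j - i) * e = w - v" using that(1) less by (simp add: of_nat_diff algebra_simps)
      then have "of_nat (j - i) * e \<in> W" using sgD(4) that by simp
      then have "of_nat c * (of_nat (j - i) * e) \<in> W" by (rule mult)
      then show False using e c by (simp add: mult.assoc[symmetric])
    qed
    have "inj_on f ({..<?p} \<times> W)"
    proof (rule inj_onI, clarify)
      fix i w j v assume *: "i < ?p" "j < ?p" "w \<in> W" "v \<in> W" "f (i, w) = f (j, v)"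
      then have "i = j" using eq[of i w j v] eq[of j v i w] by (auto simp: f_def)
      then show "i = j \<and> w = v" using * by (auto simp: f_def)
    qed
    then have card: "card V = ?p * card W" unfolding V_def by (simp add: card_image card_cartesian_product)
    have "add_subgroup V"
      unfolding add_subgroup_def
    proof (intro conjI ballI)
      show "0 \<in> V" using mem[of 0 0] sgD(1) by simp
      fix u assume "u \<in> V"
      then obtain i w where u: "u = of_nat i * e + w" "w \<in> W" "i < ?p" unfolding V_def f_def by auto
      have "- u = of_nat (?p - i) * e + (- w)" using u by (simp add: of_nat_diff algebra_simps)
      then show "- u \<in> V" using mem[OF sgD(3)[OF u(2)]] by metis
      fix v assume "v \<in> V"
      then obtain j x where v: "v = of_nat j * e + x" "x \<in> W" unfolding V_def f_def by auto
      have "u + v = of_nat (i + j) * e + (w + x)" using u v by (simp add: algebra_simps)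
      then show "u + v \<in> V" using mem[OF sgD(2)[OF u(2) v(2)]] by metis
    qed
    moreover have "card V = ?p ^ Suc k" using card k by simp
    ultimately have "V \<in> \<W>" unfolding \<W>_def by blast
    then have "card V \<le> card W" by (rule max)
    then show False using card k prime_gt_1_nat[OF prime] by simp
  qed
  then show ?thesis using k by auto
qed

lemma CARD_eq_CHAR_power_ff_deg: "CARD('a::{finite,field}) = CHAR('a) ^ ff_deg TYPE('a)"
proof -
  obtain r where r: "CARD('a) = CHAR('a) ^ r" using CARD_eq_CHAR_power by blast
  have "ff_deg TYPE('a) = r"
    unfolding ff_deg_def
    by (rule the_equality)
      (use r prime_gt_1_nat[OF prime_CHAR_finite_field[where 'a='a]] in auto)
  then show ?thesis using r by simp
qed

lemma ff_deg_pos: "ff_deg TYPE('a::{finite,field}) > 0"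
  using CARD_eq_CHAR_power_ff_deg[where 'a='a] CARD_field_ge_2[where 'a='a]
  by (cases "ff_deg TYPE('a)") auto

lemma power_CHAR_power_add:
  "(x + y :: 'a::{finite,field}) ^ (CHAR('a) ^ k) = x ^ (CHAR('a) ^ k) + y ^ (CHAR('a) ^ k)"
  by (rule freshmans_dream'[OF prime_CHAR_finite_field refl])

lemma power_CHAR_power_sum:
  fixes f :: "'i \<Rightarrow> 'a::{finite,field}"
  shows "sum f A ^ (CHAR('a) ^ k) = (\<Sum>i\<in>A. f i ^ (CHAR('a) ^ k))"
  by (rule freshmans_dream_sum'[OF prime_CHAR_finite_field refl])

text \<open>As a polynomial the trace has degree at most \<open>Q ^ (m - 1)\<close>, so it cannot vanish
  everywhere.\<close>

lemma trace_sum_not_zero: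
  assumes "CARD('a::{finite,field}) = Q ^ m" "Q \<ge> 2" "m > 0"
  obtains x :: "'a::{finite,field}" where "(\<Sum>j<m. x ^ (Q ^ j)) \<noteq> 0"
proof -
  let ?f = "\<Sum>j<m. monom 1 (Q ^ j) :: 'a poly"
  have "coeff ?f 1 = (\<Sum>j<m. if j = 0 then 1 else 0)"
    unfolding coeff_sum coeff_monom using assms(2) by (intro sum.cong) auto
  also have "\<dots> = 1" using assms(3) by simp
  finally have nz: "?f \<noteq> 0" by (metis coeff_0 zero_neq_one)
  have "degree ?f \<le> Q ^ (m - 1)"
    using assms by (intro degree_sum_le) (auto intro!: order.trans[OF degree_monom_le] power_increasing)
  also have "\<dots> < Q ^ m" using assms by (intro power_strict_increasing) auto
  finally have "card {x. poly ?f x = 0} < CARD('a)"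
    using card_poly_roots_bound[OF nz] assms(1) by simp
  then have "{x. poly ?f x = 0} \<noteq> UNIV" by (metis less_irrefl)
  then obtain x where "poly ?f x \<noteq> 0" by auto
  then show ?thesis using that[of x] by (simp add: poly_sum poly_monom)
qed

lemma ftrace_add: "ftrace (x + y :: 'a::{finite,field}) = ftrace x + ftrace y"
  unfolding ftrace_def by (simp add: power_CHAR_power_add sum.distrib)

text \<open>Frobenius shifts the summands cyclically because \<open>x ^ CARD('a) = x\<close>. Adding
  \<open>x\<close> to both sides turns the shift into two readings of one longer sum.\<close>

lemma ftrace_power_CHAR:
  fixes x :: "'a::{finite,field}"
  shows "ftrace x ^ CHAR('a) = ftrace x"
proof -
  let ?p = "CHAR('a)" and ?r = "ff_deg TYPE('a)"
  have "ftrace x ^ ?p = (\<Sum>k<?r. x ^ (?p ^ Suc k))"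
    using power_CHAR_power_sum[of "\<lambda>k. x ^ (?p ^ k)" "{..<?r}" 1] unfolding ftrace_def
    by (simp add: power_mult[symmetric] mult.commute)
  also have "\<dots> + x = (\<Sum>k<Suc ?r. x ^ (?p ^ k))"
    by (subst sum.lessThan_Suc_shift) simp
  also have "\<dots> = ftrace x + x"
    using power_CARD_eq_self[of x] CARD_eq_CHAR_power_ff_deg[where 'a='a] by (simp add: ftrace_def)
  finally show ?thesis by simp
qed

lemma inj_on_of_nat_CHAR: "inj_on (of_nat :: nat \<Rightarrow> 'a::{finite,field}) {..<CHAR('a)}"
proof (rule linorder_inj_onI')
  fix i j assume "i \<in> {..<CHAR('a)}" "j \<in> {..<CHAR('a)}" "i < j"
  then show "(of_nat i :: 'a) \<noteq> of_nat j"
    by (metis diff_le_self dvd_imp_le leD lessThan_iff of_nat_eq_iff_char_dvd order.strict_trans1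
        zero_less_diff)
qed

text \<open>The prime field supplies \<open>CHAR('a)\<close> solutions of an equation that has at
  most that many.\<close>

lemma power_CHAR_fixed_iff:
  "(x::'a::{finite,field}) ^ CHAR('a) = x \<longleftrightarrow> x \<in> of_nat ` {..<CHAR('a)}"
proof -
  let ?p = "CHAR('a)"
  have sub: "of_nat ` {..<?p} \<subseteq> {x::'a. x ^ ?p = x}"
  proof clarify
    fix j :: nat
    have "(\<Sum>i<j. 1::'a) ^ (?p ^ 1) = (\<Sum>i<j. 1 ^ (?p ^ 1))" by (rule power_CHAR_power_sum)
    then show "(of_nat j :: 'a) ^ ?p = of_nat j" by simp
  qed
  have "card {x::'a. x ^ ?p = x} \<le> ?p"
    using prime_ge_2_nat[OF prime_CHAR_finite_field[where 'a='a]] by (rule card_power_fixed_le)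
  also have "?p = card ((of_nat :: nat \<Rightarrow> 'a) ` {..<?p})"
    by (simp add: card_image inj_on_of_nat_CHAR)
  finally have "of_nat ` {..<?p} = {x::'a. x ^ ?p = x}" using sub by (intro card_seteq) auto
  then show ?thesis by auto
qed

text \<open>Makes the definite description in \<open>trace_nat\<close> meaningful: the trace is
  fixed by Frobenius, hence lies in the prime field, whose elements have unique representatives
  below the characteristic.\<close>

lemma trace_nat:
  fixes x :: "'a::{finite,field}"
  shows "trace_nat x < CHAR('a) \<and> of_nat (trace_nat x) = ftrace x"
  unfolding trace_nat_def
proof (rule theI')
  have "ftrace x \<in> of_nat ` {..<CHAR('a)}"
    using ftrace_power_CHAR power_CHAR_fixed_iff by blast
  then show "\<exists>!j. j < CHAR('a) \<and> of_nat j = ftrace x"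
    using inj_on_of_nat_CHAR[where 'a='a] by (auto simp: inj_on_def)
qed

section \<open>Additive characters\<close>

lemma omega_power_eq_iff:
  "omega TYPE('a::{finite,field}) ^ i = omega TYPE('a) ^ j \<longleftrightarrow> (of_nat i :: 'a) = of_nat j"
proof -
  let ?p = "CHAR('a)"
  have p: "?p \<ge> 1" using prime_ge_1_nat[OF prime_CHAR_finite_field] .
  have *: "omega TYPE('a) ^ k = exp (2 * of_real pi * \<i> * of_nat k / of_nat ?p)" for k
    unfolding omega_def by (simp add: exp_of_nat_mult[symmetric] field_simps)
  have "omega TYPE('a) ^ i = omega TYPE('a) ^ j \<longleftrightarrow> i mod ?p = j mod ?p"
    unfolding * by (rule complex_root_unity_eq[OF p])
  also have "\<dots> \<longleftrightarrow> (of_nat (i mod ?p) :: 'a) = of_nat (j mod ?p)"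
    using inj_on_of_nat_CHAR[where 'a='a] p by (auto simp: inj_on_def)
  finally show ?thesis by (simp add: of_nat_mod_CHAR_eq)
qed

text \<open>The canonical additive character of the field. The phases that arise from composing
  Pauli errors are its values.\<close>

definition chi :: "'a::{finite,field} \<Rightarrow> complex" where
  "chi x = omega TYPE('a) ^ trace_nat x"

lemma chi_0 [simp]: "chi 0 = 1"
proof -
  have "ftrace (0::'a) = 0" using ftrace_add[of "0::'a" 0] by (metis add_0 add_cancel_left_right)
  then have "omega TYPE('a) ^ trace_nat (0::'a) = omega TYPE('a) ^ 0"
    unfolding omega_power_eq_iff using trace_nat[of "0::'a"] by simp
  then show ?thesis by (simp add: chi_def)
qed

lemma chi_add: "chi (x + y :: 'a::{finite,field}) = chi x * chi y"
  unfolding chi_def power_add[symmetric] omega_power_eq_iff of_nat_add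
  using trace_nat[of x] trace_nat[of y] trace_nat[of "x + y"] by (simp add: ftrace_add)

lemma omega_nonzero [simp]: "omega TYPE('a::{finite,field}) \<noteq> 0"
  by (simp add: omega_def)

lemma chi_nonzero [simp]: "chi x \<noteq> 0"
  by (simp add: chi_def)

lemma chi_minus: "chi (- x) = inverse (chi x)"
  using chi_add[of x "- x"] by (simp add: field_simps)

lemma chi_diff: "chi (x - y) = chi x / chi y"
  using chi_add[of x "- y"] by (simp add: chi_minus field_simps)

lemma chi_eq_1_iff: "chi x = 1 \<longleftrightarrow> ftrace x = 0"
  unfolding chi_def using omega_power_eq_iff[of "trace_nat x" 0] trace_nat[of x]
  by auto

lemma chi_power_CHAR: "chi (x::'a::{finite,field}) ^ CHAR('a) = 1"
proof -
  have "omega TYPE('a) ^ (trace_nat x * CHAR('a)) = omega TYPE('a) ^ 0"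
    unfolding omega_power_eq_iff by simp
  then show ?thesis by (simp add: chi_def power_mult)
qed

text \<open>The multiples of a nonzero \<open>x\<close> exhaust the field, on which the trace does
  not vanish identically.\<close>

lemma chi_nontrivial:
  fixes x :: "'a::{finite,field}"
  assumes "\<And>c. chi (c * x) = 1"
  shows "x = 0"
proof (rule ccontr)
  assume x: "x \<noteq> 0"
  obtain y :: 'a where y: "(\<Sum>j<ff_deg TYPE('a). y ^ (CHAR('a) ^ j)) \<noteq> 0"
    by (rule trace_sum_not_zero[OF CARD_eq_CHAR_power_ff_deg
          prime_ge_2_nat[OF prime_CHAR_finite_field] ff_deg_pos])
  have "chi (y / x * x) = 1" by (rule assms)
  then show False using y x by (simp add: chi_eq_1_iff ftrace_def)
qed

section \<open>Powers of a primitive element\<close>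

lemma primitive_elt_nonzero:
  fixes \<alpha> :: "'b::{finite,field}"
  assumes "primitive_elt \<alpha>" "CARD('b) > 2"
  shows "\<alpha> \<noteq> 0"
proof
  assume "\<alpha> = 0"
  \<comment> \<open>As \<open>0 ^ 0 = 1\<close>, the element 0 satisfies
    \<open>primitive_elt\<close> in a field with two elements; this is the reason for the bound on
    the order.\<close>
  then have "UNIV \<subseteq> {0, 1::'b}"
    using assms(1) unfolding primitive_elt_def by (auto simp: power_0_left split: if_splits)
  then have "CARD('b) \<le> card {0, 1::'b}" by (intro card_mono) auto
  then show False using assms(2) by simp
qed

lemma power_mod_CARD_minus_1:
  fixes \<alpha> :: "'b::{finite,field}"
  assumes "\<alpha> \<noteq> 0"
  shows "\<alpha> ^ (i mod (CARD('b) - 1)) = \<alpha> ^ i"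
proof -
  let ?N = "CARD('b) - 1"
  have "\<alpha> ^ i = \<alpha> ^ (?N * (i div ?N) + i mod ?N)" by simp
  also have "\<dots> = \<alpha> ^ (i mod ?N)"
    by (simp only: power_add power_mult power_CARD_minus_1[OF assms] power_one mult_1_left)
  finally show ?thesis ..
qed

text \<open>The first \<open>CARD('b) - 1\<close> powers cover all nonzero elements, so they are
  distinct by counting.\<close>

lemma primitive_elt_power_eq_iff:
  fixes \<alpha> :: "'b::{finite,field}"
  assumes "primitive_elt \<alpha>" "CARD('b) > 2"
  shows "\<alpha> ^ i = \<alpha> ^ j \<longleftrightarrow> i mod (CARD('b) - 1) = j mod (CARD('b) - 1)"
proof -
  let ?N = "CARD('b) - 1"
  note nz = primitive_elt_nonzero[OF assms]
  have "(\<lambda>i. \<alpha> ^ i) ` {..<?N} = UNIV - {0}"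
  proof (intro equalityI subsetI)
    fix x :: 'b assume "x \<in> UNIV - {0}"
    then obtain i where "x = \<alpha> ^ i" using assms(1) unfolding primitive_elt_def by auto
    then have "x = \<alpha> ^ (i mod ?N)" by (simp only: power_mod_CARD_minus_1[OF nz])
    then show "x \<in> (\<lambda>i. \<alpha> ^ i) ` {..<?N}" using assms(2) by auto
  qed (use nz in auto)
  then have "inj_on (\<lambda>i. \<alpha> ^ i) {..<?N}" by (intro eq_card_imp_inj_on) auto
  then have "\<alpha> ^ (i mod ?N) = \<alpha> ^ (j mod ?N) \<longleftrightarrow> i mod ?N = j mod ?N"
    using assms(2) by (auto simp: inj_on_def)
  then show ?thesis by (simp only: power_mod_CARD_minus_1[OF nz])
qed

section \<open>Embedding one finite field into another\<close>

lemma minus_1_dvd_power_minus_1: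
  fixes q :: nat
  assumes "q \<ge> 1"
  shows "q - 1 dvd q ^ k - 1"
proof (induction k)
  case (Suc k)
  have "q ^ Suc k - 1 = q * (q ^ k - 1) + (q - 1)"
    using assms by (simp add: algebra_simps)
  then show ?case using Suc by (metis dvd_add dvd_mult dvd_refl)
qed simp

text \<open>Integer polynomials stand in for polynomials over the common prime field: they can be
  mapped into both fields, while a polynomial over one cannot be evaluated in the other.\<close>

definition ipoly_map :: "int poly \<Rightarrow> 'c::comm_ring_1 poly" where
  "ipoly_map = map_poly of_int"

lemma coeff_ipoly_map [simp]: "coeff (ipoly_map f) i = of_int (coeff f i)"
  by (simp add: ipoly_map_def coeff_map_poly)

lemma ipoly_map_add: "ipoly_map (f + g) = ipoly_map f + ipoly_map g"
  and ipoly_map_diff: "ipoly_map (f - g) = ipoly_map f - ipoly_map g"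
  and ipoly_map_mult: "ipoly_map (f * g) = ipoly_map f * ipoly_map g"
  and ipoly_map_monom: "ipoly_map (monom c k) = monom (of_int c) k"
  by (auto intro!: poly_eqI simp: coeff_mult)

lemma ipoly_map_1: "ipoly_map 1 = 1"
  by (intro poly_eqI) (simp add: coeff_1)

lemma ipoly_map_power: "ipoly_map (f ^ k) = ipoly_map f ^ k"
  by (induction k) (simp_all add: ipoly_map_1 ipoly_map_mult)

lemma CHAR_eq_of_CARD_power:
  assumes "CARD('b::{finite,field}) = CARD('a::{finite,field}) ^ k"
  shows "CHAR('b) = CHAR('a)"
proof -
  have "CHAR('b) dvd CARD('b)"
    using CARD_eq_CHAR_power_ff_deg[where 'a='b] ff_deg_pos[where 'a='b] by (simp add: dvd_power)
  then have "CHAR('b) dvd CHAR('a) ^ (ff_deg TYPE('a) * k)"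
    using assms CARD_eq_CHAR_power_ff_deg[where 'a='a] by (simp add: power_mult)
  then have "CHAR('b) dvd CHAR('a)" by (rule prime_dvd_power[OF prime_CHAR_finite_field])
  then show ?thesis by (rule primes_dvd_imp_eq[OF prime_CHAR_finite_field prime_CHAR_finite_field])
qed

text \<open>If \<open>h\<close> generates the multiplicative group of the subfield with \<open>q\<close> elements, then a monic
  integer polynomial of least degree vanishing at \<open>h\<close> divides \<open>X^q - X\<close> modulo \<open>p\<close>, hence has a root
  \<open>g\<close> in the other field with \<open>q\<close> elements; sending \<open>g\<close> to \<open>h\<close> defines the embedding.\<close>

lemma finite_field_embedding:
  fixes \<alpha> :: "'b::{finite,field}"
  assumes card: "CARD('b) = CARD('a::{finite,field}) ^ k" and "k > 0" and gt2: "CARD('b) > 2"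
    and prim: "primitive_elt \<alpha>"
  obtains \<iota> :: "'a::{finite,field} \<Rightarrow> 'b"
  where "\<iota> 1 = 1" "\<And>x y. \<iota> (x + y) = \<iota> x + \<iota> y" "\<And>x y. \<iota> (x * y) = \<iota> x * \<iota> y" "inj \<iota>"
proof -
  define q where "q = CARD('a)"
  define N where "N = CARD('b) - 1"
  have q2: "q \<ge> 2" unfolding q_def by (rule CARD_field_ge_2)
  have CHAR: "CHAR('b) = CHAR('a)" by (rule CHAR_eq_of_CARD_power[OF card])
  \<comment> \<open>This exponent gives \<open>h\<close> the order \<open>q - 1\<close>.\<close>
  define s where "s = N div (q - 1)"
  have N: "N = s * (q - 1)"
    using minus_1_dvd_power_minus_1[of q k] q2 card unfolding s_def N_def q_def by simp
  have N0: "N > 0" using gt2 by (simp add: N_def)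
  have s0: "s > 0" using N N0 by (cases s) auto
  define h where "h = \<alpha> ^ s"
  have h0: "h \<noteq> 0" using primitive_elt_nonzero[OF prim gt2] by (simp add: h_def)
  have h_inj: "i = j" if "h ^ i = h ^ j" "i < q - 1" "j < q - 1" for i j
  proof -
    have "s * i < N" "s * j < N" using that s0 N by auto
    then show ?thesis
      using that(1) s0 primitive_elt_power_eq_iff[OF prim gt2, of "s * i" "s * j"]
      unfolding N_def[symmetric] by (simp add: h_def power_mult[symmetric])
  qed
  have "h ^ (q - 1) = 1"
    using power_CARD_minus_1[OF primitive_elt_nonzero[OF prim gt2]] N
    unfolding N_def by (simp add: h_def power_mult[symmetric])
  then have "h ^ Suc (q - 1) = h" by (simp only: power_Suc mult_1_right)
  moreover have "Suc (q - 1) = q" using q2 by simp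
  ultimately have hq: "h ^ q = h" by simp
  define M where "M = {f::int poly. lead_coeff f = 1 \<and> poly (ipoly_map f) h = 0}"
  define F where "F = (monom 1 q - monom 1 1 :: int poly)"
  have F_deg: "degree F = q" and F_lead: "lead_coeff F = 1"
  proof -
    have "degree F \<le> q" unfolding F_def using q2
      by (intro degree_diff_le order.trans[OF degree_monom_le]) auto
    moreover have "coeff F q = 1" using q2 by (simp add: F_def)
    ultimately show "degree F = q" by (metis le_antisym le_degree zero_neq_one)
    then show "lead_coeff F = 1" using \<open>coeff F q = 1\<close> by simp
  qed
  have "F \<in> M" unfolding M_def using F_lead hq
    by (simp add: F_def ipoly_map_diff ipoly_map_monom poly_monom)
  then obtain f0 where f0M: "f0 \<in> M" and f0_min: "\<And>f. f \<in> M \<Longrightarrow> degree f0 \<le> degree f"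
    using ex_has_least_nat[of "\<lambda>f. f \<in> M" F degree] by blast
  have f0_lead: "lead_coeff f0 = 1" and f0_h: "poly (ipoly_map f0) h = 0"
    using f0M by (auto simp: M_def)
  have f0_deg: "degree f0 > 0"
  proof (rule ccontr)
    assume "\<not> degree f0 > 0"
    then obtain c where "f0 = [:c:]" using degree_eq_zeroE by blast
    then have "f0 = [:1:]" using f0_lead by simp
    then show False using f0_h by (simp add: ipoly_map_def map_poly_pCons)
  qed
  have deg_less: "degree f < d" if "degree f \<le> d" "coeff f d = 0" "d > 0" for f :: "int poly" and d
    using that leading_coeff_0_iff[of f] by (cases "degree f = d") auto
  \<comment> \<open>Division by \<open>f0\<close> modulo the characteristic, by induction on the
    degree. A leading coefficient divisible by the characteristic is dropped; any other can be made
    1 by a Bezout correction, so minimality of \<open>f0\<close> rules out a smaller degree and a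
    multiple of \<open>f0\<close> can be subtracted.\<close>
  have divides: "\<exists>t. ipoly_map f = ipoly_map f0 * (t :: 'a poly)" if "poly (ipoly_map f) h = 0" for f
    using that
  proof (induction "degree f" arbitrary: f rule: less_induct)
    case (less f)
    define a where "a = lead_coeff f"
    define d where "d = degree f"
    show ?case
    proof (cases "int CHAR('a) dvd a")
      case True
      then have a0: "of_int a = (0::'a)" "of_int a = (0::'b)"
        using CHAR by (simp_all add: of_int_eq_0_iff_char_dvd)
      define f' where "f' = f - monom a d"
      have eq: "ipoly_map f' = (ipoly_map f :: 'a poly)" "ipoly_map f' = (ipoly_map f :: 'b poly)"
        by (simp_all add: f'_def ipoly_map_diff ipoly_map_monom a0)
      show ?thesis
      proof (cases "d = 0")
        case True
        then have "f' = 0" unfolding f'_def a_def d_def by (auto intro!: poly_eqI simp: coeff_eq_0)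
        then have "ipoly_map f = (0 :: 'a poly)" using eq(1) by (simp add: ipoly_map_def)
        then show ?thesis by (intro exI[of _ 0]) simp
      next
        case False
        then have "degree f' < degree f"
          unfolding d_def[symmetric] f'_def
          by (intro deg_less degree_diff_le) (auto simp: degree_monom_le a_def d_def)
        then show ?thesis using less.hyps[of f'] less.prems eq by simp
      qed
    next
      case False
      moreover have "prime (int CHAR('a))" using prime_CHAR_finite_field[where 'a='a] by simp
      ultimately have "coprime (int CHAR('a)) a" by (intro prime_imp_coprime)
      then have "coprime a (int CHAR('a))" by (simp add: coprime_commute)
      then obtain b c where bc: "b * a + c * int CHAR('a) = 1"
        using bezout_int[of a "int CHAR('a)"] by auto
      have "\<not> d < degree f0"
      proof
        assume dlt: "d < degree f0"
        define f' where "f' = [:b:] * f + monom (c * int CHAR('a)) d"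
        have co: "coeff f' d = 1" using bc by (simp add: f'_def a_def d_def)
        moreover have "degree f' \<le> d"
          unfolding f'_def using degree_mult_le[of "[:b:]" f]
          by (intro degree_add_le) (auto simp: degree_monom_le d_def)
        ultimately have deg: "degree f' = d" by (metis le_antisym le_degree zero_neq_one)
        have z: "(of_int (c * int CHAR('a)) :: 'b) = 0"
          by (simp add: of_int_eq_0_iff_char_dvd CHAR del: of_int_mult)
        have "poly (ipoly_map f') h = 0"
          unfolding f'_def ipoly_map_add ipoly_map_mult ipoly_map_monom z using less.prems by simp
        then have "f' \<in> M" using co deg by (simp add: M_def)
        then show False using f0_min[of f'] deg dlt by simp
      qed
      then have dge: "degree f0 \<le> d" by simp
      define m where "m = monom a (d - degree f0)"
      define f' where "f' = f - m * f0"
      have "degree (m * f0) \<le> d"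
        using degree_mult_le[of m f0] degree_monom_le[of a "d - degree f0"] dge
        unfolding m_def by linarith
      moreover have "coeff (m * f0) d = a"
        unfolding m_def using dge f0_lead by (simp add: coeff_monom_mult)
      ultimately have "degree f' < degree f"
        unfolding d_def[symmetric] f'_def using f0_deg dge
        by (intro deg_less degree_diff_le) (auto simp: a_def d_def)
      moreover have "poly (ipoly_map f') h = 0"
        using less.prems f0_h by (simp add: f'_def ipoly_map_diff ipoly_map_mult)
      ultimately obtain t where "ipoly_map f' = ipoly_map f0 * (t::'a poly)" using less.hyps by blast
      then have "ipoly_map f = ipoly_map f0 * (t + ipoly_map m)"
        by (simp add: f'_def ipoly_map_diff ipoly_map_mult algebra_simps)
      then show ?thesis by blast
    qed
  qed
  \<comment> \<open>\<open>F\<close> is \<open>X^q - X\<close>, which vanishes on all of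
    \<open>'a\<close>. If \<open>f0\<close> had no root there, the cofactor would have
    \<open>q\<close> roots, more than its degree allows.\<close>
  have "\<exists>g::'a. poly (ipoly_map f0) g = 0"
  proof (rule ccontr)
    assume no: "\<nexists>g::'a. poly (ipoly_map f0) g = 0"
    obtain t where t: "ipoly_map F = ipoly_map f0 * (t::'a poly)"
      using divides[of F] \<open>F \<in> M\<close> by (auto simp: M_def)
    have monic: "coeff (ipoly_map f :: 'a poly) (degree f) = 1 \<and> degree (ipoly_map f :: 'a poly) = degree f"
      if "lead_coeff f = 1" for f
    proof
      show "coeff (ipoly_map f :: 'a poly) (degree f) = 1" using that by simp
      then have "degree f \<le> degree (ipoly_map f :: 'a poly)" by (intro le_degree) simp
      moreover have "degree (ipoly_map f :: 'a poly) \<le> degree f"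
        by (intro degree_le) (simp add: coeff_eq_0)
      ultimately show "degree (ipoly_map f :: 'a poly) = degree f" by simp
    qed
    have tnz: "t \<noteq> 0"
    proof
      assume "t = 0"
      then have "ipoly_map F = (0::'a poly)" using t by simp
      then show False using monic[OF F_lead] by simp
    qed
    moreover have "ipoly_map f0 \<noteq> (0 :: 'a poly)" using no by force
    ultimately have "degree t < q"
      using monic[OF F_lead] monic[OF f0_lead] F_deg f0_deg t by (simp add: degree_mult_eq)
    moreover have "poly t x = 0" for x
    proof -
      have "poly (ipoly_map F) x = 0"
        using power_CARD_eq_self[of x]
        by (simp add: F_def ipoly_map_diff ipoly_map_monom poly_monom q_def)
      then show ?thesis using t no by auto
    qed
    then have "{x. poly t x = 0} = UNIV" by auto
    ultimately show False using card_poly_roots_bound[OF tnz] by (simp add: q_def)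
  qed
  then obtain g :: 'a where g: "poly (ipoly_map f0) g = 0" ..
  have hg: "poly (ipoly_map f) g = 0" if "poly (ipoly_map f) h = 0" for f
    using divides[OF that] g by auto
  \<comment> \<open>The converse of \<open>hg\<close>. A nonzero value has \<open>N\<close>-th power
    1, so \<open>f(h) \<noteq> 0\<close> becomes the equation \<open>f(h) ^ N - 1 = 0\<close>, which
    \<open>hg\<close> carries over to \<open>g\<close>.\<close>
  have gh: "poly (ipoly_map f) h = 0" if "poly (ipoly_map f) g = 0" for f
  proof (rule ccontr)
    assume "poly (ipoly_map f) h \<noteq> 0"
    then have "poly (ipoly_map (f ^ N - 1)) h = 0"
      by (simp add: ipoly_map_diff ipoly_map_power ipoly_map_1 N_def
          power_CARD_minus_1[unfolded One_nat_def])
    then have "poly (ipoly_map (f ^ N - 1)) g = 0" by (rule hg)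
    then show False using that N0
      by (simp add: ipoly_map_diff ipoly_map_power ipoly_map_1 power_0_left)
  qed
  have g_inj: "inj_on (\<lambda>i. g ^ i) {..<q-1}"
  proof (rule inj_onI)
    fix i j assume ij: "i \<in> {..<q-1}" "j \<in> {..<q-1}" "g ^ i = g ^ j"
    then have "poly (ipoly_map (monom 1 i - monom 1 j)) g = 0"
      by (simp add: ipoly_map_diff ipoly_map_monom poly_monom)
    then have "h ^ i = h ^ j"
      using gh[of "monom 1 i - monom 1 j"] by (simp add: ipoly_map_diff ipoly_map_monom poly_monom)
    then show "i = j" using h_inj ij by auto
  qed
  have g0: "g \<noteq> 0"
    using gh[of "monom 1 1"] h0 by (auto simp: ipoly_map_monom poly_monom)
  have "card (insert 0 ((\<lambda>i. g ^ i) ` {..<q-1})) = q"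
    using g_inj g0 q2 by (subst card_insert_disjoint) (auto simp: card_image)
  then have "insert 0 ((\<lambda>i. g ^ i) ` {..<q-1}) = UNIV"
    unfolding q_def by (intro card_subset_eq) auto
  then have g_gen: "x = 0 \<or> (\<exists>i. x = g ^ i)" for x by blast
  have "\<exists>f. poly (ipoly_map f) g = x" for x
  proof (cases "x = 0")
    case True
    then show ?thesis by (intro exI[of _ 0]) (simp add: ipoly_map_def)
  next
    case False
    then obtain i where "x = g ^ i" using g_gen by blast
    then show ?thesis by (intro exI[of _ "monom 1 i"]) (simp add: ipoly_map_monom poly_monom)
  qed
  then obtain R where R: "\<And>x. poly (ipoly_map (R x)) g = x" by metis
  \<comment> \<open>Every element of \<open>'a\<close> is an integer polynomial in \<open>g\<close>;
    \<iota> evaluates the chosen polynomial at \<open>h\<close>. By \<open>gh\<close>, another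
    choice gives the same value.\<close>
  define \<iota> where "\<iota> x = poly (ipoly_map (R x)) h" for x
  have \<iota>: "\<iota> (poly (ipoly_map f) g) = poly (ipoly_map f) h" for f
    using gh[of "R (poly (ipoly_map f) g) - f"] by (simp add: R \<iota>_def ipoly_map_diff)
  show ?thesis
  proof (rule that[of \<iota>])
    show "\<iota> 1 = 1" using \<iota>[of 1] by (simp add: ipoly_map_1)
    show "\<iota> (x + y) = \<iota> x + \<iota> y" for x y
      using \<iota>[of "R x + R y"] by (simp add: ipoly_map_add R) (simp add: \<iota>_def)
    show "\<iota> (x * y) = \<iota> x * \<iota> y" for x y
      using \<iota>[of "R x * R y"] by (simp add: ipoly_map_mult R) (simp add: \<iota>_def)
    show "inj \<iota>"
    proof (rule injI)
      fix x y assume "\<iota> x = \<iota> y"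
      then have "poly (ipoly_map (R x - R y)) h = 0" by (simp add: \<iota>_def ipoly_map_diff)
      then have "poly (ipoly_map (R x - R y)) g = 0" by (rule hg)
      then show "x = y" by (simp add: ipoly_map_diff R)
    qed
  qed
qed

section \<open>The symplectic space\<close>

lemma card_vectors_over:
  assumes "finite (K :: 'c::zero set)"
  shows "card {x :: nat \<Rightarrow> 'c. (\<forall>i<n. x i \<in> K) \<and> (\<forall>i\<ge>n. x i = 0)} = card K ^ n"
    and "finite {x :: nat \<Rightarrow> 'c. (\<forall>i<n. x i \<in> K) \<and> (\<forall>i\<ge>n. x i = 0)}"
proof -
  let ?V = "{x :: nat \<Rightarrow> 'c. (\<forall>i<n. x i \<in> K) \<and> (\<forall>i\<ge>n. x i = 0)}"
  have "bij_betw (\<lambda>x. restrict x {..<n}) ?V ({..<n} \<rightarrow>\<^sub>E K)"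
    by (rule bij_betwI[where g="\<lambda>y i. if i < n then y i else 0"])
      (auto simp: fun_eq_iff PiE_iff extensional_def)
  moreover have "card ({..<n} \<rightarrow>\<^sub>E K) = card K ^ n" "finite ({..<n} \<rightarrow>\<^sub>E K)"
    using assms by (simp_all add: card_PiE finite_PiE)
  ultimately show "card ?V = card K ^ n" "finite ?V"
    by (simp_all add: bij_betw_same_card bij_betw_finite)
qed

lemma card_fvecs: "card (fvecs n :: (nat \<Rightarrow> 'a::{finite,zero}) set) = CARD('a) ^ n"
  and finite_fvecs: "finite (fvecs n :: (nat \<Rightarrow> 'a::{finite,zero}) set)"
  using card_vectors_over[of "UNIV :: 'a set" n] by (simp_all add: fvecs_def)

lemma fvecs_0 [simp]: "0 \<in> fvecs n"
  by (simp add: fvecs_def)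

lemma add_subgroup_fvecs: "add_subgroup (fvecs n :: (nat \<Rightarrow> 'a::ab_group_add) set)"
  by (auto simp: add_subgroup_def fvecs_def)

lemmas fvecs_add = add_subgroupD(2)[OF add_subgroup_fvecs]
  and fvecs_uminus = add_subgroupD(3)[OF add_subgroup_fvecs]
  and fvecs_diff = add_subgroupD(4)[OF add_subgroup_fvecs]

definition dot :: "nat \<Rightarrow> (nat \<Rightarrow> 'a::comm_ring_1) \<Rightarrow> (nat \<Rightarrow> 'a) \<Rightarrow> 'a" where
  "dot n x y = (\<Sum>i<n. x i * y i)"

lemma dot_commute: "dot n x y = dot n y x"
  by (simp add: dot_def mult.commute)

lemma dot_add_left: "dot n (x + y) z = dot n x z + dot n y z"
  and dot_add_right: "dot n z (x + y) = dot n z x + dot n z y"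
  and dot_diff_left: "dot n (x - y) z = dot n x z - dot n y z"
  and dot_diff_right: "dot n z (x - y) = dot n z x - dot n z y"
  and dot_zero_left [simp]: "dot n 0 z = 0"
  and dot_zero_right [simp]: "dot n z 0 = 0"
  by (simp_all add: dot_def sum.distrib sum_subtractf algebra_simps)

text \<open>Vectors supported on one coordinate, with an arbitrary entry there, reduce the claim to
  \<open>chi_nontrivial\<close>.\<close>

lemma chi_dot_nondegenerate:
  fixes b :: "nat \<Rightarrow> 'a::{finite,field}"
  assumes "b \<in> fvecs n" "\<And>x. x \<in> fvecs n \<Longrightarrow> chi (dot n b x) = 1"
  shows "b = 0"
proof
  fix i
  show "b i = 0 i"
  proof (cases "i < n")
    case True
    have "chi (c * b i) = 1" for c
    proof -
      have "dot n b (\<lambda>j. if j = i then c else 0) = (\<Sum>j<n. if j = i then b i * c else 0)"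
        unfolding dot_def by (intro sum.cong) auto
      also have "\<dots> = c * b i" using True by simp
      finally show ?thesis using assms(2)[of "\<lambda>j. if j = i then c else 0"] True by (simp add: fvecs_def)
    qed
    then show ?thesis using chi_nontrivial by auto
  qed (use assms(1) in \<open>auto simp: fvecs_def\<close>)
qed

text \<open>Translating by an element where \<open>f\<close> is not 1 multiplies the sum by that
  value, so the sum is 0. Multiplicativity is asked only on \<open>W\<close>, since a phase function
  is a character only on suitable subgroups.\<close>

lemma sum_character_subgroup:
  fixes f :: "'v::ab_group_add \<Rightarrow> complex"
  assumes W: "add_subgroup W" and mult: "\<And>u v. u \<in> W \<Longrightarrow> v \<in> W \<Longrightarrow> f (u + v) = f u * f v"
  shows "sum f W = (if \<forall>u\<in>W. f u = 1 then of_nat (card W) else 0)"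
proof (cases "\<forall>u\<in>W. f u = 1")
  case False
  then obtain u where u: "u \<in> W" "f u \<noteq> 1" by blast
  have "sum f W = (\<Sum>v\<in>W. f (u + v))"
    using u add_subgroupD[OF W]
    by (intro sum.reindex_bij_witness[of _ "\<lambda>v. u + v" "\<lambda>v. v - u"]) auto
  also have "\<dots> = f u * sum f W" using u by (simp add: mult sum_distrib_left)
  finally show ?thesis using u False by auto
qed simp

type_synonym 'a svec = "(nat \<Rightarrow> 'a) \<times> (nat \<Rightarrow> 'a)"

definition svecs :: "nat \<Rightarrow> 'a::zero svec set" where
  "svecs n = fvecs n \<times> fvecs n"

lemma add_subgroup_svecs: "add_subgroup (svecs n :: 'a::ab_group_add svec set)"
  by (auto simp: add_subgroup_def svecs_def mem_Times_iff intro: fvecs_add fvecs_uminus)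

lemma svecs_0 [simp]: "0 \<in> svecs n"
  by (simp add: svecs_def mem_Times_iff)

lemma finite_svecs: "finite (svecs n :: 'a::{finite,zero} svec set)"
  by (simp add: svecs_def finite_fvecs)

lemma card_svecs: "card (svecs n :: 'a::{finite,zero} svec set) = CARD('a) ^ (2 * n)"
  by (simp add: svecs_def card_cartesian_product card_fvecs mult_2 power_add)

text \<open>The commutator phase of two Pauli errors, which commute exactly when it is 1. Taking the
  form under \<open>chi\<close> makes orthogonality the trace-symplectic one, appropriate for sets
  that are merely additive.\<close>

definition sympc :: "nat \<Rightarrow> 'a::{finite,field} svec \<Rightarrow> 'a svec \<Rightarrow> complex" where
  "sympc n u v = chi (dot n (snd u) (fst v) - dot n (fst u) (snd v))"

lemma sympc_add_left: "sympc n (u + v) w = sympc n u w * sympc n v w"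
  and sympc_add_right: "sympc n w (u + v) = sympc n w u * sympc n w v"
  unfolding sympc_def chi_add[symmetric]
  by (simp_all add: dot_add_left dot_add_right algebra_simps)

lemma sympc_swap: "sympc n v u = inverse (sympc n u v)"
  by (simp add: sympc_def chi_minus[symmetric] dot_commute)

lemma sympc_uminus_right: "sympc n w (- u) = inverse (sympc n w u)"
  using sympc_add_right[of n w u "- u"] by (simp add: sympc_def field_simps)

definition orth :: "nat \<Rightarrow> 'a::{finite,field} svec set \<Rightarrow> 'a svec set" where
  "orth n C = {v \<in> svecs n. \<forall>u\<in>C. sympc n u v = 1}"

lemma sympc_nondegenerate:
  assumes "u \<in> svecs n" "\<And>v. v \<in> svecs n \<Longrightarrow> sympc n u v = 1"
  shows "u = 0"
proof -
  have "snd u = 0"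
  proof (rule chi_dot_nondegenerate)
    show "chi (dot n (snd u) x) = 1" if "x \<in> fvecs n" for x
      using assms(2)[of "(x, 0)"] that by (simp add: svecs_def sympc_def)
  qed (use assms(1) in \<open>auto simp: svecs_def\<close>)
  moreover have "fst u = 0"
  proof (rule chi_dot_nondegenerate)
    show "chi (dot n (fst u) x) = 1" if "x \<in> fvecs n" for x
      using assms(2)[of "(0, x)"] that by (simp add: svecs_def sympc_def chi_minus)
  qed (use assms(1) in \<open>auto simp: svecs_def\<close>)
  ultimately show ?thesis by (simp add: prod_eq_iff)
qed

lemma add_subgroup_orth: "add_subgroup (orth n C)"
  using add_subgroupD[OF add_subgroup_svecs[of n]]
  by (auto simp: add_subgroup_def orth_def sympc_add_right sympc_uminus_right)
    (simp add: sympc_def)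

text \<open>The sum of \<open>sympc\<close> over \<open>C\<close> and the whole space is evaluated
  in both orders: summing over \<open>C\<close> first leaves the orthogonal vectors, summing over
  the space first leaves only 0 by nondegeneracy.\<close>

lemma card_orth:
  fixes C :: "'a::{finite,field} svec set"
  assumes C: "add_subgroup C" "C \<subseteq> svecs n"
  shows "card C * card (orth n C) = CARD('a) ^ (2 * n)"
proof -
  let ?V = "svecs n :: 'a svec set"
  have finC: "finite C" using C(2) finite_svecs finite_subset by blast
  have "(\<Sum>v\<in>?V. \<Sum>u\<in>C. sympc n u v) = (\<Sum>v\<in>?V. if v \<in> orth n C then of_nat (card C) else 0)"
    by (intro sum.cong refl, subst sum_character_subgroup[OF C(1)])
      (auto simp: orth_def sympc_add_left)
  also have "\<dots> = of_nat (card (orth n C)) * of_nat (card C)"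
    using finite_svecs[where 'a='a] by (simp add: sum.If_cases orth_def Int_def)
  finally have 1: "(\<Sum>v\<in>?V. \<Sum>u\<in>C. sympc n u v) = of_nat (card (orth n C) * card C)" by simp
  have "(\<Sum>u\<in>C. \<Sum>v\<in>?V. sympc n u v) = (\<Sum>u\<in>C. if u = 0 then of_nat (card ?V) else 0)"
  proof (intro sum.cong refl)
    fix u assume u: "u \<in> C"
    have "(\<forall>v\<in>?V. sympc n u v = 1) \<longleftrightarrow> u = 0"
    proof
      assume "\<forall>v\<in>?V. sympc n u v = 1"
      then show "u = 0" using sympc_nondegenerate[of u n] u C(2) by blast
    qed (simp add: sympc_def)
    then show "(\<Sum>v\<in>?V. sympc n u v) = (if u = 0 then of_nat (card ?V) else 0)"
      by (subst sum_character_subgroup[OF add_subgroup_svecs]) (auto simp: sympc_add_right)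
  qed
  also have "\<dots> = of_nat (card ?V)" using finC add_subgroupD(1)[OF C(1)] by simp
  finally have "(of_nat (card (orth n C) * card C) :: complex) = of_nat (card ?V)"
    using 1 sum.swap[of "\<lambda>v u. sympc n u v" C ?V] by simp
  then show ?thesis unfolding of_nat_eq_iff by (simp add: card_svecs mult.commute)
qed

text \<open>One inclusion is the symmetry of orthogonality; \<open>card_orth\<close>, used for
  \<open>C\<close> and for its orthogonal, makes the orders equal.\<close>

lemma orth_orth:
  fixes C :: "'a::{finite,field} svec set"
  assumes C: "add_subgroup C" "C \<subseteq> svecs n"
  shows "orth n (orth n C) = C"
proof -
  have sub: "C \<subseteq> orth n (orth n C)"
  proof
    fix u assume u: "u \<in> C"
    have "sympc n v u = 1" if "v \<in> orth n C" for v
      using that u by (simp add: orth_def sympc_swap[of n v u])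
    then show "u \<in> orth n (orth n C)" using u C(2) unfolding orth_def by blast
  qed
  have "card C * card (orth n C) = card (orth n C) * card (orth n (orth n C))"
    using card_orth[OF C] card_orth[OF add_subgroup_orth, of n C n] by (simp add: orth_def)
  moreover have "card (orth n C) > 0"
    using card_orth[OF C] by (intro Nat.gr0I) auto
  ultimately have "card C = card (orth n (orth n C))" by simp
  moreover have "finite (orth n (orth n C))"
    using finite_svecs[where 'a='a and n=n] by (simp add: orth_def)
  ultimately show ?thesis using sub card_subset_eq by blast
qed

section \<open>Phases trivialising the Pauli cocycle\<close>

text \<open>In characteristic 2 the form has no half on the diagonal, so the refinement is extended
  one coset \<open>e + W\<close> at a time.\<close>

lemma quadratic_refinement_exponent_2:
  fixes \<beta> :: "'v::ab_group_add \<Rightarrow> 'v \<Rightarrow> complex"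
  assumes D: "add_subgroup D" "finite D" "\<And>u. u \<in> D \<Longrightarrow> u + u = 0"
    and add: "\<And>u v w. \<beta> (u + v) w = \<beta> u w * \<beta> v w" "\<And>u v w. \<beta> w (u + v) = \<beta> w u * \<beta> w v"
    and sym: "\<And>u v. u \<in> D \<Longrightarrow> v \<in> D \<Longrightarrow> \<beta> u v = \<beta> v u"
    and alt: "\<And>u. u \<in> D \<Longrightarrow> \<beta> u u = 1"
    and sq: "\<And>u v. \<beta> u v * \<beta> u v = 1"
    and U: "1 \<in> U" "\<And>x y. x \<in> U \<Longrightarrow> y \<in> U \<Longrightarrow> x * y \<in> U" "\<And>u v. \<beta> u v \<in> U"
  obtains \<phi> where "\<And>u. \<phi> u \<in> U" "\<And>u v. u \<in> D \<Longrightarrow> v \<in> D \<Longrightarrow> \<phi> (u + v) = \<phi> u * \<phi> v * \<beta> u v"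
proof -
  define good where "good W \<longleftrightarrow> add_subgroup W \<and> W \<subseteq> D \<and>
    (\<exists>\<phi>. (\<forall>u. \<phi> u \<in> U) \<and> (\<forall>u\<in>W. \<forall>v\<in>W. \<phi> (u + v) = \<phi> u * \<phi> v * \<beta> u v))" for W
  have z: "0 \<in> D" using add_subgroupD(1)[OF D(1)] .
  have "good {0}"
    unfolding good_def using z U(1) alt[OF z]
    by (auto simp: add_subgroup_def intro!: exI[of _ "\<lambda>_. 1"])
  moreover have "\<forall>W. good W \<longrightarrow> card W < Suc (card D)"
    using D(2) by (auto simp: good_def less_Suc_eq_le intro: card_mono)
  ultimately obtain W where W: "good W" and max: "\<And>V. good V \<Longrightarrow> card V \<le> card W"
    using ex_has_greatest_nat[of good "{0}" card "Suc (card D)"] by blast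
  from W obtain \<phi> where sg: "add_subgroup W" and WD: "W \<subseteq> D" and \<phi>U: "\<And>u. \<phi> u \<in> U"
    and \<phi>: "\<And>u v. u \<in> W \<Longrightarrow> v \<in> W \<Longrightarrow> \<phi> (u + v) = \<phi> u * \<phi> v * \<beta> u v"
    unfolding good_def by blast
  note sgD = add_subgroupD[OF sg]
  have "W = D"
  proof (rule ccontr)
    assume "W \<noteq> D"
    then obtain e where e: "e \<in> D" "e \<notin> W" using WD by blast
    have ee: "e + e = 0" by (rule D(3)[OF e(1)])
    have ee': "e + (e + x) = x" for x using ee by (simp add: add.assoc[symmetric])
    define V where "V = W \<union> (+) e ` W"
    \<comment> \<open>The values on the new coset are dictated by the rule for
      \<open>\<phi> (e + w)\<close> with 1 in the place of \<open>\<phi> e\<close>. For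
      \<open>u\<close> in the coset, \<open>e + u\<close> is the \<open>w\<close> with
      \<open>u = e + w\<close>, as \<open>e + e = 0\<close>.\<close>
    define \<psi> where "\<psi> u = (if u \<in> W then \<phi> u else \<phi> (e + u) * \<beta> e (e + u))" for u
    have notin: "e + w \<notin> W" if "w \<in> W" for w
      using sgD(4)[of "e + w" w] that e by auto
    have \<psi>W: "\<psi> w = \<phi> w" if "w \<in> W" for w using that by (simp add: \<psi>_def)
    have \<psi>e: "\<psi> (e + w) = \<phi> w * \<beta> e w" if "w \<in> W" for w
      using notin[OF that] by (simp add: \<psi>_def ee')
    have sq': "\<beta> u v * (\<beta> u v * x) = x" for u v x using sq[of u v] by (simp add: mult.assoc[symmetric])
    have coc: "\<psi> (u + v) = \<psi> u * \<psi> v * \<beta> u v" if uv: "u \<in> V" "v \<in> V" for u v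
    proof -
      have WW: "\<psi> (u + v) = \<psi> u * \<psi> v * \<beta> u v" if "u \<in> W" "v \<in> W" for u v
        using that by (simp add: \<psi>W \<phi> sgD)
      have WE: "\<psi> (u + (e + w)) = \<psi> u * \<psi> (e + w) * \<beta> u (e + w)" if "u \<in> W" "w \<in> W" for u w
      proof -
        have "\<beta> u e = \<beta> e u" using sym that e WD by blast
        moreover have eq: "u + (e + w) = e + (u + w)" by (simp add: algebra_simps)
        ultimately show ?thesis unfolding eq using that by (simp add: \<psi>W \<psi>e \<phi> sgD add mult_ac)
      qed
      have EW: "\<psi> ((e + w) + v) = \<psi> (e + w) * \<psi> v * \<beta> (e + w) v" if "w \<in> W" "v \<in> W" for w v
        using that by (simp add: \<psi>W \<psi>e \<phi> sgD add add.assoc mult_ac)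
      \<comment> \<open>By symmetry each cross term with \<open>e\<close> occurs as a square, which
        is 1, and \<open>\<beta> e e = 1\<close> removes what is left. This is the essential use of
        the diagonal condition.\<close>
      have EE: "\<psi> ((e + w) + (e + x)) = \<psi> (e + w) * \<psi> (e + x) * \<beta> (e + w) (e + x)"
        if "w \<in> W" "x \<in> W" for w x
      proof -
        have s: "\<beta> w e = \<beta> e w" using sym that e WD by blast
        have "(e + w) + (e + x) = e + (e + (w + x))" by (simp add: algebra_simps)
        then have eq: "(e + w) + (e + x) = w + x" by (simp only: ee')
        show ?thesis unfolding eq using that alt[OF e(1)]
          by (simp add: \<psi>W \<psi>e \<phi> sgD add s mult_ac sq')
      qed
      show ?thesis using uv WW WE EW EE unfolding V_def by blast
    qed
    have "add_subgroup V"
      unfolding add_subgroup_def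
    proof (intro conjI ballI)
      show "0 \<in> V" using sgD(1) by (simp add: V_def)
      fix u assume u: "u \<in> V"
      then have "u \<in> D" using e(1) WD add_subgroupD(2)[OF D(1)] by (auto simp: V_def)
      then have "- u = u" using D(3) by (metis add_eq_0_iff)
      then show "- u \<in> V" using u by simp
      fix v assume v: "v \<in> V"
      have m: "w \<in> W \<Longrightarrow> w \<in> V" "w \<in> W \<Longrightarrow> e + w \<in> V" for w by (auto simp: V_def)
      have "e + w + (e + x) = w + x" "w + (e + x) = e + (w + x)" "e + w + x = e + (w + x)" for w x
        using ee'[of "w + x"] by (simp_all add: algebra_simps)
      then show "u + v \<in> V" using u v m sgD(2) unfolding V_def by (elim UnE imageE) metis+
    qed
    moreover have "V \<subseteq> D" using e(1) WD add_subgroupD(2)[OF D(1)] by (auto simp: V_def)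
    moreover have "\<psi> u \<in> U" for u by (simp add: \<psi>_def \<phi>U U)
    ultimately have "good V" using coc unfolding good_def by blast
    then have "card V \<le> card W" by (rule max)
    moreover have "W \<subset> V" using notin[OF sgD(1)] sgD(1) unfolding V_def by auto
    moreover have "finite V" using \<open>V \<subseteq> D\<close> D(2) finite_subset by blast
    ultimately show False using psubset_card_mono by (metis leD)
  qed
  then show ?thesis using that \<phi>U \<phi> by blast
qed

text \<open>Isotropy makes the composition cocycle symmetric on \<open>D\<close>. In odd
  characteristic \<open>p\<close> it is the coboundary of its diagonal raised to the power
  \<open>(p + 1) div 2\<close>, an inverse of 2 modulo \<open>p\<close>. In characteristic 2 a phase
  is a sign, so the rule at \<open>u + u = 0\<close> forces the diagonal to be 1; this is the
  hypothesis \<open>even\<close>.\<close>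

lemma pauli_phase_exists:
  fixes D :: "'a::{finite,field} svec set"
  assumes D: "add_subgroup D" "D \<subseteq> svecs n"
    and iso: "\<And>u v. u \<in> D \<Longrightarrow> v \<in> D \<Longrightarrow> sympc n u v = 1"
    and even: "\<And>u. CHAR('a) = 2 \<Longrightarrow> u \<in> D \<Longrightarrow> chi (dot n (snd u) (fst u)) = 1"
  obtains \<phi> where "\<And>u. \<phi> u \<in> range (\<lambda>c. omega TYPE('a) ^ c)"
    "\<And>u v. u \<in> D \<Longrightarrow> v \<in> D \<Longrightarrow> \<phi> (u + v) = \<phi> u * \<phi> v * chi (dot n (snd u) (fst v))"
proof -
  let ?U = "range (\<lambda>c::nat. omega TYPE('a) ^ c)"
  define \<beta> where "\<beta> u v = chi (dot n (snd u) (fst v))" for u v :: "'a svec"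
  have add: "\<beta> (u + v) w = \<beta> u w * \<beta> v w" "\<beta> w (u + v) = \<beta> w u * \<beta> w v" for u v w
    by (simp_all add: \<beta>_def dot_add_left dot_add_right chi_add)
  have sym: "\<beta> u v = \<beta> v u" if "u \<in> D" "v \<in> D" for u v
    using iso[OF that] unfolding sympc_def \<beta>_def chi_diff by (simp add: dot_commute)
  have U: "1 \<in> ?U" "\<And>x y. x \<in> ?U \<Longrightarrow> y \<in> ?U \<Longrightarrow> x * y \<in> ?U"
    by (auto intro: range_eqI[of _ _ 0] simp flip: power_add)
  have \<beta>U: "\<beta> u v ^ k \<in> ?U" for u v k
    unfolding \<beta>_def chi_def by (simp flip: power_mult)
  have pow: "\<beta> u v ^ CHAR('a) = 1" for u v by (simp add: \<beta>_def chi_power_CHAR)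
  show ?thesis
  proof (cases "CHAR('a) = 2")
    case True
    have uu: "u + u = 0" if "u \<in> D" for u
    proof -
      have "x + x = 0" for x :: 'a using uminus_CHAR_2[OF True, of x] by (metis add.right_inverse)
      then show ?thesis by (simp add: prod_eq_iff fun_eq_iff)
    qed
    have alt: "\<beta> u u = 1" if "u \<in> D" for u using even[OF True that] by (simp add: \<beta>_def)
    have sq: "\<beta> u v * \<beta> u v = 1" for u v using pow[of u v] True by (simp add: power2_eq_square)
    have \<beta>U1: "\<beta> u v \<in> ?U" for u v using \<beta>U[of u v 1] by simp
    have fin: "finite D" using D(2) finite_svecs finite_subset by blast
    obtain \<phi> where "\<And>u. \<phi> u \<in> ?U" "\<And>u v. u \<in> D \<Longrightarrow> v \<in> D \<Longrightarrow> \<phi> (u + v) = \<phi> u * \<phi> v * \<beta> u v"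
      by (rule quadratic_refinement_exponent_2[OF D(1) fin uu add sym alt sq U \<beta>U1]) blast+
    then show ?thesis using that[of \<phi>] unfolding \<beta>_def by blast
  next
    case False
    then have "odd CHAR('a)"
      using prime_odd_nat[OF prime_CHAR_finite_field] prime_ge_2_nat[OF prime_CHAR_finite_field[where 'a='a]]
      by force
    then have half: "2 * ((CHAR('a) + 1) div 2) = CHAR('a) + 1" by simp
    show ?thesis
    proof (rule that[of "\<lambda>u. \<beta> u u ^ ((CHAR('a) + 1) div 2)"])
      fix u v assume uv: "u \<in> D" "v \<in> D"
      have "\<beta> u v ^ ((CHAR('a) + 1) div 2) * \<beta> u v ^ ((CHAR('a) + 1) div 2) = \<beta> u v ^ (CHAR('a) + 1)"
        unfolding power_add[symmetric] mult_2[symmetric] half ..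
      also have "\<dots> = \<beta> u v" by (simp add: pow)
      finally show "\<beta> (u + v) (u + v) ^ ((CHAR('a) + 1) div 2) =
          \<beta> u u ^ ((CHAR('a) + 1) div 2) * \<beta> v v ^ ((CHAR('a) + 1) div 2) * chi (dot n (snd u) (fst v))"
        using sym[OF uv] unfolding \<beta>_def[symmetric] by (simp add: add power_mult_distrib mult_ac)
    qed (rule \<beta>U)
  qed
qed

section \<open>Stabilizer codes of isotropic subgroups\<close>

text \<open>The phase is an arbitrary complex number and the two vectors form one group element, so
  that composing errors multiplies phases and adds vectors, up to the cocycle
  \<open>chi (dot n (snd u) (fst v))\<close>.\<close>

definition phased_pauli :: "nat \<Rightarrow> complex \<Rightarrow> 'a::{finite,field} svec \<Rightarrow> 'a qop" where
  "phased_pauli n z u = (\<lambda>\<psi> x. z * chi (dot n (snd u) (x - fst u)) * \<psi> (x - fst u))"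

lemma pauli_eq_phased_pauli: "pauli n c a b = phased_pauli n (omega TYPE('a::{finite,field}) ^ c) (a, b :: nat \<Rightarrow> 'a)"
  by (simp add: pauli_def phased_pauli_def chi_def dot_def fun_diff_def)

lemma pauli_group_eq:
  "pauli_group n = {phased_pauli n (omega TYPE('a::{finite,field}) ^ c) u | c (u :: 'a svec). u \<in> svecs n}"
  by (fastforce simp: pauli_group_def pauli_eq_phased_pauli svecs_def)

lemma scalars_eq:
  "scalars n = {phased_pauli n (omega TYPE('a::{finite,field}) ^ c) (0 :: 'a svec) | c. True}"
  by (simp add: scalars_def pauli_eq_phased_pauli zero_prod_def zero_fun_def)

lemma phased_pauli_comp:
  "phased_pauli n z u \<circ> phased_pauli n w v
    = phased_pauli n (z * w * chi (dot n (snd u) (fst v))) (u + v)"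
proof (intro ext)
  fix \<psi> :: "'a state" and x
  let ?y = "x - fst u - fst v"
  have "dot n (snd u) (x - fst u) = dot n (snd u) (fst v) + dot n (snd u) ?y"
    by (simp add: dot_diff_right)
  then have "(phased_pauli n z u \<circ> phased_pauli n w v) \<psi> x
    = z * w * chi (dot n (snd u) (fst v)) * (chi (dot n (snd u) ?y) * chi (dot n (snd v) ?y)) * \<psi> ?y"
    by (simp add: phased_pauli_def chi_add)
  then show "(phased_pauli n z u \<circ> phased_pauli n w v) \<psi> x
    = phased_pauli n (z * w * chi (dot n (snd u) (fst v))) (u + v) \<psi> x"
    by (simp add: phased_pauli_def dot_add_left chi_add diff_diff_eq)
qed

lemma phased_pauli_1_0: "phased_pauli n 1 0 = id"
  by (simp add: phased_pauli_def fun_eq_iff)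

lemma phased_pauli_eqD:
  assumes eq: "phased_pauli n z u = phased_pauli n w v" and "u \<in> svecs n" "v \<in> svecs n"
    and "z \<noteq> 0" "w \<noteq> 0"
  shows "u = v \<and> z = w"
proof -
  \<comment> \<open>The state concentrated at 0 reveals the translation and the phase; the constant
    function, used further down, reveals the character.\<close>
  let ?\<delta> = "\<lambda>y. if y = 0 then 1 else 0 :: complex"
  have "phased_pauli n z u ?\<delta> (fst u) = phased_pauli n w v ?\<delta> (fst u)" by (simp add: eq)
  then have a: "fst u = fst v" and zw: "z = w"
    using assms(4) by (auto simp: phased_pauli_def split: if_splits)
  have "snd u - snd v = 0"
  proof (rule chi_dot_nondegenerate)
    show "snd u - snd v \<in> fvecs n" using assms(2,3) by (auto simp: svecs_def intro: fvecs_diff)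
    fix x
    have "phased_pauli n z u (\<lambda>_. 1) (x + fst u) = phased_pauli n w v (\<lambda>_. 1) (x + fst u)"
      by (simp add: eq)
    then show "chi (dot n (snd u - snd v) x) = 1"
      using a zw assms(4) by (simp add: phased_pauli_def dot_diff_left chi_diff)
  qed
  then show ?thesis using a zw by (simp add: prod_eq_iff)
qed

text \<open>By \<open>phased_pauli_eqD\<close> an error determines its vector, so the least weight
  is taken over a single value.\<close>

lemma pauli_wt_phased_pauli:
  fixes u :: "'a::{finite,field} svec"
  assumes "u \<in> svecs n"
  shows "pauli_wt n (phased_pauli n (omega TYPE('a) ^ c) u) = symp_wt n (fst u) (snd u)"
  unfolding pauli_wt_def
proof (rule Least_equality)
  show "\<exists>c' a b. a \<in> fvecs n \<and> b \<in> fvecs n \<and> phased_pauli n (omega TYPE('a) ^ c) u = pauli n c' a b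
      \<and> symp_wt n (fst u) (snd u) = symp_wt n a b"
    using assms by (intro exI[of _ c] exI[of _ "fst u"] exI[of _ "snd u"])
      (auto simp: pauli_eq_phased_pauli svecs_def)
  fix w
  assume "\<exists>c' a b. a \<in> fvecs n \<and> b \<in> fvecs n \<and> phased_pauli n (omega TYPE('a) ^ c) u = pauli n c' a b
      \<and> w = symp_wt n a b"
  then obtain c' a b where "(a, b) \<in> svecs n" "w = symp_wt n a b"
    "phased_pauli n (omega TYPE('a) ^ c) u = phased_pauli n (omega TYPE('a) ^ c') (a, b)"
    unfolding pauli_eq_phased_pauli svecs_def by auto
  then show "symp_wt n (fst u) (snd u) \<le> w"
    using phased_pauli_eqD[of n _ u _ "(a, b)"] assms by (fastforce simp: svecs_def)
qed

lemma vector_space_cscale: "vector_space (cscale :: complex \<Rightarrow> 'a state \<Rightarrow> 'a state)"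
  by unfold_locales (auto simp: cscale_def fun_eq_iff algebra_simps)

lemma sum_fun_apply: "(\<Sum>i\<in>A. f i) x = (\<Sum>i\<in>A. f i x)"
  by (induction A rule: infinite_finite_induct) auto

text \<open>The family \<open>e\<close> is dual to the evaluations at \<open>R\<close>, and a member
  of \<open>W\<close> vanishing on \<open>R\<close> is 0. So the values at \<open>R\<close> are
  coordinates and the family is a basis of \<open>W\<close>.\<close>

lemma dim_eq_card_evaluation_points:
  fixes W :: "'a state set"
  assumes sub: "module.subspace cscale W" and fin: "finite R"
    and e: "\<And>r. r \<in> R \<Longrightarrow> e r \<in> W" "\<And>r s. r \<in> R \<Longrightarrow> s \<in> R \<Longrightarrow> e r s = (if r = s then 1 else 0)"
    and zero: "\<And>\<psi>. \<psi> \<in> W \<Longrightarrow> (\<And>r. r \<in> R \<Longrightarrow> \<psi> r = 0) \<Longrightarrow> \<psi> = 0"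
  shows "vector_space.dim cscale W = card R"
proof -
  interpret cs: vector_space "cscale :: complex \<Rightarrow> 'a state \<Rightarrow> 'a state" by (rule vector_space_cscale)
  have inj: "inj_on e R"
  proof (rule inj_onI)
    fix r s assume rs: "r \<in> R" "s \<in> R" "e r = e s"
    have "e s r = 1" using e(2)[OF rs(1) rs(1)] unfolding rs(3) by simp
    then show "r = s" using e(2)[OF rs(2) rs(1)] by (auto split: if_splits)
  qed
  have eval: "(\<Sum>r\<in>R. cscale (c r) (e r)) s = c s" if "s \<in> R" for c s
  proof -
    have "(\<Sum>r\<in>R. cscale (c r) (e r)) s = (\<Sum>r\<in>R. if r = s then c r else 0)"
      unfolding sum_fun_apply using that by (intro sum.cong) (auto simp: cscale_def e)
    then show ?thesis using that fin by simp
  qed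
  have "cs.dim W = card (e ` R)"
  proof (rule cs.dim_unique)
    show "e ` R \<subseteq> W" using e(1) by blast
    show "W \<subseteq> cs.span (e ` R)"
    proof
      fix \<psi> assume \<psi>: "\<psi> \<in> W"
      let ?s = "\<Sum>r\<in>R. cscale (\<psi> r) (e r)"
      have "?s \<in> W" using e(1) sub by (intro cs.subspace_sum cs.subspace_scale)
      then have "\<psi> - ?s \<in> W" using \<psi> sub by (intro cs.subspace_diff)
      moreover have "(\<psi> - ?s) r = 0" if "r \<in> R" for r using eval[OF that, of \<psi>] by simp
      ultimately have "\<psi> - ?s = 0" by (rule zero)
      then have "\<psi> = ?s" by simp
      moreover have "?s \<in> cs.span (e ` R)"
        by (intro cs.span_sum cs.span_scale cs.span_base) auto
      ultimately show "\<psi> \<in> cs.span (e ` R)" by simp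
    qed
    show "cs.independent (e ` R)"
    proof (rule cs.independent_if_scalars_zero)
      show "finite (e ` R)" using fin by simp
      fix f x assume f: "(\<Sum>x\<in>e ` R. cscale (f x) x) = 0" and "x \<in> e ` R"
      then obtain s where s: "s \<in> R" "x = e s" by blast
      have "(\<Sum>r\<in>R. cscale (f (e r)) (e r)) = 0" using f by (simp add: sum.reindex[OF inj])
      then show "f x = 0" using eval[OF s(1), of "\<lambda>r. f (e r)"] s by simp
    qed
  qed simp
  then show ?thesis using inj by (simp add: card_image)
qed

text \<open>The rule \<open>cocycle\<close> says that \<open>pl\<close> is a homomorphism on
  \<open>D\<close>. Each vector then carries exactly one phase in \<open>stab\<close>, so no scalar
  other than the identity occurs there.\<close>

locale phased_isotropic =
  fixes n :: nat and D :: "'a::{finite,field} svec set" and \<phi> :: "'a svec \<Rightarrow> complex"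
  assumes D: "add_subgroup D" "D \<subseteq> svecs n"
    and iso: "\<And>u v. u \<in> D \<Longrightarrow> v \<in> D \<Longrightarrow> sympc n u v = 1"
    and phase: "\<And>u. \<phi> u \<in> range (\<lambda>c. omega TYPE('a) ^ c)"
    and cocycle: "\<And>u v. u \<in> D \<Longrightarrow> v \<in> D \<Longrightarrow> \<phi> (u + v) = \<phi> u * \<phi> v * chi (dot n (snd u) (fst v))"
begin

abbreviation pl :: "'a svec \<Rightarrow> 'a qop" where "pl u \<equiv> phased_pauli n (\<phi> u) u"

definition stab :: "'a qop set" where "stab = pl ` D"

lemmas D_closed = add_subgroupD[OF D(1)]

lemma D_svecs: "u \<in> D \<Longrightarrow> u \<in> svecs n"
  using D(2) by blast

lemma fin_D: "finite D"
  using D(2) finite_svecs finite_subset by blast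

lemma \<phi>_nz [simp]: "\<phi> u \<noteq> 0"
  using phase[of u] by auto

lemma \<phi>_0 [simp]: "\<phi> 0 = 1"
  using cocycle[of 0 0] D_closed(1) by simp

lemma pl_comp: "u \<in> D \<Longrightarrow> v \<in> D \<Longrightarrow> pl u \<circ> pl v = pl (u + v)"
  by (simp add: phased_pauli_comp cocycle)

lemma pl_0: "pl 0 = id"
  by (simp add: phased_pauli_1_0)

lemma phase_obtain:
  obtains c where "\<phi> u = omega TYPE('a) ^ c"
  using phase[of u] by blast

lemma abelian_stab: "abelian_pauli_subgroup n stab"
  unfolding abelian_pauli_subgroup_def
proof (intro conjI ballI)
  show "stab \<subseteq> pauli_group n"
  proof
    fix E assume "E \<in> stab"
    then obtain u where u: "u \<in> D" "E = pl u" by (auto simp: stab_def)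
    obtain c where "\<phi> u = omega TYPE('a) ^ c" by (rule phase_obtain)
    then show "E \<in> pauli_group n" unfolding pauli_group_eq u(2)
      using D_svecs[OF u(1)] by (intro CollectI exI[of _ c] exI[of _ u]) simp
  qed
  show "id \<in> stab" unfolding stab_def 
    by (rule image_eqI[where f=pl, OF pl_0[symmetric] D_closed(1)])
  fix s assume "s \<in> stab"
  then obtain u where u: "u \<in> D" "s = pl u" by (auto simp: stab_def)
  show "\<exists>t\<in>stab. s \<circ> t = id \<and> t \<circ> s = id"
    using u D_closed(3)[of u] pl_comp[of u "- u"] pl_comp[of "- u" u] pl_0
    by (intro bexI[of _ "pl (- u)"]) (simp_all add: stab_def)
  fix t assume "t \<in> stab"
  then obtain v where v: "v \<in> D" "t = pl v" by (auto simp: stab_def)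
  show "s \<circ> t \<in> stab" using u v D_closed(2)[of u v] by (simp add: pl_comp stab_def)
  show "s \<circ> t = t \<circ> s" using u v by (simp add: pl_comp add.commute)
qed

text \<open>Conjugation changes \<open>pl u\<close> only by the commutator phase, and
  \<open>stab\<close> has a single phase for each vector. Normalizing \<open>stab\<close> thus
  amounts to commuting with it.\<close>

lemma normalizer_stab:
  "normalizer n stab = {phased_pauli n (omega TYPE('a) ^ c) v | c v. v \<in> orth n D}"
proof -
  have "(\<forall>s\<in>stab. \<exists>s'\<in>stab. phased_pauli n z v \<circ> s = s' \<circ> phased_pauli n z v) \<longleftrightarrow> v \<in> orth n D"
    if v: "v \<in> svecs n" and z: "z \<noteq> 0" for z v
  proof
    assume *: "\<forall>s\<in>stab. \<exists>s'\<in>stab. phased_pauli n z v \<circ> s = s' \<circ> phased_pauli n z v"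
    have "sympc n u v = 1" if u: "u \<in> D" for u
    proof -
      obtain u' where u': "u' \<in> D" "phased_pauli n z v \<circ> pl u = pl u' \<circ> phased_pauli n z v"
        using * u unfolding stab_def by blast
      then have eq: "v + u = u' + v
          \<and> z * \<phi> u * chi (dot n (snd v) (fst u)) = \<phi> u' * z * chi (dot n (snd u') (fst v))"
        unfolding phased_pauli_comp
        using z add_subgroupD(2)[OF add_subgroup_svecs v D_svecs[OF u]]
          add_subgroupD(2)[OF add_subgroup_svecs D_svecs[OF u'(1)] v]
        by (intro phased_pauli_eqD) auto
      then have "u' = u" by (simp add: add.commute)
      then show ?thesis using eq z by (simp add: sympc_def chi_diff dot_commute)
    qed
    then show "v \<in> orth n D" using v by (simp add: orth_def)
  next
    assume v': "v \<in> orth n D"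
    show "\<forall>s\<in>stab. \<exists>s'\<in>stab. phased_pauli n z v \<circ> s = s' \<circ> phased_pauli n z v"
    proof
      fix s assume s: "s \<in> stab"
      then obtain u where u: "u \<in> D" "s = pl u" by (auto simp: stab_def)
      have "chi (dot n (snd v) (fst u)) = chi (dot n (snd u) (fst v))"
        using v' u(1) by (auto simp: orth_def sympc_def chi_diff dot_commute)
      then have "phased_pauli n z v \<circ> s = s \<circ> phased_pauli n z v"
        unfolding u phased_pauli_comp by (simp add: add.commute mult.commute)
      then show "\<exists>s'\<in>stab. phased_pauli n z v \<circ> s = s' \<circ> phased_pauli n z v" using s by blast
    qed
  qed
  note key = this
  show ?thesis
  proof (intro equalityI subsetI)
    fix E assume E: "E \<in> normalizer n stab"
    then obtain c v where v: "v \<in> svecs n" "E = phased_pauli n (omega TYPE('a) ^ c) v"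
      unfolding normalizer_def pauli_group_eq by blast
    then have "v \<in> orth n D" using E key[of v "omega TYPE('a) ^ c"] by (simp add: normalizer_def)
    then show "E \<in> {phased_pauli n (omega TYPE('a) ^ c) v | c v. v \<in> orth n D}" using v by blast
  next
    fix E assume "E \<in> {phased_pauli n (omega TYPE('a) ^ c) v | c v. v \<in> orth n D}"
    then obtain c v where v: "v \<in> orth n D" "E = phased_pauli n (omega TYPE('a) ^ c) v" by blast
    then have "v \<in> svecs n" by (simp add: orth_def)
    then show "E \<in> normalizer n stab"
      using v key[of v "omega TYPE('a) ^ c"] unfolding normalizer_def pauli_group_eq
      by (intro CollectI conjI exI[of _ c] exI[of _ v]) auto
  qed
qed

lemma scalar_S_stab:
  "scalar_S n stab = {phased_pauli n (omega TYPE('a) ^ c) u | c u. u \<in> D}"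
proof (intro equalityI subsetI)
  fix E assume "E \<in> scalar_S n stab"
  then obtain c u where u: "u \<in> D" "E = phased_pauli n (omega TYPE('a) ^ c) 0 \<circ> pl u"
    unfolding scalar_S_def scalars_eq stab_def by blast
  obtain c' where "\<phi> u = omega TYPE('a) ^ c'" by (rule phase_obtain)
  then have "E = phased_pauli n (omega TYPE('a) ^ (c + c')) u"
    unfolding u phased_pauli_comp by (simp add: power_add)
  then show "E \<in> {phased_pauli n (omega TYPE('a) ^ c) u | c u. u \<in> D}" using u by blast
next
  fix E assume "E \<in> {phased_pauli n (omega TYPE('a) ^ c) u | c u. u \<in> D}"
  then obtain c u where u: "u \<in> D" "E = phased_pauli n (omega TYPE('a) ^ c) u" by blast
  obtain c' where c': "\<phi> u = omega TYPE('a) ^ c'" by (rule phase_obtain)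
  let ?p = "CHAR('a)"
  \<comment> \<open>The exponent \<open>c' * (?p - 1)\<close> gives the inverse of
    \<open>\<phi> u\<close>, since \<open>omega\<close> has order \<open>?p\<close>.\<close>
  have "omega TYPE('a) ^ (c + c' * (?p - 1) + c') = omega TYPE('a) ^ c"
  proof -
    have "c + c' * (?p - 1) + c' = c + c' * ?p"
      using prime_gt_0_nat[OF prime_CHAR_finite_field[where 'a='a]] by (cases ?p) auto
    then show ?thesis unfolding omega_power_eq_iff by (simp only:) simp
  qed
  then have "E = phased_pauli n (omega TYPE('a) ^ (c + c' * (?p - 1))) 0 \<circ> pl u"
    unfolding u phased_pauli_comp c' by (simp flip: power_add)
  then show "E \<in> scalar_S n stab" unfolding scalar_S_def scalars_eq stab_def using u by blast
qed

lemma stab_code_subspace: "module.subspace cscale (stab_code n stab)"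
proof -
  interpret cs: vector_space "cscale :: complex \<Rightarrow> 'a state \<Rightarrow> 'a state" by (rule vector_space_cscale)
  have "pl u (\<psi> + \<psi>') = pl u \<psi> + pl u \<psi>'" "pl u (cscale c \<psi>) = cscale c (pl u \<psi>)" "pl u 0 = 0" for u \<psi> \<psi>' c
    by (auto simp: phased_pauli_def cscale_def fun_eq_iff algebra_simps)
  then show ?thesis
    by (auto simp: cs.subspace_def stab_code_def hilbert_def stab_def cscale_def)
qed

text \<open>The group acts monomially: a fixed state is supported on the points \<open>A\<close> where the diagonal
  elements act trivially, and is determined by its values on representatives of \<open>A\<close> modulo the
  translation parts \<open>fst ` D\<close>.\<close>

lemma qdim_stab: "qdim n stab * card D = CARD('a) ^ n"
proof -
  define DZ where "DZ = {u \<in> D. fst u = 0}"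
  define DX where "DX = fst ` D"
  define A where "A = {x \<in> fvecs n. \<forall>u\<in>DZ. \<phi> u * chi (dot n (snd u) x) = 1}"
  have DZ: "add_subgroup DZ" using D_closed unfolding DZ_def add_subgroup_def by auto
  have DX: "add_subgroup DX"
    unfolding add_subgroup_def DX_def
  proof (intro conjI ballI)
    show "0 \<in> fst ` D" using D_closed(1) by force
    fix x assume "x \<in> fst ` D"
    then obtain u where u: "u \<in> D" "x = fst u" by blast
    show "- x \<in> fst ` D" using D_closed(3)[OF u(1)] u(2) by (intro image_eqI[of _ _ "- u"]) auto
    fix y assume "y \<in> fst ` D"
    then obtain v where v: "v \<in> D" "y = fst v" by blast
    show "x + y \<in> fst ` D"
      using D_closed(2)[OF u(1) v(1)] u(2) v(2) by (intro image_eqI[of _ _ "u + v"]) auto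
  qed
  note DXc = add_subgroupD[OF DX]
  have DXf: "x \<in> fvecs n" if "x \<in> DX" for x
    using that D_svecs by (auto simp: DX_def svecs_def)
  have finDZ: "finite DZ" and finDX: "finite DX" using fin_D by (auto simp: DZ_def DX_def)
  have finA: "finite A" using finite_fvecs[where 'a='a] by (simp add: A_def)
  have cardDZ: "card DZ > 0" using DZ finDZ by (auto simp: card_gt_0_iff add_subgroup_def)
  have cardD: "card D = card DX * card DZ"
  proof -
    have "card {u \<in> D. fst u = x} = card DZ" if x: "x \<in> DX" for x
    proof -
      obtain v where v: "v \<in> D" "fst v = x" using x unfolding DX_def by blast
      have "bij_betw (\<lambda>u. u + v) DZ {u \<in> D. fst u = x}"
        using v D_closed by (intro bij_betwI[where g="\<lambda>u. u - v"]) (auto simp: DZ_def)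
      then show ?thesis by (simp add: bij_betw_same_card)
    qed
    then have "(\<Sum>x\<in>DX. card {u \<in> D. fst u = x}) = card DX * card DZ" by simp
    moreover have "card D = (\<Sum>x\<in>DX. card {u \<in> D. fst u = x})"
      unfolding DX_def using sum.image_gen[OF fin_D, of "\<lambda>_. 1::nat" fst] by simp
    ultimately show ?thesis by simp
  qed
  \<comment> \<open>Elements of \<open>DZ\<close> have no translation part, so the cocycle is
    trivial there and the summand is a genuine character of \<open>DZ\<close>.\<close>
  have char_DZ: "(\<Sum>u\<in>DZ. \<phi> u * chi (dot n (snd u) x))
      = (if \<forall>u\<in>DZ. \<phi> u * chi (dot n (snd u) x) = 1 then of_nat (card DZ) else 0)" for x
    by (rule sum_character_subgroup[OF DZ])
      (auto simp: DZ_def cocycle dot_add_left chi_add)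
  \<comment> \<open>Summed over \<open>DZ\<close> first, only the points of \<open>A\<close>
    survive; summed over all points first, only \<open>u = 0\<close> does.\<close>
  have cardA: "card A * card DZ = CARD('a) ^ n"
  proof -
    let ?F = "fvecs n :: (nat \<Rightarrow> 'a) set"
    have "(\<Sum>x\<in>?F. \<Sum>u\<in>DZ. \<phi> u * chi (dot n (snd u) x))
        = (\<Sum>x\<in>?F. if x \<in> A then of_nat (card DZ) else 0)"
      unfolding char_DZ by (intro sum.cong) (auto simp: A_def)
    also have "\<dots> = of_nat (card A) * of_nat (card DZ)"
      using finite_fvecs[where 'a='a] by (simp add: sum.If_cases A_def Int_def)
    finally have 1: "(\<Sum>x\<in>?F. \<Sum>u\<in>DZ. \<phi> u * chi (dot n (snd u) x)) = of_nat (card A * card DZ)" by simp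
    have "(\<Sum>u\<in>DZ. \<Sum>x\<in>?F. \<phi> u * chi (dot n (snd u) x)) = (\<Sum>u\<in>DZ. if u = 0 then of_nat (card ?F) else 0)"
    proof (intro sum.cong refl)
      fix u assume u: "u \<in> DZ"
      then have uf: "snd u \<in> fvecs n" using D_svecs[of u] by (auto simp: DZ_def svecs_def)
      have "(\<forall>x\<in>?F. chi (dot n (snd u) x) = 1) \<longleftrightarrow> u = 0"
      proof
        assume "\<forall>x\<in>?F. chi (dot n (snd u) x) = 1"
        then have "snd u = 0" using chi_dot_nondegenerate[OF uf] by blast
        then show "u = 0" using u by (simp add: DZ_def prod_eq_iff)
      qed simp
      then have "(\<Sum>x\<in>?F. chi (dot n (snd u) x)) = (if u = 0 then of_nat (card ?F) else 0)"
        by (subst sum_character_subgroup[OF add_subgroup_fvecs]) (auto simp: dot_add_right chi_add)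
      then show "(\<Sum>x\<in>?F. \<phi> u * chi (dot n (snd u) x)) = (if u = 0 then of_nat (card ?F) else 0)"
        by (simp flip: sum_distrib_left)
    qed
    also have "\<dots> = of_nat (card ?F)" using finDZ add_subgroupD(1)[OF DZ] by simp
    finally have "(of_nat (card A * card DZ) :: complex) = of_nat (card ?F)"
      using 1 sum.swap[of "\<lambda>x u. \<phi> u * chi (dot n (snd u) x)" DZ ?F] by simp
    then show ?thesis unfolding of_nat_eq_iff by (simp add: card_fvecs)
  qed
  \<comment> \<open>A diagonal element commutes with all of the group, so its character is trivial
    on the translation parts.\<close>
  have A_trans: "x + a \<in> A" if x: "x \<in> A" and a: "a \<in> DX" for x a
  proof -
    obtain v where v: "v \<in> D" "fst v = a" using a unfolding DX_def by blast
    have "chi (dot n (snd u) a) = 1" if "u \<in> DZ" for u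
      using iso[of u v] that v by (simp add: DZ_def sympc_def)
    then show ?thesis using x DXf[OF a] by (auto simp: A_def dot_add_right chi_add intro: fvecs_add)
  qed
  define rep where "rep x = (SOME y. y \<in> A \<and> x - y \<in> DX)" for x
  have rep: "rep x \<in> A \<and> x - rep x \<in> DX" if "x \<in> A" for x
    unfolding rep_def by (rule someI[of _ x]) (simp only: diff_self that DXc(1) simp_thms)
  have rep_eq: "rep x = rep y" if "x - y \<in> DX" for x y
  proof -
    have "x - z \<in> DX \<longleftrightarrow> y - z \<in> DX" for z
      using DXc(2)[OF that, of "y - z"] DXc(4)[OF _ that, of "x - z"] by auto
    then show ?thesis by (simp add: rep_def)
  qed
  define R where "R = rep ` A"
  have RA: "R \<subseteq> A" using rep by (auto simp: R_def)
  have R_eq: "r = s" if rs: "r \<in> R" "s \<in> R" "s - r \<in> DX" for r s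
  proof -
    have "rep t = t" if "t \<in> R" for t
      using that rep rep_eq unfolding R_def by (metis imageE)
    then show ?thesis using rep_eq[OF rs(3)] rs by simp
  qed
  have "bij_betw (\<lambda>(r, a). r + a) (R \<times> DX) A"
  proof (rule bij_betwI[where g="\<lambda>x. (rep x, x - rep x)"])
    show "(\<lambda>(r, a). r + a) \<in> R \<times> DX \<rightarrow> A" using RA A_trans by auto
    show "(\<lambda>x. (rep x, x - rep x)) \<in> A \<rightarrow> R \<times> DX" using rep by (auto simp: R_def)
    show "(rep (case p of (r, a) \<Rightarrow> r + a), (case p of (r, a) \<Rightarrow> r + a) - rep (case p of (r, a) \<Rightarrow> r + a)) = p"
      if pR: "p \<in> R \<times> DX" for p
    proof -
      obtain r a where p: "p = (r, a)" "r \<in> R" "a \<in> DX" using pR by auto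
      have "rep (r + a) \<in> R" using p RA A_trans by (auto simp: R_def)
      moreover have "r + a - rep (r + a) \<in> DX" using rep p RA A_trans by blast
      then have "rep (r + a) - r \<in> DX" using DXc(4)[OF p(3), of "r + a - rep (r + a)"] by simp
      ultimately have "r = rep (r + a)" using R_eq p by blast
      then show ?thesis using p by simp
    qed
  qed auto
  then have cardR: "card R * card DX = card A"
    by (simp add: bij_betw_same_card flip: card_cartesian_product)
  \<comment> \<open>Summing over the group projects the basis state at \<open>r\<close>, up to a
    factor, onto the code. The elements that keep \<open>r\<close> in place are those of
    \<open>DZ\<close>, whence the value \<open>card DZ\<close> at \<open>r\<close> and the
    normalisation in \<open>e\<close>.\<close>
  define e0 where "e0 r = (\<Sum>u\<in>D. pl u (\<lambda>y. if y = r then 1 else 0))" for r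
  define e where "e r = cscale (1 / of_nat (card DZ)) (e0 r)" for r
  have e0: "e0 r \<in> stab_code n stab" if r: "r \<in> R" for r
    unfolding stab_code_def
  proof (intro CollectI conjI ballI)
    have rf: "r \<in> fvecs n" using r RA by (auto simp: A_def)
    show "e0 r \<in> hilbert n"
      unfolding hilbert_def
    proof (intro CollectI allI impI)
      fix x :: "nat \<Rightarrow> 'a" assume x: "x \<notin> fvecs n"
      have "x - fst u \<noteq> r" if "u \<in> D" for u
      proof
        assume "x - fst u = r"
        then have "x = r + fst u" by (simp add: algebra_simps)
        then show False using x rf D_svecs[OF that] fvecs_add[of r n "fst u"] by (auto simp: svecs_def)
      qed
      then show "e0 r x = 0" by (simp add: e0_def sum_fun_apply phased_pauli_def)
    qed
    fix E assume "E \<in> stab"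
    then obtain v where v: "v \<in> D" "E = pl v" by (auto simp: stab_def)
    let ?d = "\<lambda>y. if y = r then 1 else 0 :: complex"
    have "E (e0 r) = (\<Sum>u\<in>D. pl v (pl u ?d))"
      unfolding v(2) e0_def
      by (rule ext) (simp add: phased_pauli_def sum_fun_apply sum_distrib_left)
    also have "\<dots> = (\<Sum>u\<in>D. pl (v + u) ?d)"
    proof (intro sum.cong refl)
      fix u assume "u \<in> D"
      then show "pl v (pl u ?d) = pl (v + u) ?d" using pl_comp[OF v(1), of u] by (metis comp_apply)
    qed
    also have "\<dots> = e0 r"
      unfolding e0_def using v D_closed
      by (intro sum.reindex_bij_witness[of _ "\<lambda>u. u - v" "\<lambda>u. v + u"]) auto
    finally show "E (e0 r) = e0 r" .
  qed
  have e0_val: "e0 r s = (if r = s then of_nat (card DZ) else 0)" if rs: "r \<in> R" "s \<in> R" for r s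
  proof (cases "r = s")
    case True
    have "e0 r s = (\<Sum>u\<in>D. if fst u = 0 then \<phi> u * chi (dot n (snd u) r) else 0)"
      unfolding e0_def sum_fun_apply using True by (intro sum.cong) (auto simp: phased_pauli_def)
    also have "\<dots> = (\<Sum>u\<in>DZ. \<phi> u * chi (dot n (snd u) r))"
      using fin_D by (simp add: sum.If_cases DZ_def Int_def)
    also have "\<dots> = of_nat (card DZ)" using rs(1) RA unfolding char_DZ by (auto simp: A_def)
    finally show ?thesis using True by simp
  next
    case False
    have "s - fst u \<noteq> r" if "u \<in> D" for u
    proof
      assume "s - fst u = r"
      then have "s - r = fst u" by (auto simp: algebra_simps)
      then show False using R_eq[OF rs] False that by (auto simp: DX_def)
    qed
    then show ?thesis using False by (simp add: e0_def sum_fun_apply phased_pauli_def)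
  qed
  have "qdim n stab = card R"
    unfolding qdim_def
  proof (rule dim_eq_card_evaluation_points[OF stab_code_subspace])
    show "finite R" using finA by (simp add: R_def)
    show "e r \<in> stab_code n stab" if "r \<in> R" for r
    proof -
      interpret cs: vector_space "cscale :: complex \<Rightarrow> 'a state \<Rightarrow> 'a state"
        by (rule vector_space_cscale)
      show ?thesis unfolding e_def using cs.subspace_scale[OF stab_code_subspace e0[OF that]] .
    qed
    show "e r s = (if r = s then 1 else 0)" if "r \<in> R" "s \<in> R" for r s
      using e0_val[OF that] cardDZ by (simp add: e_def cscale_def)
    show "\<psi> = 0" if \<psi>: "\<psi> \<in> stab_code n stab" and zero: "\<And>r. r \<in> R \<Longrightarrow> \<psi> r = 0" for \<psi>
    proof (intro ext)
      fix x
      have fixed: "\<phi> u * chi (dot n (snd u) (x - fst u)) * \<psi> (x - fst u) = \<psi> x" if "u \<in> D" for u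
      proof -
        have "pl u \<psi> = \<psi>" using \<psi> that by (auto simp: stab_code_def stab_def)
        then have "pl u \<psi> x = \<psi> x" by simp
        then show ?thesis by (simp add: phased_pauli_def)
      qed
      consider "x \<notin> fvecs n" | "x \<in> fvecs n" "x \<notin> A" | "x \<in> A" by blast
      then show "\<psi> x = 0 x"
      proof cases
        case 1
        then show ?thesis using \<psi> by (simp add: stab_code_def hilbert_def)
      next
        case 2
        then obtain u where "u \<in> DZ" "\<phi> u * chi (dot n (snd u) x) \<noteq> 1" by (auto simp: A_def)
        then show ?thesis using fixed[of u] by (auto simp: DZ_def)
      next
        case 3
        then obtain u where u: "u \<in> D" "x - rep x = fst u" using rep[OF 3] by (auto simp: DX_def)
        then have "x - fst u = rep x" by (metis diff_diff_eq2 add_diff_cancel_left')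
        moreover have "rep x \<in> R" using 3 by (simp add: R_def)
        ultimately show ?thesis using fixed[OF u(1)] zero by auto
      qed
    qed
  qed
  then show ?thesis using cardR cardA cardD by (simp add: mult.assoc[symmetric])
qed

end

section \<open>Cyclotomic cosets\<close>

lemma mod_mult_eq_of_mod_1:
  fixes N :: nat
  assumes "P mod N = 1 mod N"
  shows "x * P mod N = x mod N"
  by (metis assms mod_mult_right_eq mult.right_neutral)

lemma power_mod_eq_1:
  fixes q :: nat
  assumes "q \<ge> 1"
  shows "(q ^ k) mod (q ^ k - 1) = 1 mod (q ^ k - 1)"
proof -
  have "q ^ k = 1 + (q ^ k - 1)" using assms by simp
  then show ?thesis by (metis mod_add_self2)
qed

text \<open>As \<open>q ^ k\<close> is 1 modulo \<open>q ^ k - 1\<close>, multiplication by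
  \<open>q ^ (k - j)\<close> undoes that by \<open>q ^ j\<close>.\<close>

lemma mod_mult_power_swap:
  fixes q :: nat
  assumes "q \<ge> 1" "j \<le> k" "x * q ^ j mod (q ^ k - 1) = y mod (q ^ k - 1)"
  shows "x mod (q ^ k - 1) = y * q ^ (k - j) mod (q ^ k - 1)"
proof -
  let ?N = "q ^ k - 1"
  have "y * q ^ (k - j) mod ?N = (x * q ^ j) * q ^ (k - j) mod ?N"
    using assms(3) by (metis mod_mult_left_eq)
  also have "(x * q ^ j) * q ^ (k - j) = x * q ^ k"
    using assms(2) by (simp add: mult.assoc flip: power_add)
  also have "x * q ^ k mod ?N = x mod ?N"
    by (rule mod_mult_eq_of_mod_1[OF power_mod_eq_1[OF assms(1)]])
  finally show ?thesis ..
qed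

lemma mult_power_mod_exponent:
  fixes Q :: nat
  assumes "Q \<ge> 1"
  shows "x * Q ^ k mod (Q ^ m - 1) = x * Q ^ (k mod m) mod (Q ^ m - 1)"
proof -
  let ?N = "Q ^ m - 1"
  have "(Q ^ m) ^ (k div m) mod ?N = 1 ^ (k div m) mod ?N"
    using power_mod_eq_1[OF assms, of m] by (metis power_mod)
  then have 1: "(Q ^ m) ^ (k div m) mod ?N = 1 mod ?N" by simp
  have "Q ^ k = Q ^ (k mod m) * (Q ^ m) ^ (k div m)"
    by (simp flip: power_mult power_add)
  then have "x * Q ^ k = (x * Q ^ (k mod m)) * (Q ^ m) ^ (k div m)" by (simp add: mult.assoc)
  then show ?thesis by (simp only: mod_mult_eq_of_mod_1[OF 1])
qed

text \<open>Both \<open>x\<close> and \<open>y\<close> fit into half the base-\<open>q\<close>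
  digits of the modulus. If \<open>2 * k \<le> m\<close>, the left side does not wrap around and
  equals \<open>y\<close>, whose indivisibility by \<open>q^2\<close> gives \<open>k = 0\<close>.
  Otherwise the complementary power is moved to \<open>y\<close>, and \<open>x\<close> would be
  divisible by \<open>q^2\<close>.\<close>

lemma cyclotomic_coset_leaders_unique:
  fixes q m :: nat
  assumes q: "q \<ge> 2" and k: "k < m"
    and x: "1 \<le> x" "x < q ^ m - 1" "\<not> q\<^sup>2 dvd x"
    and y: "1 \<le> y" "y < q ^ m - 1" "\<not> q\<^sup>2 dvd y"
    and eq: "x * (q\<^sup>2) ^ k mod (q ^ (2 * m) - 1) = y mod (q ^ (2 * m) - 1)"
  shows "k = 0 \<and> x = y"
proof -
  let ?N = "q ^ (2 * m) - 1"
  have small: "u * q ^ j < ?N" if "u < q ^ m - 1" "j \<le> m" for u j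
  proof -
    have "u * q ^ j \<le> u * q ^ m" using that q by (intro mult_left_mono power_increasing) auto
    also have "\<dots> \<le> (q ^ m - 2) * q ^ m" using that by (intro mult_right_mono) auto
    also have "\<dots> = q ^ (2 * m) - 2 * q ^ m" by (simp add: mult_2 power_add diff_mult_distrib)
    also have "\<dots> < ?N"
    proof -
      have "1 < 2 * q ^ m" using q by (simp add: Suc_lessI)
      moreover have "1 < q ^ (2 * m)" using q k by (intro one_less_power) auto
      ultimately show ?thesis by linarith
    qed
    finally show ?thesis .
  qed
  have yN: "y < ?N" and xN: "x < ?N" using small[of y 0] small[of x 0] assms by auto
  have pow: "(q\<^sup>2) ^ k = q ^ (2 * k)" by (simp add: power_mult)
  show ?thesis
  proof (cases "2 * k \<le> m")
    case True
    then have "x * q ^ (2 * k) < ?N" using small assms by simp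
    then have eq': "x * q ^ (2 * k) = y" using eq yN unfolding pow by simp
    have "k = 0"
    proof (rule ccontr)
      assume "k \<noteq> 0"
      then have "q\<^sup>2 dvd q ^ (2 * k)" by (intro le_imp_power_dvd) simp
      then show False using eq' y(3) by auto
    qed
    then show ?thesis using eq' by simp
  next
    case False
    have "x mod ?N = y * q ^ (2 * m - 2 * k) mod ?N"
      using mod_mult_power_swap[of q "2 * k" "2 * m" x y] eq q k unfolding pow by simp
    moreover have "y * q ^ (2 * m - 2 * k) < ?N" using small[of y "2 * m - 2 * k"] False assms by simp
    ultimately have "x = y * q ^ (2 * m - 2 * k)" using xN by simp
    moreover have "q\<^sup>2 dvd q ^ (2 * m - 2 * k)" using k by (intro le_imp_power_dvd) simp
    ultimately show ?thesis using x(3) by auto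
  qed
qed

lemma ex_power_decomposition:
  fixes Q x :: nat
  assumes "Q \<ge> 2" "x \<ge> 1"
  shows "\<exists>y j. \<not> Q dvd y \<and> x = y * Q ^ j"
  using assms(2)
proof (induction x rule: less_induct)
  case (less x)
  show ?case
  proof (cases "Q dvd x")
    case True
    then obtain w where w: "x = Q * w" by blast
    then have w1: "w \<ge> 1" using less.prems by (cases w) auto
    then have "1 * w < Q * w" using assms(1) by (intro mult_strict_right_mono) auto
    then have "w < x" using w by simp
    note w1 this
    then obtain y j where "\<not> Q dvd y" "w = y * Q ^ j" using less.IH by blast
    then show ?thesis using w by (intro exI[of _ y] exI[of _ "Suc j"]) simp
  qed (intro exI[of _ x] exI[of _ 0], simp)
qed

lemma card_not_dvd:
  fixes Q d :: nat
  assumes "Q \<ge> 1"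
  shows "card {x \<in> {1..d}. \<not> Q dvd x} = d - d div Q"
proof -
  have img: "{x \<in> {1..d}. Q dvd x} = (\<lambda>i. Q * i) ` {1..d div Q}"
  proof (intro equalityI subsetI)
    fix x assume "x \<in> {x \<in> {1..d}. Q dvd x}"
    then obtain i where "x = Q * i" "1 \<le> Q * i" "Q * i \<le> d" by auto
    then show "x \<in> (\<lambda>i. Q * i) ` {1..d div Q}" using assms
      by (auto simp: less_eq_div_iff_mult_less_eq mult.commute intro!: imageI)
  next
    fix x assume "x \<in> (\<lambda>i. Q * i) ` {1..d div Q}"
    then show "x \<in> {x \<in> {1..d}. Q dvd x}" using assms
      by (auto simp: less_eq_div_iff_mult_less_eq mult.commute)
  qed
  define B where "B = {x \<in> {1..d}. Q dvd x}"
  have "card B = d div Q"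
    unfolding B_def img using assms by (subst card_image) (auto simp: inj_on_def)
  moreover have "card ({1..d} - B) = card {1..d} - card B"
    by (rule card_Diff_subset) (auto simp: B_def)
  moreover have "{x \<in> {1..d}. \<not> Q dvd x} = {1..d} - B" by (auto simp: B_def)
  ultimately show ?thesis by simp
qed

lemma ceiling_mult_one_minus_inverse:
  fixes Q d :: nat
  assumes "Q \<ge> 1"
  shows "\<lceil>real d * (1 - 1 / real Q)\<rceil> = int (d - d div Q)"
proof -
  have "real d * (1 - 1 / real Q) = of_int (int d) + (- (real d / real Q))"
    using assms by (simp add: field_simps)
  then have "\<lceil>real d * (1 - 1 / real Q)\<rceil> = int d + \<lceil>- (real d / real Q)\<rceil>"
    by (simp only: ceiling_add_of_int add.commute[of "of_int (int d)"])
  also have "\<dots> = int d - int (d div Q)"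
    by (simp add: ceiling_minus floor_divide_of_nat_eq)
  finally show ?thesis by (simp add: of_nat_diff div_le_dividend)
qed

definition defining_set :: "nat \<Rightarrow> nat \<Rightarrow> nat \<Rightarrow> nat set" where
  "defining_set Q N \<delta> = (\<Union>x\<in>{1..<\<delta>}. cyclo_coset Q N x)"

text \<open>Stripping factors \<open>q^2\<close> moves each exponent below \<delta> to a
  representative of its coset that is not divisible by \<open>q^2\<close>. By
  \<open>cyclotomic_coset_leaders_unique\<close> such representatives lie in distinct cosets of full
  size \<open>m\<close>.\<close>

lemma card_defining_set:
  fixes q m \<delta> :: nat
  assumes q: "q \<ge> 2" and m: "m \<ge> 1" and \<delta>: "\<delta> \<le> q ^ m - 1" "\<delta> \<ge> 1"
  shows "card (defining_set (q\<^sup>2) (q ^ (2 * m) - 1) \<delta>) = m * ((\<delta> - 1) - (\<delta> - 1) div q\<^sup>2)"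
proof -
  let ?N = "q ^ (2 * m) - 1" and ?Q = "q\<^sup>2"
  have N: "?N = ?Q ^ m - 1" by (simp add: power_mult)
  have Q2: "?Q \<ge> 2" using q self_le_power[of q 2] by simp
  define X where "X = {x \<in> {1..\<delta>-1}. \<not> ?Q dvd x}"
  define f where "f = (\<lambda>(x, k). x * ?Q ^ k mod ?N)"
  have "defining_set ?Q ?N \<delta> = f ` (X \<times> {..<m})"
  proof (intro equalityI subsetI)
    fix z assume "z \<in> defining_set ?Q ?N \<delta>"
    then obtain x k where x: "1 \<le> x" "x < \<delta>" "z = x * ?Q ^ k mod ?N"
      by (auto simp: defining_set_def cyclo_coset_def)
    obtain y j where y: "\<not> ?Q dvd y" "x = y * ?Q ^ j"
      using ex_power_decomposition[OF Q2 x(1)] by blast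
    have "1 \<le> y" using y by (cases y) auto
    moreover have "y \<le> x" using y(2) Q2 by simp
    then have "y \<le> \<delta> - 1" using x by simp
    ultimately have "y \<in> X" using x y by (auto simp: X_def)
    have "z = y * ?Q ^ (j + k) mod ?N" using x y by (simp add: power_add mult.assoc)
    also have "\<dots> = y * ?Q ^ ((j + k) mod m) mod ?N"
      unfolding N by (rule mult_power_mod_exponent) (use Q2 in simp)
    finally have "z = f (y, (j + k) mod m)" by (simp add: f_def)
    then show "z \<in> f ` (X \<times> {..<m})" using \<open>y \<in> X\<close> m by (intro image_eqI) auto
  next
    fix z assume "z \<in> f ` (X \<times> {..<m})"
    then show "z \<in> defining_set ?Q ?N \<delta>"
      by (auto simp: f_def X_def defining_set_def cyclo_coset_def)
  qed
  moreover have "inj_on f (X \<times> {..<m})"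
  proof -
    have *: "x = y \<and> k = l" if "x \<in> X" "y \<in> X" "k < m" "l < m" "f (x, k) = f (y, l)" "l \<le> k" for x y k l
    proof -
      have bx: "1 \<le> x" "x < q ^ m - 1" "\<not> ?Q dvd x" and by1: "1 \<le> y" "y < q ^ m - 1" "\<not> ?Q dvd y"
        using that \<delta> by (auto simp: X_def)
      have "(x * ?Q ^ (k - l)) * ?Q ^ l = x * ?Q ^ k"
        using that by (simp add: mult.assoc flip: power_add)
      then have "(x * ?Q ^ (k - l)) * ?Q ^ l mod ?N = y * ?Q ^ l mod ?N"
        using that(5) by (simp only: f_def split)
      then have "(x * ?Q ^ (k - l)) mod ?N = (y * ?Q ^ l) * ?Q ^ (m - l) mod ?N"
        using mod_mult_power_swap[of ?Q l m "x * ?Q ^ (k - l)" "y * ?Q ^ l"] Q2 that unfolding N by simp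
      also have "(y * ?Q ^ l) * ?Q ^ (m - l) = y * ?Q ^ m"
        using that by (simp add: mult.assoc flip: power_add)
      also have "y * ?Q ^ m mod ?N = y mod ?N"
        unfolding N by (rule mod_mult_eq_of_mod_1[OF power_mod_eq_1]) (use Q2 in simp)
      finally have "k - l = 0 \<and> x = y"
        using bx by1 that q by (intro cyclotomic_coset_leaders_unique[of q "k - l" m x y]) auto
      then show ?thesis using that by simp
    qed
    show ?thesis
    proof (rule inj_onI, clarify)
      fix x k y l assume "x \<in> X" "y \<in> X" "k < m" "l < m" "f (x, k) = f (y, l)"
      then show "x = y \<and> k = l" using *[of x y k l] *[of y x l k] by (cases "l \<le> k") auto
    qed
  qed
  ultimately have "card (defining_set ?Q ?N \<delta>) = card X * m"
    by (simp add: card_image card_cartesian_product)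
  also have "card X = (\<delta> - 1) - (\<delta> - 1) div ?Q" unfolding X_def by (rule card_not_dvd) (use Q2 in simp)
  finally show ?thesis by simp
qed

lemma defining_set_less:
  "N > 0 \<Longrightarrow> z \<in> defining_set Q N \<delta> \<Longrightarrow> z < N"
  by (auto simp: defining_set_def cyclo_coset_def)

lemma finite_defining_set: "N > 0 \<Longrightarrow> finite (defining_set Q N \<delta>)"
  using defining_set_less by (meson bounded_nat_set_is_finite)

text \<open>The two cases reflect a parity: in the congruences below, \<open>x\<close> is multiplied
  by odd powers of \<open>q\<close>, and the largest one needed is \<open>q ^ m\<close> for odd
  \<open>m\<close> but only \<open>q ^ (m - 1)\<close> for even \<open>m\<close>, which leaves room
  for a further factor \<open>q\<close>. The terms are ordered so that truncated subtraction does no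
  harm.\<close>

definition delta_max :: "nat \<Rightarrow> nat \<Rightarrow> nat" where
  "delta_max q m = (if even m then q ^ (m + 1) - q\<^sup>2 + 1 else q ^ m - 1)"

text \<open>Multiplying by powers of \<open>q\<close>, the congruence is brought to a form where the left hand side lies
  strictly between 0 and \<open>q ^ (2 * m) - 1\<close>.\<close>

lemma not_dvd_hermitian:
  fixes q m :: nat
  assumes q: "q \<ge> 2" and m: "m \<ge> 1" and z: "1 \<le> z" "z \<le> q ^ m - 2" and x: "x \<le> delta_max q m"
  shows "\<not> (q ^ (2 * m) - 1) dvd q * x + z * (q\<^sup>2) ^ k"
proof
  let ?N = "q ^ (2 * m) - 1"
  assume dvd: "?N dvd q * x + z * (q\<^sup>2) ^ k"
  define l where "l = k mod m"
  have l: "l < m" using m by (simp add: l_def)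
  have qm: "q ^ m \<ge> 2" using q m self_le_power[of q m] by simp
  have "z * (q\<^sup>2) ^ k mod ?N = z * (q\<^sup>2) ^ l mod ?N"
    using mult_power_mod_exponent[of "q\<^sup>2" z k m] q unfolding l_def by (simp add: power_mult)
  then have "(q * x + z * (q\<^sup>2) ^ k) mod ?N = (q * x + z * (q\<^sup>2) ^ l) mod ?N" by (metis mod_add_right_eq)
  then have dvd: "?N dvd q * x + z * q ^ (2 * l)" using dvd by (simp add: dvd_eq_mod_eq_0 power_mult)
  have red: "?N dvd u + v" if "?N dvd u * q ^ (2 * m) + v" for u v
  proof -
    have "u * q ^ (2 * m) mod ?N = u mod ?N"
      by (rule mod_mult_eq_of_mod_1[OF power_mod_eq_1]) (use q in simp)
    then have "(u * q ^ (2 * m) + v) mod ?N = (u + v) mod ?N" by (metis mod_add_left_eq)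
    then show ?thesis using that by (simp add: dvd_eq_mod_eq_0)
  qed
  \<comment> \<open>Multiplying by the complementary power strips \<open>z\<close> of its power of
    \<open>q\<close>; \<open>formB\<close> strips \<open>x\<close> instead. Which of the two avoids
    wrap-around depends on \<open>l\<close>.\<close>
  have formA: "?N dvd q ^ j * x + z" if "l \<ge> 1" "j = 2 * m - 2 * l + 1" for j
  proof -
    have "?N dvd q ^ (2 * m - 2 * l) * (q * x + z * q ^ (2 * l))" using dvd by (rule dvd_mult)
    also have "\<dots> = z * (q ^ (2 * m - 2 * l) * q ^ (2 * l)) + q ^ j * x"
      using that by (simp add: algebra_simps)
    also have "q ^ (2 * m - 2 * l) * q ^ (2 * l) = q ^ (2 * m)" using l by (simp flip: power_add)
    finally show ?thesis using red by (simp add: add.commute)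
  qed
  have formB: "?N dvd x + z * q ^ (2 * l - 1)" if "l \<ge> 1"
  proof -
    have "?N dvd q ^ (2 * m - 1) * (q * x + z * q ^ (2 * l))" using dvd by (rule dvd_mult)
    also have "\<dots> = x * (q ^ (2 * m - 1) * q) + z * (q ^ (2 * m - 1) * q ^ (2 * l))"
      by (simp add: algebra_simps)
    also have "q ^ (2 * m - 1) * q = q ^ (2 * m)" using m by (simp flip: power_Suc2)
    also have "q ^ (2 * m - 1) * q ^ (2 * l) = q ^ (2 * l - 1) * q ^ (2 * m)"
      using that m by (simp add: add.commute flip: power_add)
    finally have "?N dvd (x + z * q ^ (2 * l - 1)) * q ^ (2 * m) + 0" by (simp add: algebra_simps)
    then show ?thesis using red by fastforce
  qed
  \<comment> \<open>The largest odd number up to \<open>m\<close>, because the exponent of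
    \<open>q\<close> at \<open>x\<close> in \<open>formA\<close> is odd.\<close>
  define M where "M = (if even m then m - 1 else m)"
  have sq: "q ^ (2 * m) = q ^ m * q ^ m" by (simp add: mult_2 power_add)
  have even_case: "m \<ge> 2 \<and> x + q\<^sup>2 \<le> q * q ^ m + 1 \<and> q ^ m = q * q ^ (m - 1) \<and> q \<le> q ^ (m - 1)" if "even m"
  proof -
    have m2: "m \<ge> 2" using that m by (auto elim: evenE)
    have "q\<^sup>2 \<le> q ^ (m + 1)" using q m by (intro power_increasing) auto
    then have "x + q\<^sup>2 \<le> q * q ^ m + 1" using x that by (simp add: delta_max_def)
    moreover have "q ^ m = q * q ^ (m - 1)" using m by (simp flip: power_Suc)
    moreover have "q \<le> q ^ (m - 1)" using m2 q by (intro self_le_power) auto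
    ultimately show ?thesis using m2 by blast
  qed
  have boundA: "q ^ j * x + z < ?N" if "j \<le> M" for j
  proof -
    have "q ^ j \<le> q ^ M" using that q by (intro power_increasing) auto
    then have "q ^ j * x \<le> q ^ M * x" by (rule mult_right_mono) simp
    moreover have "q ^ M * x + z + 2 \<le> q ^ (2 * m)"
    proof (cases "even m")
      case True
      note e = even_case[OF True]
      have "q ^ (m - 1) * (x + q\<^sup>2) \<le> q ^ (m - 1) * (q * q ^ m + 1)"
        using e by (intro mult_left_mono) auto
      also have "\<dots> = q ^ m * q ^ m + q ^ (m - 1)" using e by (simp add: algebra_simps)
      finally have "q ^ (m - 1) * x + q * q ^ m \<le> q ^ m * q ^ m + q ^ (m - 1)"
        using e by (simp add: algebra_simps power2_eq_square)
      moreover have "2 * q ^ m \<le> q * q ^ m" using q by simp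
      moreover have "q ^ (m - 1) \<le> q ^ m" using q by (intro power_increasing) auto
      moreover have "z + 2 \<le> q ^ m" using z qm by simp
      ultimately show ?thesis using True unfolding M_def sq by (simp only: if_True)
    next
      case False
      then have "q ^ m * x \<le> q ^ m * (q ^ m - 1)" using x by (simp add: delta_max_def)
      also have "\<dots> = q ^ m * q ^ m - q ^ m" by (simp add: diff_mult_distrib2)
      finally have "q ^ m * x + q ^ m \<le> q ^ m * q ^ m" using qm by (simp add: le_diff_conv2)
      moreover have "z + 2 \<le> q ^ m" using z qm by simp
      ultimately show ?thesis using False unfolding M_def sq by simp
    qed
    ultimately show ?thesis by linarith
  qed
  have boundB: "x + z * q ^ j < ?N" if "j \<le> m - 1" for j
  proof -
    have "q ^ j \<le> q ^ (m - 1)" using that q by (intro power_increasing) auto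
    then have "z * q ^ j \<le> z * q ^ (m - 1)" by simp
    also have "\<dots> \<le> (q ^ m - 2) * q ^ (m - 1)" using z by (intro mult_right_mono) auto
    also have "\<dots> = q ^ m * q ^ (m - 1) - 2 * q ^ (m - 1)" by (simp add: diff_mult_distrib)
    finally have zb: "z * q ^ j + 2 * q ^ (m - 1) \<le> q ^ m * q ^ (m - 1)"
      using qm by (simp add: le_diff_conv2)
    have qm1: "q ^ m = q * q ^ (m - 1)" using m by (simp flip: power_Suc)
    have "q ^ m * (2 * q ^ (m - 1)) \<le> q ^ m * q ^ m"
      unfolding qm1[symmetric] using q by (subst (2) qm1) (intro mult_left_mono mult_right_mono, auto)
    then have dbl: "2 * (q ^ m * q ^ (m - 1)) \<le> q ^ m * q ^ m" by (simp add: algebra_simps)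
    have x_le: "x + 2 \<le> q ^ m * q ^ (m - 1) + 2 * q ^ (m - 1)"
    proof (cases "even m")
      case True
      note e = even_case[OF True]
      have "q * q ^ m \<le> q ^ (m - 1) * q ^ m" using e by (intro mult_right_mono) auto
      moreover have "2 * q ^ (m - 1) \<ge> 2" using q by simp
      moreover have "q\<^sup>2 \<ge> 1" using q by simp
      ultimately show ?thesis using e unfolding mult.commute[of "q ^ m" "q ^ (m - 1)"] by linarith
    next
      case False
      then have "x \<le> q ^ m" using x by (simp add: delta_max_def)
      moreover have "q ^ m * 1 \<le> q ^ m * q ^ (m - 1)" using q by (intro mult_left_mono) auto
      moreover have "2 * q ^ (m - 1) \<ge> 2" using q by simp
      ultimately show ?thesis by linarith
    qed
    have "x + z * q ^ j + 2 \<le> q ^ (2 * m)" unfolding sq using zb dbl x_le by linarith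
    then show ?thesis by linarith
  qed
  \<comment> \<open>From \<open>2 * l - 1 \<ge> m\<close> follows
    \<open>2 * m - 2 * l + 1 \<le> m\<close>, and an odd number up to \<open>m\<close> is at most
    \<open>M\<close>. The two forms thus cover every \<open>l \<ge> 1\<close>.\<close>
  have "2 * m - 2 * l + 1 \<le> M" if "l \<ge> 1" "\<not> 2 * l - 1 \<le> m - 1"
  proof (cases "even m")
    case True
    then obtain t where "m = 2 * t" by (elim evenE)
    moreover from this that have "l \<ge> t + 1" by simp
    ultimately show ?thesis using that l True unfolding M_def by simp
  qed (use that l in \<open>simp add: M_def\<close>)
  then consider "l = 0" | "l \<ge> 1" "2 * l - 1 \<le> m - 1" | "l \<ge> 1" "2 * m - 2 * l + 1 \<le> M"
    by linarith
  then show False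
  proof cases
    case 1
    then have "?N dvd q ^ 1 * x + z" using dvd by simp
    moreover have "1 \<le> M" using m by (auto simp: M_def elim: evenE)
    ultimately show False using boundA[of 1] z by (auto dest: dvd_imp_le)
  next
    case 2
    then show False using formB boundB[of "2 * l - 1"] z q by (auto dest!: dvd_imp_le)
  next
    case 3
    define j where "j = 2 * m - 2 * l + 1"
    have "?N dvd q ^ j * x + z" using formA[OF 3(1) j_def] .
    moreover have "q ^ j * x + z < ?N" using boundA[of j] 3(2) by (simp add: j_def)
    ultimately show False using z by (auto dest!: dvd_imp_le)
  qed
qed

section \<open>Primitive BCH codes\<close>

lemma prod_linear_factors_dvd:
  fixes p :: "'b::field poly"
  assumes "finite A" "inj_on f A" "\<And>a. a \<in> A \<Longrightarrow> poly p (f a) = 0"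
  shows "(\<Prod>a\<in>A. [:- f a, 1:]) dvd p"
  using assms
proof (induction A rule: finite_induct)
  case (insert a A)
  then have "(\<Prod>a\<in>A. [:- f a, 1:]) dvd p" by (auto simp: inj_on_def)
  then obtain r where r: "p = (\<Prod>a\<in>A. [:- f a, 1:]) * r" by (elim dvdE)
  have "poly (\<Prod>a\<in>A. [:- f a, 1:]) (f a) \<noteq> 0"
    using insert.hyps insert.prems(1) by (auto simp: poly_prod inj_on_def)
  then have "poly r (f a) = 0" using insert.prems(2)[of a] r by simp
  then obtain s where s: "r = [:- f a, 1:] * s" unfolding poly_eq_0_iff_dvd by (elim dvdE)
  have "p = (\<Prod>a\<in>insert a A. [:- f a, 1:]) * s"
    using insert.hyps unfolding r s prod.insert[OF insert.hyps] by (simp only: mult_ac)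
  then show ?case by (metis dvd_triv_left)
qed simp

lemma degree_prod_linear_factors:
  "degree (\<Prod>a\<in>A. [:- f a, 1 :: 'b::field:]) = card A"
  by (subst degree_prod_sum_eq) auto

lemma coeff_cw_poly: "coeff (cw_poly n c) i = (if i < n then c i else 0)"
  by (simp add: cw_poly_def coeff_sum)

lemma poly_cw_poly: "poly (cw_poly n c) x = (\<Sum>i<n. c i * x ^ i)"
  by (simp add: cw_poly_def poly_sum poly_monom)

lemma degree_cw_poly_less: "n > 0 \<Longrightarrow> degree (cw_poly n c) < n"
  by (intro degree_lessI) (auto simp: coeff_cw_poly)

text \<open>For a word of small weight, pairing with the polynomial that vanishes at all but one of
  the support points isolates a single nonzero term.\<close>

lemma bch_bound:
  fixes \<alpha> :: "'b::{finite,field}"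
  assumes prim: "primitive_elt \<alpha>" "CARD('b) > 2"
    and root: "\<And>z. z \<in> {1..t} \<Longrightarrow> (\<Sum>i<CARD('b)-1. c i * \<alpha> ^ (z * i)) = 0"
    and nz: "i0 < CARD('b) - 1" "c i0 \<noteq> 0"
  shows "hamming_wt (CARD('b) - 1) c > t"
proof (rule ccontr)
  let ?N = "CARD('b) - 1"
  define I where "I = {i. i < ?N \<and> c i \<noteq> 0}"
  have fin: "finite I" and i0: "i0 \<in> I" using nz by (auto simp: I_def)
  assume "\<not> hamming_wt ?N c > t"
  then have card: "card I \<le> t" by (simp add: hamming_wt_def I_def)
  define h where "h = (\<Prod>i\<in>I-{i0}. [:- (\<alpha> ^ i), 1:])"
  have deg: "degree h < t"
    unfolding h_def degree_prod_linear_factors using card fin i0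
    by (metis card_Diff1_less order_less_le_trans)
  \<comment> \<open>The additional factor \<open>\<alpha> ^ i\<close> shifts the exponents
    contributed by \<open>h\<close> up by one, from below \<open>t\<close> into
    \<open>{1..t}\<close>, where the sums vanish.\<close>
  have "(\<Sum>i<?N. c i * \<alpha> ^ i * poly h (\<alpha> ^ i))
      = (\<Sum>i<?N. \<Sum>k\<le>degree h. coeff h k * (c i * \<alpha> ^ (Suc k * i)))"
    by (intro sum.cong refl)
      (simp add: poly_altdef sum_distrib_left power_add mult_ac flip: power_mult)
  also have "\<dots> = (\<Sum>k\<le>degree h. coeff h k * (\<Sum>i<?N. c i * \<alpha> ^ (Suc k * i)))"
    by (subst sum.swap) (simp add: sum_distrib_left)
  also have "\<dots> = 0"
  proof (intro sum.neutral ballI)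
    fix k assume "k \<in> {..degree h}"
    then have "Suc k \<in> {1..t}" using deg by simp
    then show "coeff h k * (\<Sum>i<?N. c i * \<alpha> ^ (Suc k * i)) = 0" by (simp only: root mult_zero_right)
  qed
  finally have "(\<Sum>i<?N. c i * \<alpha> ^ i * poly h (\<alpha> ^ i)) = 0" .
  moreover have "(\<Sum>i<?N. c i * \<alpha> ^ i * poly h (\<alpha> ^ i)) = (\<Sum>i\<in>{i0}. c i * \<alpha> ^ i * poly h (\<alpha> ^ i))"
  proof (rule sum.mono_neutral_right)
    show "\<forall>i\<in>{..<?N} - {i0}. c i * \<alpha> ^ i * poly h (\<alpha> ^ i) = 0"
    proof
      fix i assume i: "i \<in> {..<?N} - {i0}"
      show "c i * \<alpha> ^ i * poly h (\<alpha> ^ i) = 0"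
      proof (cases "c i = 0")
        case False
        then have "i \<in> I - {i0}" using i by (auto simp: I_def)
        then have "poly h (\<alpha> ^ i) = 0" using fin by (auto simp: h_def poly_prod)
        then show ?thesis by simp
      qed simp
    qed
  qed (use nz in auto)
  moreover have "poly h (\<alpha> ^ i0) \<noteq> 0"
  proof -
    have "\<alpha> ^ i0 \<noteq> \<alpha> ^ i" if "i \<in> I - {i0}" for i
      using that nz primitive_elt_power_eq_iff[OF prim, of i0 i] by (auto simp: I_def)
    then show ?thesis using fin by (auto simp: h_def poly_prod)
  qed
  ultimately show False using nz primitive_elt_nonzero[OF prim] by simp
qed

text \<open>Words have entries in the big field, and the code alphabet is the subset
  \<open>K\<close> of it. The exponent \<open>e\<close> makes the \<open>Q\<close>-th power a power
  of Frobenius, hence additive.\<close>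

locale primitive_bch =
  fixes \<alpha> :: "'b::{finite,field}" and Q m \<delta> e :: nat
  assumes card: "CARD('b) = Q ^ m" and Q_CHAR: "Q = CHAR('b) ^ e" and Q2: "Q \<ge> 2"
    and m1: "m \<ge> 1" and prim: "primitive_elt \<alpha>" and gt2: "CARD('b) > 2"
begin

definition N where "N = Q ^ m - 1"
definition K where "K = {x::'b. x ^ Q = x}"
definition Z where "Z = defining_set Q N \<delta>"
definition g where "g = bch_gen Q N \<alpha> \<delta>"
definition kvecs where "kvecs = {c. (\<forall>i. c i \<in> K) \<and> (\<forall>i\<ge>N. c i = 0)}"
definition ev where "ev c x = (\<Sum>i<N. c i * x ^ i :: 'b)"

lemma N_CARD: "CARD('b) - 1 = N"
  by (simp add: N_def card)

lemma N_pos: "N > 0"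
  using gt2 N_CARD by simp

lemma \<alpha>_nz: "\<alpha> \<noteq> 0"
  by (rule primitive_elt_nonzero[OF prim gt2])

lemmas power_eq_iff = primitive_elt_power_eq_iff[OF prim gt2, unfolded N_CARD]

lemma power_mod_N: "\<alpha> ^ (i mod N) = \<alpha> ^ i"
  using power_mod_CARD_minus_1[OF \<alpha>_nz] unfolding N_CARD .

lemma frob_add: "(x + y :: 'b) ^ Q = x ^ Q + y ^ Q"
  unfolding Q_CHAR by (rule power_CHAR_power_add)

lemma frob_sum: "(\<Sum>i\<in>A. f i :: 'b) ^ Q = (\<Sum>i\<in>A. f i ^ Q)"
  unfolding Q_CHAR by (rule power_CHAR_power_sum)

lemma frob_pow_sum: "(\<Sum>i\<in>A. f i :: 'b) ^ (Q ^ k) = (\<Sum>i\<in>A. f i ^ (Q ^ k))"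
  unfolding Q_CHAR power_mult[symmetric] by (rule power_CHAR_power_sum)

lemma K_0: "0 \<in> K"
  using Q2 by (simp add: K_def)

lemma K_add: "x \<in> K \<Longrightarrow> y \<in> K \<Longrightarrow> x + y \<in> K"
  by (simp add: K_def frob_add)

lemma K_mult: "x \<in> K \<Longrightarrow> y \<in> K \<Longrightarrow> x * y \<in> K"
  by (simp add: K_def power_mult_distrib)

lemma K_power: "x \<in> K \<Longrightarrow> x ^ k \<in> K"
  by (simp add: K_def mult.commute flip: power_mult) (simp add: power_mult)

lemma K_uminus: "x \<in> K \<Longrightarrow> - x \<in> K"
proof -
  assume x: "x \<in> K"
  have "(- x) ^ Q + x ^ Q = 0" using frob_add[of "- x" x] Q2 by (simp add: power_0_left)
  then show ?thesis using x by (simp add: K_def eq_neg_iff_add_eq_0)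
qed

lemma K_sum: "(\<And>i. i \<in> A \<Longrightarrow> f i \<in> K) \<Longrightarrow> sum f A \<in> K"
  by (induction A rule: infinite_finite_induct) (auto intro: K_0 K_add)

lemma K_pow_Q: "x \<in> K \<Longrightarrow> x ^ (Q ^ k) = x"
  by (induction k) (simp_all add: K_def power_mult)

lemma ev_frob:
  assumes "\<And>i. c i \<in> K"
  shows "ev c x ^ (Q ^ k) = ev c (x ^ (Q ^ k))"
  unfolding ev_def frob_pow_sum using K_pow_Q[OF assms]
  by (simp add: power_mult_distrib mult.commute flip: power_mult)

text \<open>Coefficients in \<open>K\<close> are fixed by the \<open>Q\<close>-th power, so
  evaluation commutes with it, and vanishing at one exponent spreads over its cyclotomic
  coset.\<close>

lemma Z_closed_roots:
  assumes "\<And>i. c i \<in> K" "\<And>z. z \<in> {1..<\<delta>} \<Longrightarrow> ev c (\<alpha> ^ z) = 0" "z \<in> Z"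
  shows "ev c (\<alpha> ^ z) = 0"
proof -
  obtain x k where x: "x \<in> {1..<\<delta>}" "z = x * Q ^ k mod N"
    using assms(3) by (auto simp: Z_def defining_set_def cyclo_coset_def)
  have "ev c (\<alpha> ^ z) = ev c (\<alpha> ^ x) ^ (Q ^ k)"
    unfolding x(2) power_mod_N ev_frob[OF assms(1)] by (simp add: power_mult)
  then show ?thesis using assms(2)[OF x(1)] Q2 by (simp add: power_0_left)
qed

lemma fin_Z: "finite Z"
  unfolding Z_def by (rule finite_defining_set[OF N_pos])

lemma g_eq: "g = (\<Prod>z\<in>Z. [:- (\<alpha> ^ z), 1:])"
  by (simp add: g_def bch_gen_def Z_def defining_set_def)

lemma g_nz: "g \<noteq> 0"
  using fin_Z by (simp add: g_eq)

lemma degree_g: "degree g = card Z"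
  unfolding g_eq by (rule degree_prod_linear_factors)

lemma inj_power_Z: "inj_on (\<lambda>z. \<alpha> ^ z) Z"
  using defining_set_less[OF N_pos] by (auto simp: inj_on_def power_eq_iff Z_def)

definition frob_poly where "frob_poly = map_poly (\<lambda>x::'b. x ^ Q)"

lemma coeff_frob_poly [simp]: "coeff (frob_poly p) i = coeff p i ^ Q"
  using Q2 by (simp add: frob_poly_def coeff_map_poly)

lemma frob_poly_mult: "frob_poly (p * r) = frob_poly p * frob_poly r"
  by (intro poly_eqI) (simp add: coeff_mult frob_sum power_mult_distrib)

lemma frob_poly_prod: "frob_poly (\<Prod>i\<in>A. f i) = (\<Prod>i\<in>A. frob_poly (f i))"
proof (induction A rule: infinite_finite_induct)
  case (infinite A)
  then show ?case using Q2 by (intro poly_eqI) (auto simp: coeff_1 power_0_left)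
next
  case empty
  then show ?case using Q2 by (intro poly_eqI) (auto simp: coeff_1 power_0_left)
qed (simp add: frob_poly_mult)

lemma frob_poly_eq_iff: "frob_poly p = p \<longleftrightarrow> (\<forall>i. coeff p i \<in> K)"
  by (auto simp: poly_eq_iff K_def)

text \<open>Multiplication by \<open>Q\<close> permutes the defining set, so Frobenius only permutes
  the linear factors of \<open>g\<close>. This places the coefficients of \<open>g\<close> in
  \<open>K\<close>.\<close>

lemma frob_poly_g: "frob_poly g = g"
proof -
  define s where "s z = z * Q mod N" for z
  have "s ` Z \<subseteq> Z"
  proof clarify
    fix z assume "z \<in> Z"
    then obtain x k where x: "x \<in> {1..<\<delta>}" "z = x * Q ^ k mod N"
      by (auto simp: Z_def defining_set_def cyclo_coset_def)
    have "s z = x * Q ^ Suc k mod N"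
      unfolding s_def x(2) mod_mult_left_eq by (simp add: mult_ac)
    then show "s z \<in> Z" using x(1) unfolding Z_def defining_set_def cyclo_coset_def by blast
  qed
  moreover have "inj_on s Z"
  proof (rule inj_onI)
    fix y z assume yz: "y \<in> Z" "z \<in> Z" "s y = s z"
    have *: "w * Q * Q ^ (m - 1) mod N = w" if "w \<in> Z" for w
    proof -
      have "w * Q * Q ^ (m - 1) = w * Q ^ m" using m1 by (simp add: mult.assoc flip: power_Suc)
      also have "\<dots> mod N = w mod N"
        unfolding N_def by (rule mod_mult_eq_of_mod_1[OF power_mod_eq_1]) (use Q2 in simp)
      also have "w mod N = w" using defining_set_less[OF N_pos] that by (auto simp: Z_def)
      finally show ?thesis .
    qed
    have "y = (y * Q mod N) * Q ^ (m - 1) mod N" using *[OF yz(1)] by (simp add: mod_mult_left_eq)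
    also have "\<dots> = z" using yz(3) *[OF yz(2)] by (simp add: s_def mod_mult_left_eq)
    finally show "y = z" .
  qed
  ultimately have bij: "bij_betw s Z Z" using fin_Z by (simp add: bij_betw_def endo_inj_surj)
  have lin: "frob_poly [:- (\<alpha> ^ z), 1:] = [:- (\<alpha> ^ s z), 1:]" for z
  proof -
    have "(- (\<alpha> ^ z)) ^ Q + (\<alpha> ^ z) ^ Q = 0" using frob_add[of "- (\<alpha> ^ z)" "\<alpha> ^ z"] Q2
      by (simp add: power_0_left)
    then have "(- (\<alpha> ^ z)) ^ Q = - (\<alpha> ^ s z)"
      by (simp add: s_def power_mod_N eq_neg_iff_add_eq_0 power_mult)
    then show ?thesis using Q2
      by (intro poly_eqI) (auto simp: coeff_pCons power_0_left split: nat.splits)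
  qed
  have "frob_poly g = (\<Prod>z\<in>Z. [:- (\<alpha> ^ s z), 1:])" by (simp add: g_eq frob_poly_prod lin)
  also have "\<dots> = g" unfolding g_eq by (rule prod.reindex_bij_betw[OF bij])
  finally show ?thesis .
qed

lemma bch_code_iff_gen:
  "c \<in> bch_code Q \<alpha> \<delta> \<longleftrightarrow> c \<in> kvecs \<and> (\<exists>f. (\<forall>i. coeff f i \<in> K) \<and> cw_poly N c = f * g)"
  unfolding bch_code_def Let_def N_CARD kvecs_def K_def g_def by auto

text \<open>Turns divisibility by \<open>g\<close> into linear conditions. In the converse the
  cofactor has coefficients in \<open>K\<close>: Frobenius fixes the word and \<open>g\<close>, and
  \<open>g\<close> may be cancelled.\<close>

lemma bch_code_iff:
  "c \<in> bch_code Q \<alpha> \<delta> \<longleftrightarrow> c \<in> kvecs \<and> (\<forall>z\<in>{1..<\<delta>}. ev c (\<alpha> ^ z) = 0)"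
proof
  assume c: "c \<in> bch_code Q \<alpha> \<delta>"
  then obtain f where f: "cw_poly N c = f * g" unfolding bch_code_iff_gen by blast
  have "ev c (\<alpha> ^ z) = 0" if z: "z \<in> {1..<\<delta>}" for z
  proof -
    have "z mod N \<in> Z"
      unfolding Z_def defining_set_def cyclo_coset_def using z by (auto intro!: bexI[of _ z] exI[of _ 0])
    then have "poly g (\<alpha> ^ (z mod N)) = 0" using fin_Z by (auto simp: g_eq poly_prod)
    then have "poly (cw_poly N c) (\<alpha> ^ z) = 0" by (simp add: f power_mod_N)
    then show ?thesis by (simp add: poly_cw_poly ev_def)
  qed
  then show "c \<in> kvecs \<and> (\<forall>z\<in>{1..<\<delta>}. ev c (\<alpha> ^ z) = 0)" using c by (simp add: bch_code_iff_gen)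
next
  assume c: "c \<in> kvecs \<and> (\<forall>z\<in>{1..<\<delta>}. ev c (\<alpha> ^ z) = 0)"
  have "g dvd cw_poly N c"
    unfolding g_eq
  proof (rule prod_linear_factors_dvd[OF fin_Z inj_power_Z])
    fix z assume "z \<in> Z"
    then show "poly (cw_poly N c) (\<alpha> ^ z) = 0"
      using Z_closed_roots[of c z] c by (simp add: poly_cw_poly ev_def kvecs_def)
  qed
  then obtain f where f: "cw_poly N c = f * g" by (metis dvdE mult.commute)
  have "frob_poly (cw_poly N c) = cw_poly N c"
    using c K_0 by (simp add: frob_poly_eq_iff coeff_cw_poly kvecs_def)
  then have "frob_poly f * g = f * g" using frob_poly_mult[of f g] by (simp add: f frob_poly_g)
  then have "frob_poly f = f" using g_nz by simp
  then show "c \<in> bch_code Q \<alpha> \<delta>" using c f by (auto simp: bch_code_iff_gen frob_poly_eq_iff)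
qed

text \<open>Multiplication by \<open>g\<close> parametrises the code by polynomials over
  \<open>K\<close> with \<open>N - card Z\<close> free coefficients.\<close>

lemma card_bch_code:
  assumes "card Z \<le> N"
  shows "card (bch_code Q \<alpha> \<delta>) = card K ^ (N - card Z)"
proof -
  let ?k = "N - card Z"
  define V where "V = {x :: nat \<Rightarrow> 'b. (\<forall>i<?k. x i \<in> K) \<and> (\<forall>i\<ge>?k. x i = 0)}"
  have gK: "coeff g i \<in> K" for i using frob_poly_g by (simp add: frob_poly_eq_iff)
  have "bij_betw (\<lambda>v. coeff (cw_poly ?k v * g)) V (bch_code Q \<alpha> \<delta>)"
  proof (rule bij_betw_imageI)
    show "inj_on (\<lambda>v. coeff (cw_poly ?k v * g)) V"
    proof (rule inj_onI)
      fix v w assume vw: "v \<in> V" "w \<in> V" "coeff (cw_poly ?k v * g) = coeff (cw_poly ?k w * g)"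
      then have "cw_poly ?k v = cw_poly ?k w" using g_nz by (simp add: coeff_inject)
      then have "coeff (cw_poly ?k v) i = coeff (cw_poly ?k w) i" for i by simp
      then have "v i = w i" if "i < ?k" for i using that by (metis coeff_cw_poly)
      moreover have "v i = w i" if "\<not> i < ?k" for i using that vw(1,2) by (simp add: V_def)
      ultimately show "v = w" by blast
    qed
    show "(\<lambda>v. coeff (cw_poly ?k v * g)) ` V = bch_code Q \<alpha> \<delta>"
    proof (intro equalityI subsetI)
      fix c assume "c \<in> (\<lambda>v. coeff (cw_poly ?k v * g)) ` V"
      then obtain v where v: "v \<in> V" "c = coeff (cw_poly ?k v * g)" by blast
      have vK: "coeff (cw_poly ?k v) i \<in> K" for i using v(1) K_0 by (auto simp: coeff_cw_poly V_def)
      have zero: "c i = 0" if "i \<ge> N" for i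
      proof (cases "?k = 0")
        case True
        then show ?thesis by (simp add: v(2) cw_poly_def)
      next
        case False
        then have "degree (cw_poly ?k v) < ?k" by (intro degree_cw_poly_less) simp
        then have "degree (cw_poly ?k v * g) < i"
          using degree_mult_le[of "cw_poly ?k v" g] degree_g that assms by linarith
        then show ?thesis by (simp add: v(2) coeff_eq_0)
      qed
      have "c i \<in> K" for i unfolding v(2) coeff_mult by (intro K_sum K_mult vK gK)
      then have "c \<in> kvecs" using zero by (simp add: kvecs_def)
      moreover have "cw_poly N c = cw_poly ?k v * g"
        by (intro poly_eqI) (use zero v(2) in \<open>auto simp: coeff_cw_poly\<close>)
      ultimately show "c \<in> bch_code Q \<alpha> \<delta>" unfolding bch_code_iff_gen using vK by blast
    next
      fix c assume "c \<in> bch_code Q \<alpha> \<delta>"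
      then obtain f where c: "c \<in> kvecs" and fK: "\<And>i. coeff f i \<in> K" and f: "cw_poly N c = f * g"
        unfolding bch_code_iff_gen by blast
      have fz: "coeff f i = 0" if i: "i \<ge> ?k" for i
      proof (cases "f = 0")
        case False
        then have "degree f + card Z < N"
          using degree_cw_poly_less[OF N_pos, of c] g_nz unfolding f by (simp add: degree_mult_eq degree_g)
        then show ?thesis using i by (intro coeff_eq_0) simp
      qed simp
      have "cw_poly ?k (coeff f) = f" by (intro poly_eqI) (simp add: coeff_cw_poly fz)
      then have "c = coeff (cw_poly ?k (coeff f) * g)"
        unfolding f[symmetric] using c by (auto simp: coeff_cw_poly kvecs_def fun_eq_iff simp flip: f)
      moreover have "coeff f \<in> V" using fK fz by (simp add: V_def)
      ultimately show "c \<in> (\<lambda>v. coeff (cw_poly ?k v * g)) ` V" by blast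
    qed
  qed
  then have "card (bch_code Q \<alpha> \<delta>) = card V" by (simp add: bij_betw_same_card)
  also have "\<dots> = card K ^ ?k" unfolding V_def by (rule card_vectors_over(1)) (simp add: K_def)
  finally show ?thesis .
qed

lemma weight_gt:
  assumes "c \<in> kvecs" "c \<noteq> (\<lambda>_. 0)" "\<And>z. z \<in> {1..t} \<Longrightarrow> ev c (\<alpha> ^ z) = 0"
  shows "hamming_wt N c > t"
proof -
  obtain i where i: "c i \<noteq> 0" using assms(2) by auto
  then have "i < N" using assms(1) unfolding kvecs_def by (cases "i < N") auto
  moreover have "(\<Sum>i<CARD('b)-1. c i * \<alpha> ^ (z * i)) = 0" if "z \<in> {1..t}" for z
    using assms(3)[OF that] unfolding N_CARD ev_def by (simp add: power_mult)
  ultimately show ?thesis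
    using bch_bound[OF prim gt2, of t c i] i unfolding N_CARD by blast
qed

lemma bch_code_scale:
  assumes "c \<in> bch_code Q \<alpha> \<delta>" "t \<in> K"
  shows "(\<lambda>i. t * c i) \<in> bch_code Q \<alpha> \<delta>"
proof -
  have "ev (\<lambda>i. t * c i) x = t * ev c x" for x by (simp add: ev_def sum_distrib_left mult.assoc)
  then show ?thesis using assms by (auto simp: bch_code_iff kvecs_def intro: K_mult)
qed

lemma bch_code_add:
  assumes "c \<in> bch_code Q \<alpha> \<delta>" "d \<in> bch_code Q \<alpha> \<delta>"
  shows "(\<lambda>i. c i + d i) \<in> bch_code Q \<alpha> \<delta>"
proof -
  have "ev (\<lambda>i. c i + d i) x = ev c x + ev d x" for x by (simp add: ev_def sum.distrib algebra_simps)
  then show ?thesis using assms by (auto simp: bch_code_iff kvecs_def intro: K_add)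
qed

lemma bij_rotate: "bij_betw (\<lambda>i. (i + j) mod N) {..<N} {..<N}"
proof -
  have "inj_on (\<lambda>i. (i + j) mod N) {..<N}"
  proof (rule inj_onI)
    fix a b assume *: "a \<in> {..<N}" "b \<in> {..<N}" "(a + j) mod N = (b + j) mod N"
    then have "(int a + int j) mod int N = (int b + int j) mod int N"
      by (metis of_nat_add zmod_int)
    then have "int a mod int N = int b mod int N" by (metis add_diff_cancel_right' mod_diff_left_eq)
    then show "a = b" using * by (simp add: flip: zmod_int)
  qed
  moreover have "(\<lambda>i. (i + j) mod N) ` {..<N} \<subseteq> {..<N}" using N_pos by auto
  ultimately show ?thesis by (simp add: bij_betw_def endo_inj_surj)
qed

lemma bch_code_rotate:
  assumes c: "c \<in> bch_code Q \<alpha> \<delta>"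
  shows "(\<lambda>i. if i < N then c ((i + j) mod N) else 0) \<in> bch_code Q \<alpha> \<delta>"
proof -
  let ?r = "\<lambda>i. if i < N then c ((i + j) mod N) else 0"
  have "ev ?r (\<alpha> ^ z) = 0" if z: "z \<in> {1..<\<delta>}" for z
  proof -
    have "ev ?r (\<alpha> ^ z) * \<alpha> ^ (z * j) = (\<Sum>i<N. c ((i + j) mod N) * (\<alpha> ^ z) ^ ((i + j) mod N))"
      unfolding ev_def sum_distrib_right
    proof (intro sum.cong refl)
      fix i assume "i \<in> {..<N}"
      have "(\<alpha> ^ z) ^ ((i + j) mod N) = (\<alpha> ^ z) ^ (i + j)"
        using power_mod_N[of "i + j"] by (metis power_mult mult.commute)
      then show "?r i * (\<alpha> ^ z) ^ i * \<alpha> ^ (z * j) = c ((i + j) mod N) * (\<alpha> ^ z) ^ ((i + j) mod N)"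
        using \<open>i \<in> {..<N}\<close> by (simp add: power_add power_mult)
    qed
    also have "\<dots> = ev c (\<alpha> ^ z)"
      unfolding ev_def by (rule sum.reindex_bij_betw[OF bij_rotate])
    also have "\<dots> = 0" using c z by (simp add: bch_code_iff)
    finally show ?thesis using \<alpha>_nz by simp
  qed
  then show ?thesis using c K_0 by (auto simp: bch_code_iff kvecs_def)
qed

text \<open>Entry \<open>i\<close> is the trace of \<open>b * inverse \<alpha> ^ (y * i)\<close>
  from the big field to \<open>K\<close>, as in Delsarte duality. Through such words a condition
  over the big field can be tested by words over \<open>K\<close>.\<close>

definition trace_word where
  "trace_word b y = (\<lambda>i. if i < N then \<Sum>j<m. (b * inverse \<alpha> ^ (y * i)) ^ (Q ^ j) else 0)"

text \<open>Expanding the trace gives geometric sums whose ratios are quotients of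
  \<open>\<alpha> ^ z\<close> and \<open>\<alpha> ^ (y * Q ^ j)\<close>. A ratio equals 1 only if
  \<open>y\<close> lies in the coset of \<open>z\<close>, which \<open>y \<notin> Z\<close>
  excludes.\<close>

lemma trace_word_in_bch_code:
  assumes y: "y < N" "y \<notin> Z"
  shows "trace_word b y \<in> bch_code Q \<alpha> \<delta>"
proof -
  have trK: "(\<Sum>j<m. x ^ (Q ^ j)) \<in> K" for x :: 'b
  proof -
    have "(\<Sum>j<m. x ^ (Q ^ j)) ^ Q + x = (\<Sum>j<m. x ^ (Q ^ Suc j)) + x"
      by (simp add: frob_sum mult.commute flip: power_mult)
    also have "\<dots> = (\<Sum>j<Suc m. x ^ (Q ^ j))" by (subst sum.lessThan_Suc_shift) simp
    also have "\<dots> = (\<Sum>j<m. x ^ (Q ^ j)) + x" using power_CARD_eq_self[of x] by (simp add: card)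
    finally show ?thesis by (simp add: K_def)
  qed
  have "ev (trace_word b y) (\<alpha> ^ z) = 0" if z: "z \<in> {1..<\<delta>}" for z
  proof -
    have "ev (trace_word b y) (\<alpha> ^ z)
        = (\<Sum>i<N. \<Sum>j<m. b ^ (Q ^ j) * (\<alpha> ^ z * inverse \<alpha> ^ (y * Q ^ j)) ^ i)"
      unfolding ev_def
      by (intro sum.cong refl)
        (simp add: trace_word_def sum_distrib_left sum_distrib_right power_mult_distrib mult_ac
          flip: power_mult)
    also have "\<dots> = (\<Sum>j<m. b ^ (Q ^ j) * (\<Sum>i<N. (\<alpha> ^ z * inverse \<alpha> ^ (y * Q ^ j)) ^ i))"
      by (subst sum.swap) (simp add: sum_distrib_left)
    also have "\<dots> = 0"
    proof (intro sum.neutral ballI)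
      fix j assume "j \<in> {..<m}"
      define \<rho> where "\<rho> = \<alpha> ^ z * inverse \<alpha> ^ (y * Q ^ j)"
      have "\<rho> \<noteq> 1"
      proof
        assume "\<rho> = 1"
        then have "\<alpha> ^ z = \<alpha> ^ (y * Q ^ j)" using \<alpha>_nz by (simp add: \<rho>_def power_inverse field_simps)
        then have "y * Q ^ j mod N = z mod N" by (simp add: power_eq_iff)
        then have "y mod N = z * Q ^ (m - j) mod N"
          unfolding N_def using Q2 \<open>j \<in> {..<m}\<close> by (intro mod_mult_power_swap) auto
        then have "y \<in> cyclo_coset Q N z" using y(1) by (auto simp: cyclo_coset_def)
        then show False using y(2) z by (auto simp: Z_def defining_set_def)
      qed
      moreover have "\<rho> ^ N = 1"
        using power_CARD_minus_1[of \<rho>] \<alpha>_nz unfolding N_CARD by (simp add: \<rho>_def)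
      ultimately have "(\<Sum>i<N. \<rho> ^ i) = 0" by (simp add: geometric_sum)
      then show "b ^ (Q ^ j) * (\<Sum>i<N. (\<alpha> ^ z * inverse \<alpha> ^ (y * Q ^ j)) ^ i) = 0"
        by (simp add: \<rho>_def)
    qed
    finally show ?thesis .
  qed
  then show ?thesis using trK K_0 by (auto simp: bch_code_iff kvecs_def trace_word_def)
qed

text \<open>The pairing with \<open>trace_word b y\<close> is the trace of \<open>b\<close> times
  the sum in the conclusion. Were that sum nonzero, its multiples would fill the field and the trace
  would vanish everywhere.\<close>

lemma trace_word_orthogonal_imp_root:
  assumes dK: "\<And>i. d i \<in> K" and orth: "\<And>b. (\<Sum>i<N. trace_word b y i * d i) = 0"
  shows "(\<Sum>i<N. inverse \<alpha> ^ (y * i) * d i) = 0"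
proof (rule ccontr)
  let ?T = "\<Sum>i<N. inverse \<alpha> ^ (y * i) * d i"
  assume T: "?T \<noteq> 0"
  have "(\<Sum>j<m. (b * ?T) ^ (Q ^ j)) = 0" for b
  proof -
    have "(\<Sum>j<m. (b * ?T) ^ (Q ^ j)) = (\<Sum>j<m. \<Sum>i<N. (b * inverse \<alpha> ^ (y * i)) ^ (Q ^ j) * d i)"
      by (simp add: sum_distrib_left frob_pow_sum power_mult_distrib K_pow_Q[OF dK] mult.assoc)
    also have "\<dots> = (\<Sum>i<N. trace_word b y i * d i)"
      by (subst sum.swap) (simp add: trace_word_def sum_distrib_right)
    finally show ?thesis using orth by simp
  qed
  then have all: "(\<Sum>j<m. x ^ (Q ^ j)) = 0" for x :: 'b
    using T by (metis nonzero_eq_divide_eq)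
  obtain x :: 'b where "(\<Sum>j<m. x ^ (Q ^ j)) \<noteq> 0"
    by (rule trace_sum_not_zero[OF card Q2]) (use m1 in auto)
  then show False using all by blast
qed

end

section \<open>The Hermitian dual\<close>

text \<open>The image of \<iota> is fixed by the \<open>q\<close>-th power, so
  \<open>\<gamma> ^ q \<noteq> \<gamma>\<close> makes 1 and \<gamma> a basis of \<open>K\<close>
  over it. On \<open>K\<close> the \<open>q\<close>-th power is the conjugation of the Hermitian
  product.\<close>

locale hermitian_bch = primitive_bch \<alpha> Q m \<delta> e
  for \<alpha> :: "'b::{finite,field}" and Q m \<delta> e :: nat +
  fixes \<iota> :: "'a::{finite,field} \<Rightarrow> 'b" and \<gamma> :: 'b and q :: nat
  assumes q: "q = CARD('a)" and Qq: "Q = q\<^sup>2"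
    and \<iota>_1: "\<iota> 1 = 1" and \<iota>_add: "\<And>x y. \<iota> (x + y) = \<iota> x + \<iota> y"
    and \<iota>_mult: "\<And>x y. \<iota> (x * y) = \<iota> x * \<iota> y" and \<iota>_inj: "inj \<iota>"
    and \<gamma>K: "\<gamma> \<in> K" and \<gamma>q: "\<gamma> ^ q \<noteq> \<gamma>"
    and \<delta>: "2 \<le> \<delta>" "\<delta> \<le> q ^ m - 1"
begin

lemma q2: "q \<ge> 2"
  unfolding q by (rule CARD_field_ge_2)

lemma N_q: "N = q ^ (2 * m) - 1"
  unfolding N_def unfolding Qq by (simp add: power_mult)

lemma CHAR_ab: "CHAR('b) = CHAR('a)"
  by (rule CHAR_eq_of_CARD_power[where k="2 * m"]) (simp add: card Qq q power_mult)

lemma conj_sum: "(\<Sum>i\<in>A. f i :: 'b) ^ q = (\<Sum>i\<in>A. f i ^ q)"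
  unfolding q CARD_eq_CHAR_power_ff_deg[where 'a='a] CHAR_ab[symmetric] by (rule power_CHAR_power_sum)

lemma conj_add: "(x + y :: 'b) ^ q = x ^ q + y ^ q"
  unfolding q CARD_eq_CHAR_power_ff_deg[where 'a='a] CHAR_ab[symmetric] by (rule power_CHAR_power_add)

lemma conj_conj: "x \<in> K \<Longrightarrow> (x ^ q) ^ q = x"
  unfolding K_def unfolding Qq by (simp add: power2_eq_square flip: power_mult)

lemma \<iota>_0: "\<iota> 0 = 0"
  using \<iota>_add[of 0 0] by (metis add_0 add_cancel_left_right)

lemma \<iota>_minus: "\<iota> (- x) = - \<iota> x"
  using \<iota>_add[of x "- x"] by (simp add: \<iota>_0 eq_neg_iff_add_eq_0 add.commute)

lemma \<iota>_sum: "\<iota> (\<Sum>i\<in>A. f i) = (\<Sum>i\<in>A. \<iota> (f i))"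
  by (induction A rule: infinite_finite_induct) (simp_all add: \<iota>_0 \<iota>_add)

lemma \<iota>_eq_0_iff: "\<iota> x = 0 \<longleftrightarrow> x = 0"
  using \<iota>_inj \<iota>_0 by (metis injD)

lemma \<iota>_conj: "\<iota> x ^ q = \<iota> x"
proof -
  have "\<iota> (x ^ k) = \<iota> x ^ k" for k by (induction k) (simp_all add: \<iota>_1 \<iota>_mult)
  then show ?thesis using power_CARD_eq_self[of x] by (metis q)
qed

lemma \<iota>_K: "\<iota> x \<in> K"
proof -
  have "\<iota> x ^ Q = (\<iota> x ^ q) ^ q" by (simp add: Qq power2_eq_square flip: power_mult)
  then show ?thesis by (simp add: K_def \<iota>_conj)
qed

lemma pair_eq_0_iff: "\<iota> a + \<gamma> * \<iota> b = 0 \<longleftrightarrow> a = 0 \<and> b = 0"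
proof
  assume *: "\<iota> a + \<gamma> * \<iota> b = 0"
  have "b = 0"
  proof (rule ccontr)
    assume b: "b \<noteq> 0"
    have "\<gamma> * \<iota> b = \<iota> (- a)" using * by (simp add: \<iota>_minus eq_neg_iff_add_eq_0 add.commute)
    then have "\<gamma> * (\<iota> b * \<iota> (1 / b)) = \<iota> (- a) * \<iota> (1 / b)" by (simp only: mult.assoc[symmetric])
    then have "\<gamma> = \<iota> (- a * (1 / b))" using b by (simp add: \<iota>_1 flip: \<iota>_mult)
    then show False using \<gamma>q \<iota>_conj by metis
  qed
  then show "a = 0 \<and> b = 0" using * by (simp add: \<iota>_0 \<iota>_eq_0_iff)
qed (simp add: \<iota>_0)

lemma pair_inj: "inj (\<lambda>(a, b). \<iota> a + \<gamma> * \<iota> b)"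
proof (rule injI, clarify)
  fix a b a' b' assume "\<iota> a + \<gamma> * \<iota> b = \<iota> a' + \<gamma> * \<iota> b'"
  then have "(\<iota> a + \<gamma> * \<iota> b) + - (\<iota> a' + \<gamma> * \<iota> b') = 0" by simp
  also have "(\<iota> a + \<gamma> * \<iota> b) + - (\<iota> a' + \<gamma> * \<iota> b') = \<iota> (a + - a') + \<gamma> * \<iota> (b + - b')"
    unfolding \<iota>_add \<iota>_minus by (simp add: algebra_simps)
  finally have "a + - a' = 0 \<and> b + - b' = 0" unfolding pair_eq_0_iff .
  then show "a = a' \<and> b = b'" by simp
qed

text \<open>The pairs give \<open>q^2\<close> distinct elements of \<open>K\<close>, and
  \<open>X^Q - X\<close> has no more roots.\<close>

lemma K_eq: "K = range (\<lambda>(a, b). \<iota> a + \<gamma> * \<iota> b)" and card_K: "card K = q\<^sup>2"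
proof -
  have sub: "range (\<lambda>(a, b). \<iota> a + \<gamma> * \<iota> b) \<subseteq> K" by (auto intro: K_add K_mult \<iota>_K \<gamma>K)
  have c: "card (range (\<lambda>(a, b). \<iota> a + \<gamma> * \<iota> b)) = q\<^sup>2"
    by (simp add: card_image[OF pair_inj] q power2_eq_square)
  have "card K \<le> q\<^sup>2" using card_power_fixed_le[OF Q2, where 'a='b] unfolding K_def unfolding Qq .
  then show "K = range (\<lambda>(a, b). \<iota> a + \<gamma> * \<iota> b)" using sub c card_seteq[OF _ sub] by (simp add: K_def)
  then show "card K = q\<^sup>2" using c by simp
qed

definition emb :: "'a svec \<Rightarrow> nat \<Rightarrow> 'b" where
  "emb u = (\<lambda>i. \<iota> (fst u i) + \<gamma> * \<iota> (snd u i))"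

lemma emb_K: "emb u i \<in> K"
  by (auto simp: emb_def intro: K_add K_mult \<iota>_K \<gamma>K)

lemma emb_kvecs: "u \<in> svecs N \<Longrightarrow> emb u \<in> kvecs"
  by (auto simp: kvecs_def emb_K) (auto simp: emb_def svecs_def fvecs_def \<iota>_0)

lemma emb_add: "emb (u + v) = (\<lambda>i. emb u i + emb v i)"
  by (simp add: emb_def \<iota>_add algebra_simps)

lemma emb_inj: "inj emb"
proof (rule injI)
  fix u v assume eq: "emb u = emb v"
  have "fst u i = fst v i \<and> snd u i = snd v i" for i
    using fun_cong[OF eq, of i] injD[OF pair_inj, of "(fst u i, snd u i)" "(fst v i, snd v i)"]
    by (simp add: emb_def)
  then show "u = v" by (simp add: prod_eq_iff fun_eq_iff)
qed

lemma emb_0: "emb 0 = (\<lambda>_. 0)"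
  by (simp add: emb_def \<iota>_0)

lemma emb_surj:
  assumes c: "c \<in> kvecs"
  obtains u where "u \<in> svecs N" "emb u = c"
proof -
  have "\<forall>i. \<exists>p. c i = \<iota> (fst p) + \<gamma> * \<iota> (snd p)"
    using c K_eq unfolding kvecs_def by (auto simp: image_iff split_def)
  then obtain p where p: "\<And>i. c i = \<iota> (fst (p i)) + \<gamma> * \<iota> (snd (p i))" by metis
  show ?thesis
  proof (rule that[of "(\<lambda>i. fst (p i), \<lambda>i. snd (p i))"])
    have "fst (p i) = 0 \<and> snd (p i) = 0" if "i \<ge> N" for i
      using p[of i] c that pair_eq_0_iff[of "fst (p i)" "snd (p i)"] by (simp add: kvecs_def)
    then show "(\<lambda>i. fst (p i), \<lambda>i. snd (p i)) \<in> svecs N" by (simp add: svecs_def fvecs_def)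
  qed (simp add: emb_def p fun_eq_iff)
qed

lemma symp_wt_emb: "symp_wt n (fst u) (snd u) = hamming_wt n (emb u)"
  unfolding symp_wt_def hamming_wt_def emb_def using pair_eq_0_iff by (metis (no_types, lifting))

definition C where "C = {u \<in> svecs N. emb u \<in> bch_code Q \<alpha> \<delta>}"
definition D where "D = orth N C"

lemma emb_uminus: "emb (- u) = (\<lambda>i. - 1 * emb u i)"
  by (simp add: emb_def \<iota>_minus)

lemma one_K: "1 \<in> K"
  by (simp add: K_def)

lemma add_subgroup_C: "add_subgroup C"
proof -
  have "(\<lambda>_. 0) \<in> bch_code Q \<alpha> \<delta>" by (simp add: bch_code_iff kvecs_def K_0 ev_def)
  moreover have "- 1 \<in> K" by (rule K_uminus[OF one_K])
  ultimately show ?thesis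
    unfolding add_subgroup_def C_def using add_subgroupD[OF add_subgroup_svecs[of N]]
    by (auto simp only: emb_0 emb_add emb_uminus mem_Collect_eq intro: bch_code_add bch_code_scale)
qed

lemma C_svecs: "C \<subseteq> svecs N"
  by (auto simp: C_def)

lemma card_C: "card Z \<le> N \<Longrightarrow> card C = q ^ (2 * (N - card Z))"
proof -
  assume Z: "card Z \<le> N"
  have "emb ` C = bch_code Q \<alpha> \<delta>"
  proof (intro equalityI subsetI)
    fix c assume c: "c \<in> bch_code Q \<alpha> \<delta>"
    then have "c \<in> kvecs" by (simp add: bch_code_iff)
    then obtain u where "u \<in> svecs N" "emb u = c" by (rule emb_surj)
    then show "c \<in> emb ` C" using c by (auto simp: C_def)
  qed (auto simp: C_def)
  moreover have "inj_on emb C" using emb_inj inj_on_subset by blast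
  ultimately have "card C = card (bch_code Q \<alpha> \<delta>)" by (metis card_image)
  then show ?thesis using card_bch_code[OF Z] by (simp add: card_K power_mult)
qed

text \<open>With \<open>H\<close> the Hermitian product, \<open>H - H ^ q\<close> is a multiple of the symplectic product, which
  vanishes because \<open>C\<close> is closed under scaling by the small field; scaling by \<open>\<gamma>\<close> then gives \<open>H = 0\<close>.\<close>

lemma D_hermitian_orth:
  assumes v: "v \<in> D" and c: "c \<in> bch_code Q \<alpha> \<delta>"
  shows "(\<Sum>i<N. c i * emb v i ^ q) = 0"
proof -
  define H where "H c = (\<Sum>i<N. c i * emb v i ^ q)" for c
  have real: "H c ^ q = H c" if c: "c \<in> bch_code Q \<alpha> \<delta>" for c
  proof -
    have "c \<in> kvecs" using c by (simp add: bch_code_iff)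
    then obtain u where u: "u \<in> svecs N" "emb u = c" by (rule emb_surj)
    define s where "s = dot N (snd u) (fst v) - dot N (fst u) (snd v)"
    have "chi (t * s) = 1" for t
    proof -
      define tu where "tu = ((\<lambda>i. t * fst u i), (\<lambda>i. t * snd u i))"
      have "emb tu = (\<lambda>i. \<iota> t * c i)"
        using u(2) by (auto simp: emb_def tu_def \<iota>_mult algebra_simps)
      then have "tu \<in> C"
        using u c bch_code_scale[OF c \<iota>_K[of t]] by (auto simp: C_def tu_def svecs_def fvecs_def)
      then have "sympc N tu v = 1" using v by (simp add: D_def orth_def)
      then show ?thesis
        by (simp add: sympc_def tu_def s_def dot_def sum_distrib_left algebra_simps)
    qed
    then have "s = 0" by (rule chi_nontrivial)
    \<comment> \<open>The identity \<open>H - H^q = (\<gamma> - \<gamma>^q) * \<iota> s\<close>,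
      rearranged so that each side is a sum.\<close>
    have "H c + (\<gamma> ^ q) * \<iota> (dot N (snd u) (fst v)) + \<gamma> * \<iota> (dot N (fst u) (snd v))
        = H c ^ q + \<gamma> * \<iota> (dot N (snd u) (fst v)) + \<gamma> ^ q * \<iota> (dot N (fst u) (snd v))"
    proof -
      have "H c ^ q = (\<Sum>i<N. c i ^ q * emb v i)"
        unfolding H_def conj_sum by (simp add: power_mult_distrib conj_conj[OF emb_K])
      then show ?thesis
        unfolding H_def u(2)[symmetric] emb_def dot_def
        by (simp add: conj_add power_mult_distrib \<iota>_conj \<iota>_sum \<iota>_mult sum_distrib_left algebra_simps
            flip: sum.distrib)
    qed
    moreover have "dot N (snd u) (fst v) = dot N (fst u) (snd v)" using \<open>s = 0\<close> by (simp add: s_def)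
    ultimately show ?thesis by (simp add: add_ac)
  qed
  have "H (\<lambda>i. \<gamma> * c i) = \<gamma> * H c" by (simp add: H_def sum_distrib_left mult.assoc)
  then have "(\<gamma> * H c) ^ q = \<gamma> * H c" using real[OF bch_code_scale[OF c \<gamma>K]] by simp
  then have "\<gamma> ^ q * H c = \<gamma> * H c" using real[OF c] by (simp add: power_mult_distrib)
  then have "H c = 0" using \<gamma>q by simp
  then show ?thesis by (simp add: H_def)
qed

lemma D_svecs: "v \<in> D \<Longrightarrow> v \<in> svecs N"
  by (simp add: D_def orth_def)

text \<open>With \<open>y\<close> the residue of \<open>- q * x\<close> modulo \<open>N\<close>, the
  \<open>q\<close>-th power of the evaluation at \<open>\<alpha> ^ x\<close> becomes the sum that
  the trace words for \<open>y\<close> test. They belong to the code since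
  \<open>not_dvd_hermitian\<close> gives \<open>y \<notin> Z\<close>. The value \<open>x = 0\<close>
  is included for the sake of the phases in characteristic 2.\<close>

lemma D_root:
  assumes v: "v \<in> D" and x: "x \<le> delta_max q m"
  shows "ev (emb v) (\<alpha> ^ x) = 0"
proof -
  define y where "y = (N - q * x mod N) mod N"
  have yN: "y < N" using N_pos by (simp add: y_def)
  have "(y + q * x) mod N = 0"
  proof -
    have "(y + q * x) mod N = ((N - q * x mod N) + q * x mod N) mod N"
      unfolding y_def mod_add_left_eq mod_add_right_eq ..
    also have "(N - q * x mod N) + q * x mod N = N" using N_pos by (simp add: less_imp_le)
    finally show ?thesis by simp
  qed
  then have dvd: "N dvd y + q * x" by (simp add: dvd_eq_mod_eq_0)
  have "\<alpha> ^ y * \<alpha> ^ (q * x) = 1"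
    using power_eq_iff[of "y + q * x" 0] dvd by (simp add: power_add)
  then have inv: "inverse \<alpha> ^ y = \<alpha> ^ (q * x)"
    unfolding power_inverse by (rule inverse_unique)
  have "y \<notin> Z"
  proof
    assume "y \<in> Z"
    then obtain z k where z: "z \<in> {1..<\<delta>}" "y = z * Q ^ k mod N"
      by (auto simp: Z_def defining_set_def cyclo_coset_def)
    have "N dvd q * x + z * Q ^ k"
      using dvd unfolding z(2) dvd_eq_mod_eq_0 mod_add_left_eq by (simp add: add.commute)
    then have "q ^ (2 * m) - 1 dvd q * x + z * (q\<^sup>2) ^ k" unfolding N_q using Qq by simp
    moreover have "1 \<le> z" "z \<le> q ^ m - 2" using z(1) \<delta> by auto
    ultimately show False using not_dvd_hermitian[OF q2 m1 _ _ x] by blast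
  qed
  have "(\<Sum>i<N. inverse \<alpha> ^ (y * i) * emb v i ^ q) = 0"
    by (rule trace_word_orthogonal_imp_root)
      (auto intro: K_power emb_K D_hermitian_orth[OF v trace_word_in_bch_code[OF yN \<open>y \<notin> Z\<close>]])
  moreover have "ev (emb v) (\<alpha> ^ x) ^ q = (\<Sum>i<N. inverse \<alpha> ^ (y * i) * emb v i ^ q)"
    unfolding ev_def conj_sum
  proof (intro sum.cong refl)
    fix i
    have "inverse \<alpha> ^ (y * i) = \<alpha> ^ (q * x * i)" using inv by (simp add: power_mult)
    moreover have "((\<alpha> ^ x) ^ i) ^ q = \<alpha> ^ (q * x * i)" by (simp add: mult_ac flip: power_mult)
    ultimately show "(emb v i * (\<alpha> ^ x) ^ i) ^ q = inverse \<alpha> ^ (y * i) * emb v i ^ q"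
      by (simp add: power_mult_distrib)
  qed
  ultimately show ?thesis by simp
qed

lemma \<delta>_le_delta_max: "\<delta> \<le> delta_max q m"
proof (cases "even m")
  case True
  then have "m \<ge> 2" using m1 by (auto elim: evenE)
  then have "q\<^sup>2 \<le> q ^ m" using q2 by (intro power_increasing) auto
  moreover have "2 * q ^ m \<le> q ^ (m + 1)" using q2 by simp
  ultimately have "q ^ m + q\<^sup>2 \<le> q ^ (m + 1)" by linarith
  then show ?thesis using \<delta> True by (simp add: delta_max_def)
qed (use \<delta> in \<open>simp add: delta_max_def\<close>)

lemma D_subset_C: "D \<subseteq> C"
proof
  fix v assume v: "v \<in> D"
  have "ev (emb v) (\<alpha> ^ z) = 0" if "z \<in> {1..<\<delta>}" for z
    using D_root[OF v, of z] that \<delta>_le_delta_max by simp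
  then show "v \<in> C" using D_svecs[OF v] by (simp add: C_def bch_code_iff emb_kvecs)
qed

lemma D_isotropic: "u \<in> D \<Longrightarrow> v \<in> D \<Longrightarrow> sympc N u v = 1"
  using D_subset_C by (auto simp: D_def orth_def)

lemma add_subgroup_D: "add_subgroup D"
  unfolding D_def by (rule add_subgroup_orth)

lemma emb_nz: "u \<noteq> 0 \<Longrightarrow> emb u \<noteq> (\<lambda>_. 0)"
  using injD[OF emb_inj, of u 0] by (auto simp: emb_0)

lemma C_weight: "u \<in> C \<Longrightarrow> u \<noteq> 0 \<Longrightarrow> symp_wt N (fst u) (snd u) \<ge> \<delta>"
  unfolding symp_wt_emb using weight_gt[of "emb u" "\<delta> - 1"] \<delta> emb_nz[of u]
  by (force simp: C_def bch_code_iff)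

lemma D_weight: "u \<in> D \<Longrightarrow> u \<noteq> 0 \<Longrightarrow> symp_wt N (fst u) (snd u) > delta_max q m"
  unfolding symp_wt_emb
  by (rule weight_gt) (auto intro: emb_kvecs D_svecs D_root dest: emb_nz)

section \<open>Rotations of words and the diagonal in characteristic 2\<close>

definition cyclic_shift :: "nat \<Rightarrow> (nat \<Rightarrow> 'a) \<Rightarrow> nat \<Rightarrow> 'a" where
  "cyclic_shift j a = (\<lambda>i. if i < N then a ((i + j) mod N) else 0)"

lemma dot_cyclic_shift: "dot N (cyclic_shift j a) (cyclic_shift j b) = dot N a b"
  unfolding dot_def
  using sum.reindex_bij_betw[OF bij_rotate[of j], of "\<lambda>i. a i * b i"]
  by (simp add: cyclic_shift_def)

lemma cyclic_shift_inverse: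
  assumes "a \<in> fvecs N" "j \<le> N"
  shows "cyclic_shift j (cyclic_shift (N - j) a) = a"
proof
  fix i
  show "cyclic_shift j (cyclic_shift (N - j) a) i = a i"
  proof (cases "i < N")
    case True
    have "((i + j) mod N + (N - j)) mod N = (i + j + (N - j)) mod N" by (simp add: mod_add_left_eq)
    also have "\<dots> = i" using True assms(2) by simp
    finally show ?thesis using True N_pos by (simp add: cyclic_shift_def)
  qed (use assms(1) in \<open>simp add: cyclic_shift_def fvecs_def\<close>)
qed

abbreviation rot2 where "rot2 j u \<equiv> (cyclic_shift j (fst u), cyclic_shift j (snd u))"

lemma rot2_svecs: "rot2 j u \<in> svecs N"
  by (simp add: svecs_def fvecs_def cyclic_shift_def)

lemma rot2_C:
  assumes u: "u \<in> C"
  shows "rot2 j u \<in> C"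
proof -
  have "emb (rot2 j u) = (\<lambda>i. if i < N then emb u ((i + j) mod N) else 0)"
    by (auto simp: emb_def cyclic_shift_def \<iota>_0)
  then show ?thesis using u bch_code_rotate[of "emb u" j] by (simp add: C_def rot2_svecs)
qed

text \<open>\<open>C\<close> and the symplectic form are invariant under rotation; rotating the
  words of \<open>C\<close> backwards carries this over to the orthogonal.\<close>

lemma rot2_D:
  assumes v: "v \<in> D" and j: "j \<le> N"
  shows "rot2 j v \<in> D"
proof -
  have "sympc N u (rot2 j v) = 1" if u: "u \<in> C" for u
  proof -
    have uf: "fst u \<in> fvecs N" "snd u \<in> fvecs N" using u by (auto simp: C_def svecs_def)
    have "u = rot2 j (rot2 (N - j) u)" using cyclic_shift_inverse[OF uf(1) j] cyclic_shift_inverse[OF uf(2) j] by simp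
    then have "sympc N u (rot2 j v) = sympc N (rot2 j (rot2 (N - j) u)) (rot2 j v)" by simp
    also have "\<dots> = sympc N (rot2 (N - j) u) v" by (simp add: sympc_def dot_cyclic_shift)
    also have "\<dots> = 1" using v rot2_C[OF u] by (simp add: D_def orth_def)
    finally show ?thesis .
  qed
  then show ?thesis by (simp add: D_def orth_def rot2_svecs)
qed

text \<open>In characteristic 2 the map \<open>u \<mapsto> chi (dot N (snd u) (fst u))\<close> is a rotation invariant sign
  character of \<open>D\<close>. The sum of the \<open>N\<close> rotations of a word of \<open>D\<close> is zero, as 1 is a root of its
  polynomial, and \<open>N\<close> is odd.\<close>

lemma D_diagonal_trivial:
  assumes char2: "CHAR('a) = 2" and v: "v \<in> D"
  shows "chi (dot N (snd v) (fst v)) = 1"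
proof -
  define f where "f u = chi (dot N (snd u) (fst u))" for u :: "'a svec"
  have sq: "chi x * chi x = 1" for x :: 'a
    using chi_power_CHAR[of x] by (simp add: char2 power2_eq_square)
  \<comment> \<open>Isotropy equates the two cross terms, whose product is then the square of a
    sign.\<close>
  have f_add: "f (u + w) = f u * f w" if "u \<in> D" "w \<in> D" for u w
  proof -
    have "chi (dot N (snd u) (fst w)) = chi (dot N (snd w) (fst u))"
      using D_isotropic[OF that] by (simp add: sympc_def chi_diff dot_commute)
    then show ?thesis
      using sq[of "dot N (snd w) (fst u)"]
      by (simp add: f_def dot_add_left dot_add_right chi_add mult_ac)
  qed
  have partial: "(\<Sum>j<k. rot2 j v) \<in> D \<and> f (\<Sum>j<k. rot2 j v) = f v ^ k" if "k \<le> N" for k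
    using that
  proof (induction k)
    case 0
    show ?case using add_subgroupD(1)[OF add_subgroup_D] by (simp add: f_def)
  next
    case (Suc k)
    have "rot2 k v \<in> D" using rot2_D[OF v] Suc.prems by simp
    moreover have "f (rot2 k v) = f v" by (simp add: f_def dot_cyclic_shift)
    ultimately show ?case
      using Suc f_add add_subgroupD(2)[OF add_subgroup_D] by (simp add: mult.commute)
  qed
  have total: "(\<Sum>j<N. cyclic_shift j a i) = (if i < N then \<Sum>j<N. a j else 0)" for a i
    using sum.reindex_bij_betw[OF bij_rotate[of i], of a] by (simp add: cyclic_shift_def add.commute)
  \<comment> \<open>At exponent 0 evaluation is the sum of the coordinates; independence of 1 and
    \<gamma> separates it into the two component sums.\<close>
  have "ev (emb v) (\<alpha> ^ 0) = 0" by (rule D_root[OF v]) simp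
  then have "\<iota> (\<Sum>i<N. fst v i) + \<gamma> * \<iota> (\<Sum>i<N. snd v i) = 0"
    by (simp add: ev_def emb_def \<iota>_sum sum.distrib sum_distrib_left)
  then have sums: "(\<Sum>i<N. fst v i) = 0" "(\<Sum>i<N. snd v i) = 0" by (simp_all add: pair_eq_0_iff)
  have "(\<Sum>j<N. rot2 j v) = 0"
  proof -
    have "fst (\<Sum>j<N. rot2 j v) = (\<Sum>j<N. cyclic_shift j (fst v))"
      "snd (\<Sum>j<N. rot2 j v) = (\<Sum>j<N. cyclic_shift j (snd v))"
      by (simp_all add: fst_sum snd_sum)
    moreover have "(\<Sum>j<N. cyclic_shift j (fst v)) = 0" "(\<Sum>j<N. cyclic_shift j (snd v)) = 0"
    proof -
      have "(\<Sum>j<N. cyclic_shift j a) i = (if i < N then \<Sum>j<N. a j else 0)" for a i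
        unfolding total[symmetric] by (rule sum_fun_apply)
      then show "(\<Sum>j<N. cyclic_shift j (fst v)) = 0" "(\<Sum>j<N. cyclic_shift j (snd v)) = 0"
        using sums by (simp_all add: fun_eq_iff)
    qed
    ultimately show ?thesis by (simp add: prod_eq_iff)
  qed
  then have pow: "f v ^ N = 1" using partial[of N] by (simp add: f_def)
  have "even q"
    unfolding q CARD_eq_CHAR_power_ff_deg[where 'a='a] char2 using ff_deg_pos[where 'a='a] by simp
  then have "even (q ^ (2 * m))" using m1 by simp
  then have "odd N" using q2 unfolding N_q by simp
  then obtain k where "N = 2 * k + 1" by (elim oddE)
  then have "f v ^ N = (f v * f v) ^ k * f v" by (simp add: power_mult power2_eq_square)
  then show ?thesis using pow sq by (simp add: f_def)
qed

end

section \<open>Dimension count and assembly of the code\<close>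

lemma two_mult_le_power:
  fixes q m :: nat
  assumes "q \<ge> 2" "m \<ge> 1"
  shows "2 * m \<le> q ^ m"
  using assms(2)
proof (induction m rule: nat_induct_at_least)
  case (Suc m)
  have "2 * q ^ m \<le> q * q ^ m" using assms(1) by simp
  then have "2 * (2 * m) \<le> q ^ Suc m" using Suc.IH unfolding power_Suc by linarith
  moreover have "2 * Suc m \<le> 2 * (2 * m)" using Suc.hyps by simp
  ultimately show ?case by (rule order.trans[rotated])
qed (use assms(1) in simp)

text \<open>\<open>\<alpha> ^ s\<close> generates the multiplicative group of \<open>K\<close>, of
  order \<open>q^2 - 1\<close>. As \<open>1 < q < q^2 - 1\<close>, its powers with exponents 1 and
  \<open>q\<close> differ.\<close>

lemma (in primitive_bch) ex_K_not_fixed: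
  assumes Qq: "Q = q\<^sup>2" and q: "q \<ge> 2"
  shows "\<exists>\<gamma>\<in>K. \<gamma> ^ q \<noteq> \<gamma>"
proof -
  define s where "s = N div (Q - 1)"
  have N: "N = s * (Q - 1)"
    using minus_1_dvd_power_minus_1[of Q m] Q2 unfolding s_def N_def by simp
  have "s > 0" using N N_pos by (cases s) auto
  have "q * q > q + 1"
  proof -
    have "q * q \<ge> 3 * q" if "q \<ge> 3" using that by (intro mult_right_mono) auto
    then show ?thesis using q by (cases "q = 2") (simp, linarith)
  qed
  then have "q < Q - 1" unfolding Qq power2_eq_square by simp
  then have less: "s * q < N" using \<open>s > 0\<close> by (subst N) (rule mult_strict_left_mono)
  show ?thesis
  proof (rule bexI[of _ "\<alpha> ^ s"])
    have "s * Q = s + N" unfolding N using Q2 by (cases Q) auto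
    then have "s * Q mod N = s mod N" by simp
    then show "\<alpha> ^ s \<in> K" unfolding K_def by (simp add: power_eq_iff flip: power_mult)
    show "(\<alpha> ^ s) ^ q \<noteq> \<alpha> ^ s"
    proof
      assume "(\<alpha> ^ s) ^ q = \<alpha> ^ s"
      then have "s * q mod N = s mod N" by (simp add: power_eq_iff flip: power_mult)
      moreover have "s * 1 \<le> s * q" using q by (intro mult_left_mono) auto
      then have "s < N" using less by linarith
      ultimately show False using less q \<open>s > 0\<close> by simp
    qed
  qed
qed

context hermitian_bch
begin

lemma card_Z: "card Z = m * ((\<delta> - 1) - (\<delta> - 1) div q\<^sup>2)"
proof -
  have "card Z = card (defining_set (q\<^sup>2) (q ^ (2 * m) - 1) \<delta>)"
    unfolding Z_def N_q using Qq by simp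
  also have "\<dots> = m * ((\<delta> - 1) - (\<delta> - 1) div q\<^sup>2)"
    using \<delta> q2 m1 by (intro card_defining_set) auto
  finally show ?thesis .
qed

text \<open>Makes the exponent of the quantum dimension positive and \<open>D\<close> strictly
  smaller than \<open>C\<close>.\<close>

lemma two_card_Z_less: "2 * card Z < N"
proof -
  have "card Z \<le> m * (q ^ m - 2)" unfolding card_Z using \<delta> by (intro mult_left_mono) auto
  then have "2 * card Z \<le> (2 * m) * (q ^ m - 2)" by simp
  also have "\<dots> \<le> q ^ m * (q ^ m - 2)"
    using two_mult_le_power[OF q2 m1] by (intro mult_right_mono) auto
  also have "\<dots> = q ^ (2 * m) - 2 * q ^ m" by (simp add: mult_2 power_add diff_mult_distrib2)
  also have "\<dots> < N"
  proof -
    have "1 < 2 * q ^ m" using q2 by (simp add: Suc_lessI)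
    moreover have "1 < q ^ (2 * m)" using N_pos unfolding N_q by simp
    ultimately show ?thesis unfolding N_q by linarith
  qed
  finally show ?thesis .
qed

lemma card_D: "card D = q ^ (2 * card Z)"
proof -
  have "q ^ (2 * (N - card Z)) * card D = q ^ (2 * N)"
    using card_orth[OF add_subgroup_C C_svecs] card_C two_card_Z_less unfolding D_def q by simp
  also have "2 * N = 2 * (N - card Z) + 2 * card Z" using two_card_Z_less by simp
  also have "q ^ \<dots> = q ^ (2 * (N - card Z)) * q ^ (2 * card Z)" by (rule power_add)
  finally show ?thesis using q2 by simp
qed

lemma stabilizer_code_exists:
  "\<exists>S :: 'a qop set. abelian_pauli_subgroup N S \<and> qdim N S = q ^ (N - 2 * card Z)
    \<and> qmin_dist N S \<ge> \<delta> \<and> pure_up_to N S (delta_max q m + 1)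
    \<and> (bch_min_dist Q \<alpha> \<delta> \<le> delta_max q m \<longrightarrow>
         is_pure N S \<and> qmin_dist N S = bch_min_dist Q \<alpha> \<delta>)"
proof -
  have Dsub: "D \<subseteq> svecs N" using D_svecs by blast
  obtain \<phi> where \<phi>: "\<And>u. \<phi> u \<in> range (\<lambda>c. omega TYPE('a) ^ c)"
    "\<And>u v. u \<in> D \<Longrightarrow> v \<in> D \<Longrightarrow> \<phi> (u + v) = \<phi> u * \<phi> v * chi (dot N (snd u) (fst v))"
    by (rule pauli_phase_exists[OF add_subgroup_D Dsub D_isotropic D_diagonal_trivial]) blast+
  interpret st: phased_isotropic N D \<phi>
    using add_subgroup_D Dsub D_isotropic \<phi> by unfold_locales blast+
  let ?S = "st.stab"
  define wt where "wt u = symp_wt N (fst u) (snd u)" for u :: "'a svec"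
  have orthD: "orth N D = C" unfolding D_def by (rule orth_orth[OF add_subgroup_C C_svecs])
  \<comment> \<open>Equal errors have equal vectors, so removing the errors of \<open>D\<close> with
    any phase leaves just those of \<open>C - D\<close>.\<close>
  have diff: "normalizer N ?S - scalar_S N ?S
      = {phased_pauli N (omega TYPE('a) ^ c) v | c v. v \<in> C - D}"
  proof (intro equalityI subsetI)
    fix E assume "E \<in> normalizer N ?S - scalar_S N ?S"
    then show "E \<in> {phased_pauli N (omega TYPE('a) ^ c) v | c v. v \<in> C - D}"
      unfolding st.normalizer_stab st.scalar_S_stab orthD by blast
  next
    fix E assume "E \<in> {phased_pauli N (omega TYPE('a) ^ c) v | c v. v \<in> C - D}"
    then obtain c v where v: "v \<in> C" "v \<notin> D" "E = phased_pauli N (omega TYPE('a) ^ c) v" by blast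
    have "E \<notin> scalar_S N ?S"
    proof
      assume "E \<in> scalar_S N ?S"
      then obtain c' u where "u \<in> D" "E = phased_pauli N (omega TYPE('a) ^ c') u"
        unfolding st.scalar_S_stab by blast
      then have "v = u \<and> omega TYPE('a) ^ c = omega TYPE('a) ^ c'"
        using v C_svecs Dsub by (intro phased_pauli_eqD) auto
      then show False using v \<open>u \<in> D\<close> by simp
    qed
    then show "E \<in> normalizer N ?S - scalar_S N ?S"
      unfolding st.normalizer_stab orthD using v by blast
  qed
  have wts: "pauli_wt N ` (normalizer N ?S - scalar_S N ?S) = wt ` (C - D)"
  proof (intro equalityI subsetI)
    fix w assume "w \<in> pauli_wt N ` (normalizer N ?S - scalar_S N ?S)"
    then obtain c v where v: "v \<in> C - D" "w = pauli_wt N (phased_pauli N (omega TYPE('a) ^ c) v)"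
      unfolding diff by blast
    moreover have "v \<in> svecs N" using v(1) C_svecs by blast
    ultimately show "w \<in> wt ` (C - D)" by (auto simp: wt_def pauli_wt_phased_pauli)
  next
    fix w assume "w \<in> wt ` (C - D)"
    then obtain v where v: "v \<in> C - D" "w = wt v" by blast
    have "v \<in> svecs N" using v(1) C_svecs by blast
    then have "w = pauli_wt N (phased_pauli N (omega TYPE('a) ^ 0) v)"
      unfolding v(2) wt_def by (subst pauli_wt_phased_pauli) auto
    then show "w \<in> pauli_wt N ` (normalizer N ?S - scalar_S N ?S)" unfolding diff using v(1) by blast
  qed
  have qmin: "qmin_dist N ?S = Inf (wt ` (C - D))" by (simp add: qmin_dist_def wts)
  \<comment> \<open>Strictness keeps \<open>C - D\<close> nonempty; an infimum over an empty set of
    naturals would say nothing about the distance.\<close>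
  have "card D < card C"
    using card_C card_D two_card_Z_less q2 by (simp add: power_strict_increasing)
  then have ne: "C - D \<noteq> {}"
    using C_svecs finite_svecs[where 'a='a and n=N] by (metis Diff_eq_empty_iff card_mono finite_subset Dsub leD)
  have nz: "v \<noteq> 0" if "v \<in> C - D" for v
    using that add_subgroupD(1)[OF add_subgroup_D] by auto
  have "Inf (wt ` (C - D)) \<in> wt ` (C - D)" using ne by (intro Inf_nat_def1) simp
  then have min_ge: "qmin_dist N ?S \<ge> \<delta>"
    unfolding qmin using C_weight nz by (auto simp: wt_def)
  have qd: "qdim N ?S = q ^ (N - 2 * card Z)"
  proof -
    have "qdim N ?S * q ^ (2 * card Z) = q ^ N" using st.qdim_stab by (simp add: card_D q)
    also have "\<dots> = q ^ (N - 2 * card Z) * q ^ (2 * card Z)"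
      using two_card_Z_less by (simp flip: power_add)
    finally show ?thesis using q2 by simp
  qed
  have pure: "pure_up_to N ?S (delta_max q m + 1)"
    unfolding pure_up_to_def
  proof (intro ballI impI)
    fix E assume E: "E \<in> ?S" "E \<notin> scalars N"
    then obtain u where u: "u \<in> D" "E = phased_pauli N (\<phi> u) u" by (auto simp: st.stab_def)
    obtain c where c: "\<phi> u = omega TYPE('a) ^ c" by (rule st.phase_obtain)
    have "u \<noteq> 0"
    proof
      assume "u = 0"
      then have "E = phased_pauli N (omega TYPE('a) ^ c) 0" using u(2) c by simp
      then show False using E(2) unfolding scalars_eq by blast
    qed
    then show "pauli_wt N E \<ge> delta_max q m + 1"
      using D_weight[OF u(1)] D_svecs[OF u(1)] by (simp add: u(2) c pauli_wt_phased_pauli)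
  qed
  have "is_pure N ?S \<and> qmin_dist N ?S = bch_min_dist Q \<alpha> \<delta>" if d: "bch_min_dist Q \<alpha> \<delta> \<le> delta_max q m"
  proof -
    let ?B = "{hamming_wt N c | c. c \<in> bch_code Q \<alpha> \<delta> \<and> c \<noteq> (\<lambda>_. 0)}"
    have bd: "bch_min_dist Q \<alpha> \<delta> = Inf ?B" unfolding bch_min_dist_def N_CARD ..
    have inB: "wt v \<in> ?B" if "v \<in> C" "v \<noteq> 0" for v
      using that emb_nz[of v] by (auto simp: wt_def symp_wt_emb C_def)
    have "?B \<noteq> {}" using ne inB nz by blast
    then have "Inf ?B \<in> ?B" by (rule Inf_nat_def1)
    then obtain c where c: "c \<in> bch_code Q \<alpha> \<delta>" "c \<noteq> (\<lambda>_. 0)" "Inf ?B = hamming_wt N c" by blast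
    have "c \<in> kvecs" using c(1) by (simp add: bch_code_iff)
    then obtain v where v: "v \<in> svecs N" "emb v = c" by (rule emb_surj)
    have "v \<in> C" using v c by (simp add: C_def)
    have "v \<noteq> 0" using v c emb_0 by auto
    have wv: "wt v = bch_min_dist Q \<alpha> \<delta>" using bd c v by (simp add: wt_def symp_wt_emb)
    \<comment> \<open>The bound on the classical distance enters here: a nonzero word of
      \<open>D\<close> would be too heavy.\<close>
    then have "v \<notin> D" using D_weight[of v] \<open>v \<noteq> 0\<close> d by (auto simp: wt_def)
    then have "Inf (wt ` (C - D)) \<le> bch_min_dist Q \<alpha> \<delta>"
      unfolding wv[symmetric] using \<open>v \<in> C\<close> by (intro cInf_lower) auto
    moreover have "bch_min_dist Q \<alpha> \<delta> \<le> Inf (wt ` (C - D))"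
      unfolding bd using ne inB nz by (intro cInf_superset_mono) auto
    ultimately have eq: "qmin_dist N ?S = bch_min_dist Q \<alpha> \<delta>" by (simp add: qmin)
    then have "is_pure N ?S" using pure d unfolding is_pure_def pure_up_to_def by fastforce
    then show ?thesis using eq by simp
  qed
  then show ?thesis using st.abelian_stab qd min_ge pure by blast
qed

end

theorem mainTheorem11:
  fixes m \<delta> :: nat and \<alpha> :: "'b::{finite,field}"
  assumes "m \<ge> 1"
    and "2 \<le> \<delta>" and "\<delta> \<le> CARD('a::{finite,field}) ^ m - 1"
    and "CARD('b) = CARD('a) ^ (2 * m)"
    and "primitive_elt \<alpha>"
  shows "let q = CARD('a); n = q ^ (2 * m) - 1;
             e = (if even m then 1 else 0 :: nat);
             \<delta>max = int q ^ (m + e) - 1 - (int q ^ 2 - 2) * int e;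
             k = int n - 2 * int m * \<lceil>(real \<delta> - 1) * (1 - 1 / real q ^ 2)\<rceil>
         in \<exists>S :: 'a qop set.
              abelian_pauli_subgroup n S
            \<and> 0 \<le> k \<and> qdim n S = q ^ nat k
            \<and> qmin_dist n S \<ge> \<delta>
            \<and> pure_up_to n S (nat (\<delta>max + 1))
            \<and> (int (bch_min_dist (q ^ 2) \<alpha> \<delta>) \<le> \<delta>max \<longrightarrow>
                 is_pure n S \<and> qmin_dist n S = bch_min_dist (q ^ 2) \<alpha> \<delta>)"
proof -
  define q where "q = CARD('a)"
  have q2: "q \<ge> 2" unfolding q_def by (rule CARD_field_ge_2)
  have qm: "q ^ m \<ge> 3" using assms(2,3) unfolding q_def by linarith
  have "q ^ m \<le> q ^ (2 * m)" using q2 by (intro power_increasing) auto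
  then have gt2: "CARD('b) > 2" using qm assms(4) unfolding q_def by linarith
  have CHAR: "CHAR('b) = CHAR('a)" by (rule CHAR_eq_of_CARD_power[OF assms(4)])
  define e where "e = 2 * ff_deg TYPE('a)"
  have Qe: "q\<^sup>2 = CHAR('b) ^ e"
    unfolding q_def e_def CHAR CARD_eq_CHAR_power_ff_deg[where 'a='a] by (simp add: mult.commute flip: power_mult)
  interpret primitive_bch \<alpha> "q\<^sup>2" m \<delta> e
  proof
    show "CARD('b) = (q\<^sup>2) ^ m" using assms(4) by (simp add: q_def power_mult)
    show "2 \<le> q\<^sup>2" using q2 self_le_power[of q 2] by simp
  qed (use Qe assms gt2 in auto)
  obtain \<iota> :: "'a \<Rightarrow> 'b" where \<iota>: "\<iota> 1 = 1" "\<And>x y. \<iota> (x + y) = \<iota> x + \<iota> y"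
    "\<And>x y. \<iota> (x * y) = \<iota> x * \<iota> y" "inj \<iota>"
    by (rule finite_field_embedding[OF assms(4) _ gt2 assms(5)]) (use assms(1) in auto)
  obtain \<gamma> where \<gamma>: "\<gamma> \<in> K" "\<gamma> ^ q \<noteq> \<gamma>" using ex_K_not_fixed[OF refl q2] by blast
  interpret hermitian_bch \<alpha> "q\<^sup>2" m \<delta> e \<iota> \<gamma> q
    by unfold_locales (use \<iota> \<gamma> assms in \<open>auto simp: q_def\<close>)
  obtain S :: "'a qop set" where S: "abelian_pauli_subgroup N S" "qdim N S = q ^ (N - 2 * card Z)"
    "qmin_dist N S \<ge> \<delta>" "pure_up_to N S (delta_max q m + 1)"
    "bch_min_dist (q\<^sup>2) \<alpha> \<delta> \<le> delta_max q m \<longrightarrow>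
      is_pure N S \<and> qmin_dist N S = bch_min_dist (q\<^sup>2) \<alpha> \<delta>"
    using stabilizer_code_exists by (elim exE conjE)
  define f where "f = (if even m then 1 else 0 :: nat)"
  define \<delta>max where "\<delta>max = int q ^ (m + f) - 1 - (int q ^ 2 - 2) * int f"
  define k where "k = int N - 2 * int m * \<lceil>(real \<delta> - 1) * (1 - 1 / real q ^ 2)\<rceil>"
  \<comment> \<open>The natural subtractions in \<open>delta_max\<close> do not truncate, so the
    integer formula of the statement agrees with it.\<close>
  have \<delta>max: "\<delta>max = int (delta_max q m)"
  proof (cases "even m")
    case True
    have "q\<^sup>2 \<le> q ^ (m + 1)" using q2 assms(1) by (intro power_increasing) auto
    then show ?thesis using True by (simp add: \<delta>max_def f_def delta_max_def of_nat_diff)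
  qed (use qm in \<open>simp add: \<delta>max_def f_def delta_max_def of_nat_diff\<close>)
  have "(real \<delta> - 1) * (1 - 1 / real q ^ 2) = real (\<delta> - 1) * (1 - 1 / real (q\<^sup>2))"
    using assms(2) by (simp add: of_nat_diff)
  moreover have "\<lceil>real (\<delta> - 1) * (1 - 1 / real (q\<^sup>2))\<rceil> = int ((\<delta> - 1) - (\<delta> - 1) div q\<^sup>2)"
    by (rule ceiling_mult_one_minus_inverse) (use q2 in simp)
  ultimately have "\<lceil>(real \<delta> - 1) * (1 - 1 / real q ^ 2)\<rceil> = int ((\<delta> - 1) - (\<delta> - 1) div q\<^sup>2)"
    by (simp only:)
  then have "k = int N - int (2 * card Z)" unfolding k_def card_Z by simp
  then have k: "k = int (N - 2 * card Z)" using two_card_Z_less by (simp add: of_nat_diff)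
  have "abelian_pauli_subgroup N S \<and> 0 \<le> k \<and> qdim N S = q ^ nat k \<and> qmin_dist N S \<ge> \<delta>
      \<and> pure_up_to N S (nat (\<delta>max + 1))
      \<and> (int (bch_min_dist (q ^ 2) \<alpha> \<delta>) \<le> \<delta>max \<longrightarrow>
           is_pure N S \<and> qmin_dist N S = bch_min_dist (q ^ 2) \<alpha> \<delta>)"
    using S unfolding k \<delta>max by (simp add: nat_add_distrib)
  then show ?thesis
    unfolding Let_def q_def[symmetric] N_q[symmetric] f_def[symmetric] \<delta>max_def[symmetric]
      k_def[symmetric] by blast
qed

end
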